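(* There are volume-preserving quadratic $L$-$F$ systems on compact $SN$ which are semi-integrable and have positive metric entropy. That is, there exist $n$, a linear operator $L$ on $\mathbb R^n$, a rank $n$ lattice $\Gamma_0\subset\mathbb R^n$ with $e^L\Gamma_0=\Gamma_0$, and a linear vector field $F(\xi)=F\xi$ on $\mathbb R^n$ such that the $L$-$F$ flow on $SN$ preserves the Lebesgue measure $\nu$, is semi-integrable, and has positive metric entropy with respect to $\nu$.
   Context: Let $\mathfrak g_0=\mathbb R^n$ with its Euclidean scalar product and let $L:\mathfrak g_0\to\mathfrak g_0$ be a linear operator. Let $G=\mathbb R^n\times\mathbb R$ be the Lie group with coordinates $(w,u)$ and multiplication $(w,u)(w',u')=(w+e^{uL}w',u+u')$. Its Lie algebra is $\mathfrak g=\mathfrak g_0\oplus\mathbb R b$ with $\mathfrak g_0$ an abelian ideal and $\mathrm{ad}_b|_{\mathfrak g_0}=L$; it carries the scalar product extending that of $\mathfrak g_0$ with $b$ a unit vector orthogonal to $\mathfrak g_0$, and $G$ carries the corresponding left-invariant metric. Elements of $\mathfrak g$ are written $(\xi,\eta)=\xi+\eta b$, and $TG=G\times\mathfrak g$ by left translations, with coordinates $(w,u;\xi,\eta)$. Let $\Gamma_0\subset\mathbb R^n=\{u=0\}$ be a lattice of rank $n$ such that $e^L$ is an automorphism of $\Gamma_0$, and let $\Gamma\subset G$ be the discrete subgroup generated by $\Gamma_0$ and the element $(w,u)=(0,1)$. Put $N=\Gamma\backslash G$ (compact; then $\mathrm{tr}\,L=0$ and $G$ is unimodular) and $SN=N\times\mathbb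 S^n$, $\mathbb S^n=\{(\xi,\eta)\in\mathfrak g:\xi^2+\eta^2=1\}$. The Lebesgue measure $\nu$ on $SN$ is the product of the finite measure on $N$ induced by $dw\,du$ and the standard Lebesgue measure on $\mathbb S^n$. The $L$-$F$ system of a vector field $F$ is the flow of $$\frac{d\xi}{dt}=\eta F(\xi),\quad \frac{d\eta}{dt}=-\langle F(\xi),\xi\rangle,\quad \frac{dw}{dt}=e^{uL}\xi,\quad \frac{du}{dt}=\eta,$$ which is invariant under left translations and hence descends to $SN$. It is called quadratic if $F$ is linear. A dynamical system is semi-integrable if a nonempty open subset of the phase space is filled with invariant tori carrying quasi-periodic motions (the flow on each torus is conjugate to a linear flow $\theta\mapsto\theta+t\omega$). *)

theory Defs
  imports "HOL-Probability.Probability" "HOL-Algebra.Generated_Groups"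
begin

text \<open>
  The dimension \<open>n\<close> is existentially quantified in the theorem, so \<open>\<real>\<^sup>n\<close> is a carrier set rather than
  a type: the extensional functions on \<open>{..<n}\<close>. This is both the topological space
  \<^term>\<open>product_topology (\<lambda>_. euclideanreal) {..<n}\<close> and the space of the measure
  \<^term>\<open>PiM {..<n} (\<lambda>_. lborel)\<close>.
\<close>

type_synonym rvec = "nat \<Rightarrow> real"

definition Rn :: "nat \<Rightarrow> rvec set" where
  "Rn n = {..<n} \<rightarrow>\<^sub>E UNIV"

definition vzero :: "nat \<Rightarrow> rvec" where
  "vzero n = (\<lambda>i\<in>{..<n}. 0)"

definition vadd :: "nat \<Rightarrow> rvec \<Rightarrow> rvec \<Rightarrow> rvec" where
  "vadd n x y = (\<lambda>i\<in>{..<n}. x i + y i)"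

definition vscale :: "nat \<Rightarrow> real \<Rightarrow> rvec \<Rightarrow> rvec" where
  "vscale n c x = (\<lambda>i\<in>{..<n}. c * x i)"

definition vinner :: "nat \<Rightarrow> rvec \<Rightarrow> rvec \<Rightarrow> real" where
  "vinner n x y = (\<Sum>i<n. x i * y i)"

definition lincomb :: "nat \<Rightarrow> (nat \<Rightarrow> real) \<Rightarrow> (nat \<Rightarrow> rvec) \<Rightarrow> rvec" where
  "lincomb n c b = (\<lambda>i\<in>{..<n}. \<Sum>j<n. c j * b j i)"

definition linear_op :: "nat \<Rightarrow> (rvec \<Rightarrow> rvec) \<Rightarrow> bool" where
  "linear_op n A \<longleftrightarrow> A \<in> Rn n \<rightarrow> Rn n
     \<and> (\<forall>x\<in>Rn n. \<forall>y\<in>Rn n. A (vadd n x y) = vadd n (A x) (A y))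
     \<and> (\<forall>c. \<forall>x\<in>Rn n. A (vscale n c x) = vscale n c (A x))"

text \<open>\<open>exp_op n L u\<close> is the operator exponential \<open>e\<^bsup>uL\<^esup>\<close>, by its power series.\<close>

definition exp_op :: "nat \<Rightarrow> (rvec \<Rightarrow> rvec) \<Rightarrow> real \<Rightarrow> rvec \<Rightarrow> rvec" where
  "exp_op n L u x = (\<lambda>i\<in>{..<n}. \<Sum>k. u ^ k / fact k * (L ^^ k) x i)"

definition full_rank_lattice :: "nat \<Rightarrow> rvec set \<Rightarrow> bool" where
  "full_rank_lattice n \<Lambda> \<longleftrightarrow>
     (\<exists>b. (\<forall>j<n. b j \<in> Rn n)
        \<and> (\<forall>c. lincomb n c b = vzero n \<longrightarrow> (\<forall>j<n. c j = 0))
        \<and> \<Lambda> = {lincomb n (\<lambda>j. of_int (k j)) b | k :: nat \<Rightarrow> int. True})"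


section \<open>The group \<open>G\<close>, the quotient \<open>N\<close> of cosets \<open>\<Gamma>g\<close> and the unit sphere\<close>

definition LieG :: "nat \<Rightarrow> (rvec \<Rightarrow> rvec) \<Rightarrow> (rvec \<times> real) monoid" where
  "LieG n L = \<lparr>carrier = Rn n \<times> UNIV,
               mult = (\<lambda>(w, u) (w', u'). (vadd n w (exp_op n L u w'), u + u')),
               one = (vzero n, 0)\<rparr>"

definition Gam :: "nat \<Rightarrow> (rvec \<Rightarrow> rvec) \<Rightarrow> rvec set \<Rightarrow> (rvec \<times> real) set" where
  "Gam n L \<Lambda> = generate (LieG n L) ((\<lambda>\<gamma>. (\<gamma>, 0)) ` \<Lambda> \<union> {(vzero n, 1)})"

definition coset_proj ::
    "nat \<Rightarrow> (rvec \<Rightarrow> rvec) \<Rightarrow> rvec set \<Rightarrow> rvec \<times> real \<Rightarrow> (rvec \<times> real) set" where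
  "coset_proj n L \<Lambda> g = Gam n L \<Lambda> #>\<^bsub>LieG n L\<^esub> g"

definition Nspace :: "nat \<Rightarrow> (rvec \<Rightarrow> rvec) \<Rightarrow> rvec set \<Rightarrow> (rvec \<times> real) set set" where
  "Nspace n L \<Lambda> = rcosets\<^bsub>LieG n L\<^esub> Gam n L \<Lambda>"

text \<open>Elements of the Lie algebra are pairs \<open>(\<xi>, \<eta>)\<close>, standing for \<open>\<xi> + \<eta>b\<close>.\<close>

definition Sph :: "nat \<Rightarrow> (rvec \<times> real) set" where
  "Sph n = {(\<xi>, \<eta>). \<xi> \<in> Rn n \<and> vinner n \<xi> \<xi> + \<eta>\<^sup>2 = 1}"


section \<open>Topologies\<close>

definition Etop :: "nat \<Rightarrow> (rvec \<times> real) topology" where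
  "Etop n = prod_topology (product_topology (\<lambda>_. euclideanreal) {..<n}) euclideanreal"

definition quotient_topology :: "'a topology \<Rightarrow> ('a \<Rightarrow> 'b) \<Rightarrow> 'b topology" where
  "quotient_topology X q =
     topology (\<lambda>U. U \<subseteq> q ` topspace X \<and> openin X {x \<in> topspace X. q x \<in> U})"

lemma openin_quotient_topology:
  "openin (quotient_topology X q) U \<longleftrightarrow>
     U \<subseteq> q ` topspace X \<and> openin X {x \<in> topspace X. q x \<in> U}"
proof -
  have "istopology (\<lambda>U. U \<subseteq> q ` topspace X \<and> openin X {x \<in> topspace X. q x \<in> U})"
    unfolding istopology_def
  proof (intro conjI allI impI)
    fix S T
    assume S: "S \<subseteq> q ` topspace X \<and> openin X {x \<in> topspace X. q x \<in> S}"
      and T: "T \<subseteq> q ` topspace X \<and> openin X {x \<in> topspace X. q x \<in> T}"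
    show "S \<inter> T \<subseteq> q ` topspace X" using S by blast
    have "{x \<in> topspace X. q x \<in> S \<inter> T} =
        {x \<in> topspace X. q x \<in> S} \<inter> {x \<in> topspace X. q x \<in> T}" by blast
    then show "openin X {x \<in> topspace X. q x \<in> S \<inter> T}" using S T by auto
  next
    fix \<K>
    assume K: "\<forall>K\<in>\<K>. K \<subseteq> q ` topspace X \<and> openin X {x \<in> topspace X. q x \<in> K}"
    show "\<Union>\<K> \<subseteq> q ` topspace X" using K by blast
    have "{x \<in> topspace X. q x \<in> \<Union>\<K>} = (\<Union>K\<in>\<K>. {x \<in> topspace X. q x \<in> K})" by blast
    then show "openin X {x \<in> topspace X. q x \<in> \<Union>\<K>}" using K by auto
  qed
  then show ?thesis by (simp add: quotient_topology_def)
qed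

definition Ntop :: "nat \<Rightarrow> (rvec \<Rightarrow> rvec) \<Rightarrow> rvec set \<Rightarrow> (rvec \<times> real) set topology" where
  "Ntop n L \<Lambda> = quotient_topology (Etop n) (coset_proj n L \<Lambda>)"

type_synonym sn_point = "(rvec \<times> real) set \<times> (rvec \<times> real)"

definition SNtop :: "nat \<Rightarrow> (rvec \<Rightarrow> rvec) \<Rightarrow> rvec set \<Rightarrow> sn_point topology" where
  "SNtop n L \<Lambda> = prod_topology (Ntop n L \<Lambda>) (subtopology (Etop n) (Sph n))"

definition borel_of :: "'a topology \<Rightarrow> 'a measure" where
  "borel_of X = sigma (topspace X) {U. openin X U}"


section \<open>The Lebesgue measure on \<open>SN\<close>\<close>

definition Emeasure :: "nat \<Rightarrow> (rvec \<times> real) measure" where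
  "Emeasure n = PiM {..<n} (\<lambda>_. lborel) \<Otimes>\<^sub>M lborel"

definition fundamental_domain ::
    "nat \<Rightarrow> (rvec \<Rightarrow> rvec) \<Rightarrow> rvec set \<Rightarrow> (rvec \<times> real) set \<Rightarrow> bool" where
  "fundamental_domain n L \<Lambda> D \<longleftrightarrow>
     D \<in> sets (Emeasure n) \<and> bij_betw (coset_proj n L \<Lambda>) D (Nspace n L \<Lambda>)"

text \<open>
  The measure on \<open>N\<close> induced by \<open>dw du\<close>. If \<open>e\<^sup>L\<close> is an automorphism of the lattice, then \<open>dw du\<close> is
  \<open>\<Gamma>\<close>-invariant and \<open>\<Gamma>\<close> is countable, so the result does not depend on the chosen fundamental
  domain; one is \<open>P \<times> {0..<1}\<close> for a half-open fundamental parallelepiped \<open>P\<close> of the lattice.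
\<close>

definition Nmeasure :: "nat \<Rightarrow> (rvec \<Rightarrow> rvec) \<Rightarrow> rvec set \<Rightarrow> (rvec \<times> real) set measure" where
  "Nmeasure n L \<Lambda> =
     distr (restrict_space (Emeasure n) (SOME D. fundamental_domain n L \<Lambda> D))
       (borel_of (Ntop n L \<Lambda>)) (coset_proj n L \<Lambda>)"

definition Enorm :: "nat \<Rightarrow> rvec \<times> real \<Rightarrow> real" where
  "Enorm n = (\<lambda>(\<xi>, \<eta>). sqrt (vinner n \<xi> \<xi> + \<eta>\<^sup>2))"

text \<open>
  Surface measure on \<open>\<S>\<^sup>n \<subseteq> \<real>\<^sup>n\<^sup>+\<^sup>1\<close> by polar coordinates: the measure of \<open>A\<close> is \<open>n + 1\<close> times the volume
  of the cone \<open>{x. 0 < |x| \<le> 1 \<and> x / |x| \<in> A}\<close>.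
\<close>

definition Smeasure :: "nat \<Rightarrow> (rvec \<times> real) measure" where
  "Smeasure n = scale_measure (of_nat (n + 1))
     (distr (restrict_space (Emeasure n) {p. 0 < Enorm n p \<and> Enorm n p \<le> 1})
        (restrict_space (Emeasure n) (Sph n))
        (\<lambda>p. (vscale n (1 / Enorm n p) (fst p), snd p / Enorm n p)))"

definition SNmeasure :: "nat \<Rightarrow> (rvec \<Rightarrow> rvec) \<Rightarrow> rvec set \<Rightarrow> sn_point measure" where
  "SNmeasure n L \<Lambda> = Nmeasure n L \<Lambda> \<Otimes>\<^sub>M Smeasure n"


section \<open>The \<open>L\<close>-\<open>F\<close> flow\<close>

definition LF_solution ::
    "nat \<Rightarrow> (rvec \<Rightarrow> rvec) \<Rightarrow> (rvec \<Rightarrow> rvec) \<Rightarrow>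
     (real \<Rightarrow> rvec) \<Rightarrow> (real \<Rightarrow> real) \<Rightarrow> (real \<Rightarrow> rvec) \<Rightarrow> (real \<Rightarrow> real) \<Rightarrow> bool" where
  "LF_solution n L F w u \<xi> \<eta> \<longleftrightarrow>
     (\<forall>t. w t \<in> Rn n \<and> \<xi> t \<in> Rn n
        \<and> (\<forall>i<n. ((\<lambda>s. \<xi> s i) has_real_derivative \<eta> t * F (\<xi> t) i) (at t))
        \<and> (\<eta> has_real_derivative - vinner n (F (\<xi> t)) (\<xi> t)) (at t)
        \<and> (\<forall>i<n. ((\<lambda>s. w s i) has_real_derivative exp_op n L (u t) (\<xi> t) i) (at t))
        \<and> (u has_real_derivative \<eta> t) (at t))"

text \<open>
  The flow on \<open>SN\<close>: project any solution through a point over \<open>p\<close>. This is well defined, since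
  solutions starting on the unit sphere stay on it, hence are global, they are unique, and left
  translations map solutions to solutions.
\<close>

definition SNflow ::
    "nat \<Rightarrow> (rvec \<Rightarrow> rvec) \<Rightarrow> (rvec \<Rightarrow> rvec) \<Rightarrow> rvec set \<Rightarrow> real \<Rightarrow> sn_point \<Rightarrow> sn_point" where
  "SNflow n L F \<Lambda> t p =
     (THE q. \<exists>w u \<xi> \<eta>. LF_solution n L F w u \<xi> \<eta>
        \<and> p = (coset_proj n L \<Lambda> (w 0, u 0), (\<xi> 0, \<eta> 0))
        \<and> q = (coset_proj n L \<Lambda> (w t, u t), (\<xi> t, \<eta> t)))"


section \<open>Dynamical notions\<close>

definition preserves_measure :: "(real \<Rightarrow> 'a \<Rightarrow> 'a) \<Rightarrow> 'a measure \<Rightarrow> bool" where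
  "preserves_measure \<phi> M \<longleftrightarrow> (\<forall>t. \<phi> t \<in> measurable M M \<and> distr M M (\<phi> t) = M)"

text \<open>
  A finite measurable partition is given by a simple function \<open>P\<close> labelling its atoms; the join
  \<open>P \<or> T\<^sup>-\<^sup>1P \<or> \<dots> \<or> T\<^sup>-\<^sup>m\<^sup>+\<^sup>1P\<close> is then labelled by the length-\<open>m\<close> itineraries.
\<close>

definition itinerary :: "('a \<Rightarrow> 'a) \<Rightarrow> ('a \<Rightarrow> 'b) \<Rightarrow> nat \<Rightarrow> 'a \<Rightarrow> 'b list" where
  "itinerary T P m x = map (\<lambda>i. P ((T ^^ i) x)) [0..<m]"

definition partition_entropy :: "'a measure \<Rightarrow> ('a \<Rightarrow> 'b) \<Rightarrow> real" where
  "partition_entropy M P = prob_space.entropy M (exp 1) (count_space (P ` space M)) P"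

definition metric_entropy :: "'a measure \<Rightarrow> ('a \<Rightarrow> 'a) \<Rightarrow> ereal" where
  "metric_entropy M T =
     (SUP P \<in> {P :: 'a \<Rightarrow> nat. simple_function M P}.
        ereal (lim (\<lambda>m. partition_entropy M (itinerary T P m) / real m)))"

text \<open>
  The metric entropy of a flow is that of its time-one map, with respect to the normalized measure.
\<close>

definition flow_entropy :: "'a measure \<Rightarrow> (real \<Rightarrow> 'a \<Rightarrow> 'a) \<Rightarrow> ereal" where
  "flow_entropy M \<phi> = metric_entropy (uniform_measure M (space M)) (\<phi> 1)"

text \<open>The torus \<open>\<T>\<^sup>k\<close> as a product of unit circles in the complex plane.\<close>

definition torus :: "nat \<Rightarrow> (nat \<Rightarrow> complex) topology" where
  "torus k = product_topology (\<lambda>_. top_of_set (sphere 0 1)) {..<k}"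

definition linear_torus_flow :: "nat \<Rightarrow> (nat \<Rightarrow> real) \<Rightarrow> real \<Rightarrow> (nat \<Rightarrow> complex) \<Rightarrow> nat \<Rightarrow> complex" where
  "linear_torus_flow k \<omega> t \<theta> = (\<lambda>j\<in>{..<k}. cis (t * \<omega> j) * \<theta> j)"

definition quasi_periodic_torus :: "'a topology \<Rightarrow> (real \<Rightarrow> 'a \<Rightarrow> 'a) \<Rightarrow> 'a set \<Rightarrow> bool" where
  "quasi_periodic_torus X \<phi> T \<longleftrightarrow>
     T \<subseteq> topspace X \<and>
     (\<exists>k \<omega> h. 0 < k \<and> homeomorphic_map (torus k) (subtopology X T) h
        \<and> (\<forall>t. \<forall>\<theta> \<in> topspace (torus k). \<phi> t (h \<theta>) = h (linear_torus_flow k \<omega> t \<theta>)))"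

definition semi_integrable :: "'a topology \<Rightarrow> (real \<Rightarrow> 'a \<Rightarrow> 'a) \<Rightarrow> bool" where
  "semi_integrable X \<phi> \<longleftrightarrow>
     (\<exists>U. openin X U \<and> U \<noteq> {} \<and> (\<forall>x\<in>U. \<exists>T. x \<in> T \<and> T \<subseteq> U \<and> quasi_periodic_torus X \<phi> T))"

end

theory Submission
  imports Defs
begin

text \<open>
  Take \<open>n = 2\<close>, \<open>F (x, y) = (- 2 y, x)\<close>, and let \<open>\<Lambda>\<close> be the ring \<open>\<int>[\<phi>]\<close> of the golden ratio, embedded in the
  plane by its two conjugates; \<open>L\<close> is diagonal and \<open>e\<^sup>L\<close> is multiplication by the unit \<open>\<phi>\<^sup>2\<close>.
  On the sphere the flow is the Euler top \<open>x' = - 2 \<eta> y\<close>, \<open>y' = \<eta> x\<close>, \<open>\<eta>' = x y\<close>, with the integrals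
  \<open>x\<^sup>2 + 2 y\<^sup>2\<close> and \<open>x\<^sup>2 + 2 \<eta>\<^sup>2\<close>; the full flow is a skew product over it by right translations of the
  group.

  Where \<open>y > 0\<close> and \<open>0 < x\<^sup>2 + 2 \<eta>\<^sup>2 < 1\<close>, the motion on the sphere is periodic and \<open>u' = \<eta>\<close> integrates
  to a function of \<open>x / y\<close>. Hence \<open>u\<close> is periodic as well, \<open>w\<close> is translated by a constant over each
  period, and the orbits lie on three-dimensional tori with quasi-periodic motion.

  Where \<open>\<eta> > 0\<close> and \<open>x\<^sup>2 + 2 y\<^sup>2 \<le> 3 / 4\<close>, we have \<open>\<eta> \<ge> 1 / 2\<close>, so \<open>u\<close> grows linearly and the monodromy
  \<open>e\<^sup>L\<close> expands one eigendirection exponentially. For a partition by a lattice coordinate the itinerary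
  atoms in this region are therefore exponentially small, which bounds the entropy away from zero.
\<close>

section \<open>The quadratic flow on the sphere\<close>

text \<open>The unequal weights in \<open>F\<close> make the \<open>x\<close> axis the unstable axis
  of the top. The separatrix \<open>y\<^sup>2 = \<eta>\<^sup>2\<close> through it cuts the sphere
  into caps around the \<open>y\<close> axis, where \<eta> changes sign along every orbit but the
  centre, and caps around the \<eta> axis, where \<eta> keeps its sign. This is how the two
  behaviours coexist. The unit is the square of \<phi> because e^L has positive eigenvalues, whereas
  the conjugate of \<phi> is negative.

  Volume is invariant for two separate reasons. On \<open>N\<close> right translations preserve the
  measure; since \<open>Nmeasure\<close> is built on an arbitrarily chosen fundamental domain, this
  rests on independence of that choice, hence on left invariance of Lebesgue measure, hence on tr L
  = 0. On the sphere the reason is tr F = 0; in place of Jacobians, the flow is approximated by maps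
  that are piecewise rotations.

  The entropy bound uses expansion in one direction together with an upper bound on expansion per
  unit time: the lattice coordinate is observed modulo 1, so nearby points must not outrun the
  resolution of the partition between two observations.\<close>

text \<open>\<open>Q s * exp (- K s)\<close> is nonincreasing at positive times and
  \<open>Q s * exp (K s)\<close> nondecreasing at negative ones. Covering both time directions lets
  one estimate serve for uniqueness and for continuous dependence.\<close>

lemma gronwall_abs:
  fixes Q :: "real \<Rightarrow> real"
  assumes "\<And>s. min 0 t \<le> s \<Longrightarrow> s \<le> max 0 t \<Longrightarrow> \<exists>D. (Q has_real_derivative D) (at s) \<and> \<bar>D\<bar> \<le> K * Q s"
  shows "Q t \<le> exp (K * \<bar>t\<bar>) * Q 0"
proof (cases "t \<ge> 0")
  case True
  have "Q t * exp (- K * t) \<le> Q 0 * exp (- K * 0)"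
  proof (rule DERIV_nonpos_imp_nonincreasing[OF True])
    fix s assume s: "0 \<le> s" "s \<le> t"
    then obtain D where D: "(Q has_real_derivative D) (at s)" "\<bar>D\<bar> \<le> K * Q s"
      using assms[of s] True by auto
    have "((\<lambda>s. Q s * exp (- K * s)) has_real_derivative (D - K * Q s) * exp (- K * s)) (at s)"
      by (auto intro!: derivative_eq_intros D simp: algebra_simps)
    moreover have "(D - K * Q s) * exp (- K * s) \<le> 0"
      using D(2) by (intro mult_nonpos_nonneg) auto
    ultimately show "\<exists>y. ((\<lambda>s. Q s * exp (- K * s)) has_real_derivative y) (at s) \<and> y \<le> 0" by blast
  qed
  then have "Q t * exp (- K * t) * exp (K * t) \<le> Q 0 * exp (K * t)"
    by (intro mult_right_mono) auto
  then show ?thesis using True by (simp add: mult.assoc flip: exp_add) (simp add: mult.commute)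
next
  case False
  then have t: "t \<le> 0" by simp
  have "Q t * exp (K * t) \<le> Q 0 * exp (K * 0)"
  proof (rule DERIV_nonneg_imp_nondecreasing[OF t])
    fix s assume s: "t \<le> s" "s \<le> 0"
    then obtain D where D: "(Q has_real_derivative D) (at s)" "\<bar>D\<bar> \<le> K * Q s"
      using assms[of s] False by auto
    have "((\<lambda>s. Q s * exp (K * s)) has_real_derivative (D + K * Q s) * exp (K * s)) (at s)"
      by (auto intro!: derivative_eq_intros D simp: algebra_simps)
    moreover have "(D + K * Q s) * exp (K * s) \<ge> 0"
      using D(2) by (intro mult_nonneg_nonneg) auto
    ultimately show "\<exists>y. ((\<lambda>s. Q s * exp (K * s)) has_real_derivative y) (at s) \<and> 0 \<le> y" by blast
  qed
  then have "Q t * exp (K * t) * exp (- K * t) \<le> Q 0 * exp (- K * t)"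
    by (intro mult_right_mono) auto
  then show ?thesis using False by (simp add: mult.assoc flip: exp_add) (simp add: mult.commute)
qed

text \<open>The time set is a parameter so that local solutions can be restricted, shifted and
  glued.\<close>

definition euler_sol :: "real set \<Rightarrow> (real \<Rightarrow> real) \<Rightarrow> (real \<Rightarrow> real) \<Rightarrow> (real \<Rightarrow> real) \<Rightarrow> bool" where
  "euler_sol I x y e \<longleftrightarrow> (\<forall>t\<in>I. (x has_real_derivative - 2 * e t * y t) (at t)
     \<and> (y has_real_derivative e t * x t) (at t) \<and> (e has_real_derivative x t * y t) (at t))"

lemma euler_sol_subset: "euler_sol J x y e \<Longrightarrow> I \<subseteq> J \<Longrightarrow> euler_sol I x y e"
  by (auto simp: euler_sol_def)

lemma euler_sol_shift:
  assumes "euler_sol I x y e" "\<And>t. t \<in> J \<Longrightarrow> t + s \<in> I"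
  shows "euler_sol J (\<lambda>t. x (t + s)) (\<lambda>t. y (t + s)) (\<lambda>t. e (t + s))"
  using assms unfolding euler_sol_def DERIV_shift[symmetric] by auto

lemma zero_deriv_eq_at_0:
  fixes f :: "real \<Rightarrow> real"
  assumes "\<And>t. t \<in> {a<..<b} \<Longrightarrow> (f has_real_derivative 0) (at t)" "t \<in> {a<..<b}" "0 \<in> {a<..<b}"
  shows "f t = f 0"
proof -
  have "\<exists>c. \<forall>s\<in>{a<..<b}. f s = c"
    using assms(1) by (intro has_field_derivative_zero_constant) (auto intro: has_field_derivative_at_within)
  then show ?thesis using assms(2,3) by force
qed

lemma euler_conserved:
  assumes "euler_sol {a<..<b} x y e" "t \<in> {a<..<b}" "0 \<in> {a<..<b}"
  shows "(x t)\<^sup>2 + (y t)\<^sup>2 + (e t)\<^sup>2 = (x 0)\<^sup>2 + (y 0)\<^sup>2 + (e 0)\<^sup>2"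
    and "(x t)\<^sup>2 + 2 * (y t)\<^sup>2 = (x 0)\<^sup>2 + 2 * (y 0)\<^sup>2"
    and "(x t)\<^sup>2 + 2 * (e t)\<^sup>2 = (x 0)\<^sup>2 + 2 * (e 0)\<^sup>2"
proof -
  have d: "(x has_real_derivative - 2 * e t * y t) (at t)"
     "(y has_real_derivative e t * x t) (at t)" "(e has_real_derivative x t * y t) (at t)"
    if "t \<in> {a<..<b}" for t using assms(1) that by (auto simp: euler_sol_def)
  show "(x t)\<^sup>2 + (y t)\<^sup>2 + (e t)\<^sup>2 = (x 0)\<^sup>2 + (y 0)\<^sup>2 + (e 0)\<^sup>2"
    by (rule zero_deriv_eq_at_0[of a b "\<lambda>t. (x t)\<^sup>2 + (y t)\<^sup>2 + (e t)\<^sup>2", OF _ assms(2,3)])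
       (auto intro!: derivative_eq_intros d simp: algebra_simps)
  show "(x t)\<^sup>2 + 2 * (y t)\<^sup>2 = (x 0)\<^sup>2 + 2 * (y 0)\<^sup>2"
    by (rule zero_deriv_eq_at_0[of a b "\<lambda>t. (x t)\<^sup>2 + 2 * (y t)\<^sup>2", OF _ assms(2,3)])
       (auto intro!: derivative_eq_intros d simp: algebra_simps)
  show "(x t)\<^sup>2 + 2 * (e t)\<^sup>2 = (x 0)\<^sup>2 + 2 * (e 0)\<^sup>2"
    by (rule zero_deriv_eq_at_0[of a b "\<lambda>t. (x t)\<^sup>2 + 2 * (e t)\<^sup>2", OF _ assms(2,3)])
       (auto intro!: derivative_eq_intros d simp: algebra_simps)
qed

lemma sphere_abs_le:
  fixes x y e :: real
  assumes "x\<^sup>2 + y\<^sup>2 + e\<^sup>2 = 1"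
  shows "\<bar>x\<bar> \<le> 1" "\<bar>y\<bar> \<le> 1" "\<bar>e\<bar> \<le> 1"
proof -
  show "\<bar>x\<bar> \<le> 1" using assms by (simp add: abs_square_le_1[symmetric]) (smt (verit) zero_le_power2)
  show "\<bar>y\<bar> \<le> 1" using assms by (simp add: abs_square_le_1[symmetric]) (smt (verit) zero_le_power2)
  show "\<bar>e\<bar> \<le> 1" using assms by (simp add: abs_square_le_1[symmetric]) (smt (verit) zero_le_power2)
qed

lemma abs_mult_le_half_squares:
  fixes a b c :: real
  assumes "\<bar>c\<bar> \<le> 1"
  shows "\<bar>c * (a * b)\<bar> \<le> (a\<^sup>2 + b\<^sup>2) / 2"
proof -
  have "\<bar>c * (a * b)\<bar> \<le> \<bar>a * b\<bar>" using assms by (simp add: abs_mult mult_left_le_one_le)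
  also have "\<dots> \<le> (a\<^sup>2 + b\<^sup>2) / 2"
  proof -
    have "0 \<le> (\<bar>a\<bar> - \<bar>b\<bar>)\<^sup>2" by simp
    then show ?thesis by (simp add: power2_diff abs_mult)
  qed
  finally show ?thesis .
qed

text \<open>Differences of products split as
  \<open>e1 y1 - e2 y2 = e1 (y1 - y2) + y2 (e1 - e2)\<close>. Every term of the derivative of the
  squared distance is then a product of two differences and one coordinate, and coordinates on the
  sphere are at most 1. The constant 6 is generous.\<close>

lemma euler_dependence:
  assumes 1: "euler_sol {a<..<b} x1 y1 e1" and 2: "euler_sol {a<..<b} x2 y2 e2"
    and s1: "(x1 0)\<^sup>2 + (y1 0)\<^sup>2 + (e1 0)\<^sup>2 = 1" and s2: "(x2 0)\<^sup>2 + (y2 0)\<^sup>2 + (e2 0)\<^sup>2 = 1"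
    and t: "t \<in> {a<..<b}" "0 \<in> {a<..<b}"
  shows "(x1 t - x2 t)\<^sup>2 + (y1 t - y2 t)\<^sup>2 + (e1 t - e2 t)\<^sup>2
     \<le> exp (6 * \<bar>t\<bar>) * ((x1 0 - x2 0)\<^sup>2 + (y1 0 - y2 0)\<^sup>2 + (e1 0 - e2 0)\<^sup>2)"
proof (rule gronwall_abs[where Q = "\<lambda>t. (x1 t - x2 t)\<^sup>2 + (y1 t - y2 t)\<^sup>2 + (e1 t - e2 t)\<^sup>2"])
  fix s :: real assume "min 0 t \<le> s" "s \<le> max 0 t"
  then have s: "s \<in> {a<..<b}" using t by auto
  have d: "(x1 has_real_derivative - 2 * e1 s * y1 s) (at s)"
     "(y1 has_real_derivative e1 s * x1 s) (at s)" "(e1 has_real_derivative x1 s * y1 s) (at s)"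
     "(x2 has_real_derivative - 2 * e2 s * y2 s) (at s)"
     "(y2 has_real_derivative e2 s * x2 s) (at s)" "(e2 has_real_derivative x2 s * y2 s) (at s)"
    using s 1 2 by (auto simp: euler_sol_def)
  define d1 d2 d3 where "d1 = x1 s - x2 s" and "d2 = y1 s - y2 s" and "d3 = e1 s - e2 s"
  have b1: "\<bar>x1 s\<bar> \<le> 1" "\<bar>y1 s\<bar> \<le> 1" "\<bar>e1 s\<bar> \<le> 1"
    using sphere_abs_le[OF euler_conserved(1)[OF 1 s t(2), unfolded s1]] by auto
  have b2: "\<bar>x2 s\<bar> \<le> 1" "\<bar>y2 s\<bar> \<le> 1" "\<bar>e2 s\<bar> \<le> 1"
    using sphere_abs_le[OF euler_conserved(1)[OF 2 s t(2), unfolded s2]] by auto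
  let ?D = "2 * d1 * (- 2 * e1 s * y1 s + 2 * e2 s * y2 s) + 2 * d2 * (e1 s * x1 s - e2 s * x2 s)
    + 2 * d3 * (x1 s * y1 s - x2 s * y2 s)"
  have "((\<lambda>t. (x1 t - x2 t)\<^sup>2 + (y1 t - y2 t)\<^sup>2 + (e1 t - e2 t)\<^sup>2) has_real_derivative ?D) (at s)"
    by (auto intro!: derivative_eq_intros d simp: d1_def d2_def d3_def algebra_simps)
  moreover have "\<bar>?D\<bar> \<le> 6 * (d1\<^sup>2 + d2\<^sup>2 + d3\<^sup>2)"
  proof -
    have D: "?D = - 4 * (e1 s * (d1 * d2)) - 4 * (y2 s * (d1 * d3)) + 2 * (e1 s * (d1 * d2)) + 2 * (x2 s * (d2 * d3))
       + 2 * (x1 s * (d2 * d3)) + 2 * (y2 s * (d1 * d3))"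
      by (simp add: d1_def d2_def d3_def algebra_simps)
    have gen: "\<bar>- 4 * p - 4 * q + 2 * p + 2 * r + 2 * v + 2 * q\<bar> \<le> 6 * (A + B + C)"
      if "\<bar>p\<bar> \<le> (A + B) / 2" "\<bar>q\<bar> \<le> (A + C) / 2" "\<bar>r\<bar> \<le> (B + C) / 2" "\<bar>v\<bar> \<le> (B + C) / 2"
        "0 \<le> A" "0 \<le> B" "0 \<le> C" for p q r v A B C :: real
    proof -
      have "\<bar>- 4 * p - 4 * q + 2 * p + 2 * r + 2 * v + 2 * q\<bar> \<le> 2 * \<bar>p\<bar> + 2 * \<bar>q\<bar> + 2 * \<bar>r\<bar> + 2 * \<bar>v\<bar>"
        by linarith
      then show ?thesis using that by simp
    qed
    show ?thesis unfolding D
      by (rule gen) (intro abs_mult_le_half_squares b1 b2 zero_le_power2)+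
  qed
  ultimately show "\<exists>D. ((\<lambda>t. (x1 t - x2 t)\<^sup>2 + (y1 t - y2 t)\<^sup>2 + (e1 t - e2 t)\<^sup>2) has_real_derivative D) (at s) \<and>
      \<bar>D\<bar> \<le> 6 * ((x1 s - x2 s)\<^sup>2 + (y1 s - y2 s)\<^sup>2 + (e1 s - e2 s)\<^sup>2)"
    unfolding d1_def d2_def d3_def by blast
qed

lemma euler_unique:
  assumes 1: "euler_sol {a<..<b} x1 y1 e1" and 2: "euler_sol {a<..<b} x2 y2 e2"
    and "(x1 0)\<^sup>2 + (y1 0)\<^sup>2 + (e1 0)\<^sup>2 = 1" "x2 0 = x1 0" "y2 0 = y1 0" "e2 0 = e1 0" "t \<in> {a<..<b}" "0 \<in> {a<..<b}"
  shows "x2 t = x1 t" "y2 t = y1 t" "e2 t = e1 t"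
proof -
  have "(x1 t - x2 t)\<^sup>2 + (y1 t - y2 t)\<^sup>2 + (e1 t - e2 t)\<^sup>2 \<le> 0"
    using euler_dependence[OF 1 2, of t] assms by simp
  then have "(x1 t - x2 t)\<^sup>2 = 0" "(y1 t - y2 t)\<^sup>2 = 0" "(e1 t - e2 t)\<^sup>2 = 0"
    using zero_le_power2[of "x1 t - x2 t"] zero_le_power2[of "y1 t - y2 t"] zero_le_power2[of "e1 t - e2 t"] by linarith+
  then show "x2 t = x1 t" "y2 t = y1 t" "e2 t = e1 t" by auto
qed

lemma euler_unique_at:
  assumes 1: "euler_sol {a<..<b} x1 y1 e1" and 2: "euler_sol {a<..<b} x2 y2 e2"
    and "(x1 c)\<^sup>2 + (y1 c)\<^sup>2 + (e1 c)\<^sup>2 = 1" "x2 c = x1 c" "y2 c = y1 c" "e2 c = e1 c"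
    and "t \<in> {a<..<b}" "c \<in> {a<..<b}"
  shows "x2 t = x1 t \<and> y2 t = y1 t \<and> e2 t = e1 t"
  using euler_unique[OF euler_sol_shift[OF 1, of "{a - c<..<b - c}" c] euler_sol_shift[OF 2, of "{a - c<..<b - c}" c], of "t - c"]
    assms(3-) by auto

section \<open>Local existence by power series\<close>

declare sum.cong[fundef_cong]

text \<open>Taylor coefficients of the solution through \<open>p\<close>: the right-hand sides are
  products of two components, hence Cauchy convolutions of coefficients. The congruence rule for
  sums exposes \<open>i \<le> k\<close> to the termination proof.\<close>

fun euler_coeff :: "real \<times> real \<times> real \<Rightarrow> nat \<Rightarrow> real \<times> real \<times> real" where
  "euler_coeff p 0 = p"
| "euler_coeff p (Suc k) =
    ((\<Sum>i\<in>{..k}. - 2 * snd (snd (euler_coeff p i)) * fst (snd (euler_coeff p (k - i)))) / Suc k,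
     (\<Sum>i\<in>{..k}. snd (snd (euler_coeff p i)) * fst (euler_coeff p (k - i))) / Suc k,
     (\<Sum>i\<in>{..k}. fst (euler_coeff p i) * fst (snd (euler_coeff p (k - i)))) / Suc k)"

text \<open>A convolution of \<open>Suc m\<close> terms, each at most \<open>2 * 2 ^ m\<close>, is
  divided by \<open>Suc m\<close>. The resulting radius \<open>1 / 2\<close> is the same for all
  initial points in the unit cube, which is what makes restarting possible.\<close>

lemma euler_coeff_bound:
  assumes "\<bar>fst p\<bar> \<le> 1" "\<bar>fst (snd p)\<bar> \<le> 1" "\<bar>snd (snd p)\<bar> \<le> 1"
  shows "\<bar>fst (euler_coeff p k)\<bar> \<le> 2 ^ k \<and> \<bar>fst (snd (euler_coeff p k))\<bar> \<le> 2 ^ k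
    \<and> \<bar>snd (snd (euler_coeff p k))\<bar> \<le> 2 ^ k"
proof (induction k rule: less_induct)
  case (less k)
  show ?case
  proof (cases k)
    case 0 then show ?thesis using assms by simp
  next
    case (Suc m)
    have gen: "\<bar>(\<Sum>i\<in>{..m}. c * f i * g (m - i)) / Suc m\<bar> \<le> 2 ^ Suc m"
      if "\<bar>c\<bar> \<le> 2" "\<And>i. i \<le> m \<Longrightarrow> \<bar>f i\<bar> \<le> 2 ^ i" "\<And>i. i \<le> m \<Longrightarrow> \<bar>g i\<bar> \<le> 2 ^ i" for f g :: "nat \<Rightarrow> real" and c
    proof -
      have "\<bar>\<Sum>i\<in>{..m}. c * f i * g (m - i)\<bar> \<le> (\<Sum>i\<in>{..m}. \<bar>c * f i * g (m - i)\<bar>)" by (rule sum_abs)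
      also have "\<dots> \<le> (\<Sum>i\<in>{..m}. 2 ^ Suc m)"
      proof (rule sum_mono)
        fix i assume i: "i \<in> {..m}"
        have "\<bar>c * f i * g (m - i)\<bar> \<le> 2 * 2 ^ i * 2 ^ (m - i)"
          unfolding abs_mult using that i by (intro mult_mono) auto
        also have "\<dots> = 2 ^ Suc m" using i by (simp add: mult.assoc flip: power_add)
        finally show "\<bar>c * f i * g (m - i)\<bar> \<le> 2 ^ Suc m" .
      qed
      finally have "\<bar>\<Sum>i\<in>{..m}. c * f i * g (m - i)\<bar> \<le> 2 ^ Suc m * real (Suc m)" by (simp add: mult.commute)
      then have "\<bar>\<Sum>i\<in>{..m}. c * f i * g (m - i)\<bar> / real (Suc m) \<le> 2 ^ Suc m"
        by (subst pos_divide_le_eq) simp_all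
      then show ?thesis by (simp only: abs_divide abs_of_nat)
    qed
    have IH: "\<bar>fst (euler_coeff p i)\<bar> \<le> 2 ^ i" "\<bar>fst (snd (euler_coeff p i))\<bar> \<le> 2 ^ i"
     "\<bar>snd (snd (euler_coeff p i))\<bar> \<le> 2 ^ i" if "i \<le> m" for i using less[of i] that Suc by auto
    show ?thesis
      unfolding Suc euler_coeff.simps(2) fst_conv snd_conv
      using gen[of "-2" "\<lambda>i. snd (snd (euler_coeff p i))" "\<lambda>i. fst (snd (euler_coeff p i))", OF _ IH(3) IH(2)]
        gen[of 1 "\<lambda>i. snd (snd (euler_coeff p i))" "\<lambda>i. fst (euler_coeff p i)", OF _ IH(3) IH(1)]
        gen[of 1 "\<lambda>i. fst (euler_coeff p i)" "\<lambda>i. fst (snd (euler_coeff p i))", OF _ IH(1) IH(2)]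
      by (simp del: power_Suc of_nat_Suc)
  qed
qed

text \<open>Termwise differentiation on one side and the Cauchy product on the other, both valid
  inside the disc that the growth \<open>2 ^ k\<close> guarantees. The factor \<open>r\<close> is
  the coefficient \<open>- 2\<close> or \<open>1\<close> of one of the three equations.\<close>

lemma power_series_product_deriv:
  fixes a b c :: "nat \<Rightarrow> real"
  assumes a: "\<And>k. \<bar>a k\<bar> \<le> 2 ^ k" and b: "\<And>k. \<bar>b k\<bar> \<le> 2 ^ k" and c: "\<And>k. \<bar>c k\<bar> \<le> 2 ^ k"
    and rec: "\<And>k. real (Suc k) * c (Suc k) = r * (\<Sum>i\<le>k. a i * b (k - i))"
    and t: "\<bar>t\<bar> < 1 / 2"
  shows "((\<lambda>t. \<Sum>k. c k * t ^ k) has_real_derivative r * ((\<Sum>k. a k * t ^ k) * (\<Sum>k. b k * t ^ k))) (at t)"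
proof -
  have summ: "summable (\<lambda>k. norm (f k * s ^ k))" if "\<And>k. \<bar>f k\<bar> \<le> 2 ^ k" "\<bar>s\<bar> < 1/2" for f :: "nat \<Rightarrow> real" and s
  proof (rule summable_comparison_test[of _ "\<lambda>k. (2 * \<bar>s\<bar>) ^ k"])
    show "\<exists>N. \<forall>n\<ge>N. norm (norm (f n * s ^ n)) \<le> (2 * \<bar>s\<bar>) ^ n"
      using that(1) by (auto simp: abs_mult power_mult_distrib power_abs intro!: mult_right_mono exI[of _ 0])
    show "summable (\<lambda>k. (2 * \<bar>s\<bar>) ^ k)" using that(2) by (intro summable_geometric) auto
  qed
  obtain K where K: "\<bar>t\<bar> < K" "K < 1/2" using t dense by blast
  have "((\<lambda>t. \<Sum>k. c k * t ^ k) has_real_derivative (\<Sum>k. diffs c k * t ^ k)) (at t)"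
    by (rule termdiffs_strong[of c K]) (use summable_norm_cancel[OF summ[OF c, of K]] K in auto)
  moreover have "(\<Sum>k. diffs c k * t ^ k) = r * ((\<Sum>k. a k * t ^ k) * (\<Sum>k. b k * t ^ k))"
  proof -
    have "(\<Sum>k. a k * t ^ k) * (\<Sum>k. b k * t ^ k) = (\<Sum>k. \<Sum>i\<le>k. (a i * t ^ i) * (b (k - i) * t ^ (k - i)))"
      by (rule Cauchy_product[OF summ[OF a t] summ[OF b t]])
    moreover have "summable (\<lambda>k. \<Sum>i\<le>k. (a i * t ^ i) * (b (k - i) * t ^ (k - i)))"
      by (rule summable_Cauchy_product[OF summ[OF a t] summ[OF b t]])
    moreover have "diffs c k * t ^ k = r * (\<Sum>i\<le>k. (a i * t ^ i) * (b (k - i) * t ^ (k - i)))" for k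
    proof -
      have "(\<Sum>i\<le>k. (a i * t ^ i) * (b (k - i) * t ^ (k - i))) = (\<Sum>i\<le>k. (a i * b (k - i)) * t ^ k)"
      proof (rule sum.cong[OF refl])
        fix i assume "i \<in> {..k}"
        then have "t ^ k = t ^ i * t ^ (k - i)" by (simp flip: power_add)
        then show "(a i * t ^ i) * (b (k - i) * t ^ (k - i)) = (a i * b (k - i)) * t ^ k" by simp
      qed
      then show ?thesis by (simp add: diffs_def rec sum_distrib_right del: of_nat_Suc)
    qed
    ultimately show ?thesis by (simp add: suminf_mult)
  qed
  ultimately show ?thesis by simp
qed

lemma euler_local_existence:
  assumes "x0\<^sup>2 + y0\<^sup>2 + e0\<^sup>2 = (1::real)"
  shows "\<exists>x y e. euler_sol {-1/2<..<1/2} x y e \<and> x 0 = x0 \<and> y 0 = y0 \<and> e 0 = e0"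
proof -
  define p where "p = (x0, y0, e0)"
  define cx where "cx = (\<lambda>k. fst (euler_coeff p k))"
  define cy where "cy = (\<lambda>k. fst (snd (euler_coeff p k)))"
  define ce where "ce = (\<lambda>k. snd (snd (euler_coeff p k)))"
  have "\<bar>fst p\<bar> \<le> 1" "\<bar>fst (snd p)\<bar> \<le> 1" "\<bar>snd (snd p)\<bar> \<le> 1"
    using sphere_abs_le[OF assms] by (auto simp: p_def)
  from euler_coeff_bound[OF this]
  have bd: "\<bar>cx k\<bar> \<le> 2 ^ k" "\<bar>cy k\<bar> \<le> 2 ^ k" "\<bar>ce k\<bar> \<le> 2 ^ k" for k
    by (auto simp: cx_def cy_def ce_def)
  have rec: "real (Suc k) * cx (Suc k) = - 2 * (\<Sum>i\<le>k. ce i * cy (k - i))"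
    "real (Suc k) * cy (Suc k) = 1 * (\<Sum>i\<le>k. ce i * cx (k - i))"
    "real (Suc k) * ce (Suc k) = 1 * (\<Sum>i\<le>k. cx i * cy (k - i))" for k
    by (simp_all add: cx_def cy_def ce_def mult.assoc sum_negf flip: sum_distrib_left del: of_nat_Suc)
  define f where "f = (\<lambda>c t. \<Sum>k. c k * t ^ k :: real)"
  have d: "(f cx has_real_derivative - 2 * f ce t * f cy t) (at t)"
    "(f cy has_real_derivative f ce t * f cx t) (at t)"
    "(f ce has_real_derivative f cx t * f cy t) (at t)" if "\<bar>t\<bar> < 1/2" for t
    using power_series_product_deriv[OF bd(3,2,1) rec(1) that]
      power_series_product_deriv[OF bd(3,1,2) rec(2) that]
      power_series_product_deriv[OF bd(1,2,3) rec(3) that]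
    unfolding f_def by (simp_all add: mult.assoc)
  have "f c 0 = c 0" for c by (simp add: f_def)
  then show ?thesis
    using d by (intro exI[of _ "f cx"] exI[of _ "f cy"] exI[of _ "f ce"])
      (auto simp: euler_sol_def cx_def cy_def ce_def p_def abs_less_iff)
qed

lemma euler_sol_transform:
  assumes "euler_sol I x y e" "open I" "\<And>t. t \<in> I \<Longrightarrow> x' t = x t" "\<And>t. t \<in> I \<Longrightarrow> y' t = y t" "\<And>t. t \<in> I \<Longrightarrow> e' t = e t"
  shows "euler_sol I x' y' e'"
  unfolding euler_sol_def
proof (intro ballI conjI)
  fix t assume t: "t \<in> I"
  have d: "(x has_real_derivative - 2 * e' t * y' t) (at t)"
     "(y has_real_derivative e' t * x' t) (at t)" "(e has_real_derivative x' t * y' t) (at t)"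
    using assms t by (auto simp: euler_sol_def)
  show "(x' has_real_derivative - 2 * e' t * y' t) (at t)"
    by (rule has_field_derivative_transform_within_open[OF d(1) assms(2) t]) (simp add: assms)
  show "(y' has_real_derivative e' t * x' t) (at t)"
    by (rule has_field_derivative_transform_within_open[OF d(2) assms(2) t]) (simp add: assms)
  show "(e' has_real_derivative x' t * y' t) (at t)"
    by (rule has_field_derivative_transform_within_open[OF d(3) assms(2) t]) (simp add: assms)
qed

lemma euler_sol_Un: "euler_sol I x y e \<Longrightarrow> euler_sol J x y e \<Longrightarrow> euler_sol (I \<union> J) x y e"
  by (auto simp: euler_sol_def)

section \<open>Global existence by restarting on the invariant sphere\<close>

definition euler_exists :: "real \<Rightarrow> bool" where
  "euler_exists T \<longleftrightarrow> (\<forall>x0 y0 e0. x0\<^sup>2 + y0\<^sup>2 + e0\<^sup>2 = 1 \<longrightarrow>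
     (\<exists>x y e. euler_sol {-T<..<T} x y e \<and> x 0 = x0 \<and> y 0 = y0 \<and> e 0 = e0))"

text \<open>The lifespan \<open>T\<close> is uniform over the sphere and the sphere is invariant, so
  the solution can be restarted at times \<open>T / 2\<close> and \<open>- T / 2\<close>; each new
  piece reaches \<open>T / 2\<close> further, and uniqueness makes it agree with the old one on the
  overlap.\<close>

lemma euler_exists_extend:
  assumes "euler_exists T" "T > 0"
  shows "euler_exists (3 / 2 * T)"
  unfolding euler_exists_def
proof (intro allI impI)
  fix x0 y0 e0 :: real assume s: "x0\<^sup>2 + y0\<^sup>2 + e0\<^sup>2 = 1"
  obtain x y e where 0: "euler_sol {-T<..<T} x y e" "x 0 = x0" "y 0 = y0" "e 0 = e0"
    using assms s unfolding euler_exists_def by blast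
  have ex: "\<exists>x1 y1 e1. euler_sol {-T + c<..<T + c} x1 y1 e1 \<and>
      (\<forall>t. \<bar>t\<bar> < T \<and> \<bar>t - c\<bar> < T \<longrightarrow> x1 t = x t \<and> y1 t = y t \<and> e1 t = e t)" if c: "\<bar>c\<bar> < T" for c
  proof -
    have sc: "(x c)\<^sup>2 + (y c)\<^sup>2 + (e c)\<^sup>2 = 1" using euler_conserved(1)[OF 0(1), of c] c assms(2) s 0 by (auto simp: abs_less_iff)
    then obtain x1 y1 e1 where 1: "euler_sol {-T<..<T} x1 y1 e1" "x1 0 = x c" "y1 0 = y c" "e1 0 = e c"
      using assms unfolding euler_exists_def by blast
    let ?x = "\<lambda>t. x1 (t + - c)" and ?y = "\<lambda>t. y1 (t + - c)" and ?e = "\<lambda>t. e1 (t + - c)"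
    have 2: "euler_sol {-T + c<..<T + c} ?x ?y ?e" by (rule euler_sol_shift[OF 1(1)]) auto
    have "?x t = x t \<and> ?y t = y t \<and> ?e t = e t" if t: "\<bar>t\<bar> < T" "\<bar>t - c\<bar> < T" for t
    proof -
      let ?a = "max (-T) (c - T)" and ?b = "min T (c + T)"
      have "euler_sol {?a<..<?b} x y e" by (rule euler_sol_subset[OF 0(1)]) auto
      moreover have "euler_sol {?a<..<?b} ?x ?y ?e" by (rule euler_sol_subset[OF 2]) auto
      moreover have "t \<in> {?a<..<?b}" "c \<in> {?a<..<?b}" using t c assms(2) by auto
      ultimately show ?thesis
        using euler_unique_at[of ?a ?b x y e ?x ?y ?e c t] 1 sc by simp
    qed
    then show ?thesis using 2 by blast
  qed
  obtain x1 y1 e1 where 1: "euler_sol {-T + T/2<..<T + T/2} x1 y1 e1"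
      "\<And>t. \<bar>t\<bar> < T \<Longrightarrow> \<bar>t - T/2\<bar> < T \<Longrightarrow> x1 t = x t \<and> y1 t = y t \<and> e1 t = e t"
    using ex[of "T/2"] assms(2) by auto
  obtain x2 y2 e2 where 2: "euler_sol {-T - T/2<..<T - T/2} x2 y2 e2"
      "\<And>t. \<bar>t\<bar> < T \<Longrightarrow> \<bar>t + T/2\<bar> < T \<Longrightarrow> x2 t = x t \<and> y2 t = y t \<and> e2 t = e t"
    using ex[of "-T/2"] assms(2) by auto
  \<comment> \<open>The switches at \<open>T / 2\<close> and \<open>- T / 2\<close> lie inside the
    overlaps, so on each of the three open intervals the glued curve coincides with a single
    solution.\<close>
  define g where "g = (\<lambda>f f1 f2 t. if t \<ge> T/2 then f1 t else if t \<le> - T/2 then f2 t else f t :: real)"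
  have "euler_sol ({-T<..<T} \<union> {-T + T/2<..<T + T/2} \<union> {-T - T/2<..<T - T/2}) (g x x1 x2) (g y y1 y2) (g e e1 e2)"
  proof (intro euler_sol_Un)
    show "euler_sol {-T<..<T} (g x x1 x2) (g y y1 y2) (g e e1 e2)"
      using 0(1) by (rule euler_sol_transform) (use 1(2) 2(2) assms(2) in \<open>auto simp: g_def abs_less_iff\<close>)
    show "euler_sol {-T + T/2<..<T + T/2} (g x x1 x2) (g y y1 y2) (g e e1 e2)"
      using 1(1) by (rule euler_sol_transform) (use 1(2) 2(2) assms(2) in \<open>auto simp: g_def abs_less_iff\<close>)
    show "euler_sol {-T - T/2<..<T - T/2} (g x x1 x2) (g y y1 y2) (g e e1 e2)"
      using 2(1) by (rule euler_sol_transform) (use 1(2) 2(2) assms(2) in \<open>auto simp: g_def abs_less_iff\<close>)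
  qed
  then have "euler_sol {- (3 / 2 * T)<..<3 / 2 * T} (g x x1 x2) (g y y1 y2) (g e e1 e2)"
    by (rule euler_sol_subset) (use assms(2) in auto)
  then show "\<exists>x y e. euler_sol {- (3 / 2 * T)<..<3 / 2 * T} x y e \<and> x 0 = x0 \<and> y 0 = y0 \<and> e 0 = e0"
    using 0 assms(2) by (intro exI[of _ "g x x1 x2"] exI[of _ "g y y1 y2"] exI[of _ "g e e1 e2"]) (auto simp: g_def)
qed

lemma euler_exists_mono: "euler_exists T \<Longrightarrow> S \<le> T \<Longrightarrow> euler_exists S"
  unfolding euler_exists_def using euler_sol_subset[of "{-T<..<T}" _ _ _ "{-S<..<S}"] by fastforce

lemma euler_exists_all: "euler_exists T"
proof -
  have "euler_exists ((3/2) ^ n * (1/2))" for n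
  proof (induction n)
    case 0 then show ?case using euler_local_existence by (simp add: euler_exists_def)
  next
    case (Suc n) then show ?case using euler_exists_extend[OF Suc] by (simp add: mult.assoc)
  qed
  moreover obtain n where "2 * T < (3/2) ^ n" using real_arch_pow[of "3/2" "2*T"] by auto
  ultimately show ?thesis using euler_exists_mono[of "(3/2) ^ n * (1/2)" T] by simp
qed

lemma euler_global_existence:
  assumes s: "x0\<^sup>2 + y0\<^sup>2 + e0\<^sup>2 = (1::real)"
  shows "\<exists>x y e. euler_sol UNIV x y e \<and> x 0 = x0 \<and> y 0 = y0 \<and> e 0 = e0"
proof -
  have "\<forall>n::nat. \<exists>x y e. euler_sol {-real n<..<real n} x y e \<and> x 0 = x0 \<and> y 0 = y0 \<and> e 0 = e0"
    using euler_exists_all s unfolding euler_exists_def by blast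
  then obtain x y e where 1: "\<And>n. euler_sol {-real n<..<real n} (x n) (y n) (e n)"
    "\<And>n. x n 0 = x0" "\<And>n. y n 0 = y0" "\<And>n. e n 0 = e0" by metis
  define N where "N = (\<lambda>t::real. nat \<lceil>\<bar>t\<bar>\<rceil> + 1)"
  have N: "\<bar>t\<bar> < real (N t)" for t unfolding N_def by linarith
  have eq: "x (N t) t = x n t \<and> y (N t) t = y n t \<and> e (N t) t = e n t" if "\<bar>t\<bar> < real n" for n t
  proof -
    define m where "m = min (real (N t)) (real n)"
    have m: "\<bar>t\<bar> < m" using N that by (simp add: m_def)
    have "euler_sol {-m<..<m} (x (N t)) (y (N t)) (e (N t))" "euler_sol {-m<..<m} (x n) (y n) (e n)"
      by (auto intro!: euler_sol_subset[OF 1(1)] simp: m_def)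
    from euler_unique[OF this(2) this(1), of t] show ?thesis using 1 s m by (auto simp: abs_less_iff)
  qed
  let ?x = "\<lambda>t. x (N t) t" and ?y = "\<lambda>t. y (N t) t" and ?e = "\<lambda>t. e (N t) t"
  have "euler_sol {-real n<..<real n} ?x ?y ?e" for n
    using 1(1)[of n] by (rule euler_sol_transform) (use eq in \<open>auto simp: abs_less_iff\<close>)
  moreover have "t \<in> {-real (N t)<..<real (N t)}" for t using N[of t] by auto
  ultimately have "euler_sol UNIV ?x ?y ?e" unfolding euler_sol_def by blast
  then show ?thesis using 1 by (intro exI[of _ ?x] exI[of _ ?y] exI[of _ ?e]) auto
qed


section \<open>The flow on the sphere and its continuity\<close>

type_synonym r3 = "real \<times> real \<times> real"

definition S2 :: "r3 set" where "S2 = {(x, y, e). x\<^sup>2 + y\<^sup>2 + e\<^sup>2 = 1}"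

lemma S2_iff [simp]: "(x, y, e) \<in> S2 \<longleftrightarrow> x\<^sup>2 + y\<^sup>2 + e\<^sup>2 = 1"
  by (simp add: S2_def)

lemma dist_r3: "dist (x, y, e) (x', y', e') = sqrt ((x - x')\<^sup>2 + (y - y')\<^sup>2 + (e - (e'::real))\<^sup>2)" for x y x' y' :: real
  by (simp add: dist_Pair_Pair dist_real_def)

definition euler_curve :: "r3 \<Rightarrow> (real \<Rightarrow> real) \<times> (real \<Rightarrow> real) \<times> (real \<Rightarrow> real)" where
  "euler_curve p = (SOME (x, y, e). euler_sol UNIV x y e \<and> (x 0, y 0, e 0) = p)"

definition euler_x :: "r3 \<Rightarrow> real \<Rightarrow> real" where "euler_x p = fst (euler_curve p)"
definition euler_y :: "r3 \<Rightarrow> real \<Rightarrow> real" where "euler_y p = fst (snd (euler_curve p))"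
definition euler_e :: "r3 \<Rightarrow> real \<Rightarrow> real" where "euler_e p = snd (snd (euler_curve p))"

definition euler_flow :: "real \<Rightarrow> r3 \<Rightarrow> r3" where
  "euler_flow t p = (euler_x p t, euler_y p t, euler_e p t)"

lemma euler_curve:
  assumes "p \<in> S2"
  shows "euler_sol UNIV (euler_x p) (euler_y p) (euler_e p)" "(euler_x p 0, euler_y p 0, euler_e p 0) = p"
proof -
  obtain x0 y0 e0 where p: "p = (x0, y0, e0)" by (cases p)
  obtain x y e where "euler_sol UNIV x y e" "x 0 = x0" "y 0 = y0" "e 0 = e0"
    using euler_global_existence[of x0 y0 e0] assms p by auto
  then have "\<exists>z. case z of (x, y, e) \<Rightarrow> euler_sol UNIV x y e \<and> (x 0, y 0, e 0) = p"
    by (intro exI[of _ "(x, y, e)"]) (simp add: p)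
  then have "case euler_curve p of (x, y, e) \<Rightarrow> euler_sol UNIV x y e \<and> (x 0, y 0, e 0) = p"
    unfolding euler_curve_def by (rule someI_ex)
  then show "euler_sol UNIV (euler_x p) (euler_y p) (euler_e p)" "(euler_x p 0, euler_y p 0, euler_e p 0) = p"
    by (auto simp: euler_x_def euler_y_def euler_e_def split: prod.splits)
qed

lemma euler_flow_0 [simp]: "p \<in> S2 \<Longrightarrow> euler_flow 0 p = p"
  using euler_curve(2) by (simp add: euler_flow_def)

lemma euler_sol_interval: "euler_sol UNIV x y e \<Longrightarrow> euler_sol {a<..<b} x y e"
  by (auto simp: euler_sol_def)

lemma euler_sol_conserved:
  assumes "euler_sol UNIV x y e"
  shows "(x t)\<^sup>2 + (y t)\<^sup>2 + (e t)\<^sup>2 = (x 0)\<^sup>2 + (y 0)\<^sup>2 + (e 0)\<^sup>2"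
    and "(x t)\<^sup>2 + 2 * (y t)\<^sup>2 = (x 0)\<^sup>2 + 2 * (y 0)\<^sup>2"
    and "(x t)\<^sup>2 + 2 * (e t)\<^sup>2 = (x 0)\<^sup>2 + 2 * (e 0)\<^sup>2"
  by (rule euler_conserved[OF euler_sol_interval[OF assms, of "-\<bar>t\<bar>-1" "\<bar>t\<bar>+1"]]; auto)+

lemma euler_flow_in_S2: "p \<in> S2 \<Longrightarrow> euler_flow t p \<in> S2"
  using euler_sol_conserved(1)[OF euler_curve(1)] euler_curve(2)[of p]
  by (cases p) (auto simp: euler_flow_def)

lemma euler_flow_unique:
  assumes "euler_sol UNIV x y e" "(x s, y s, e s) \<in> S2"
  shows "euler_flow t (x s, y s, e s) = (x (s + t), y (s + t), e (s + t))"
proof -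
  let ?p = "(x s, y s, e s)"
  have sol: "euler_sol UNIV (\<lambda>t. x (t + s)) (\<lambda>t. y (t + s)) (\<lambda>t. e (t + s))"
    by (rule euler_sol_shift[OF assms(1)]) simp
  have t: "t \<in> {-\<bar>t\<bar>-1<..<\<bar>t\<bar>+1}" "0 \<in> {-\<bar>t\<bar>-1<..<\<bar>t\<bar>+1}" by auto
  have i: "euler_x ?p 0 = x s" "euler_y ?p 0 = y s" "euler_e ?p 0 = e s" using euler_curve(2)[OF assms(2)] by auto
  have "(euler_x ?p 0)\<^sup>2 + (euler_y ?p 0)\<^sup>2 + (euler_e ?p 0)\<^sup>2 = 1" "x (0 + s) = euler_x ?p 0"
    "y (0 + s) = euler_y ?p 0" "e (0 + s) = euler_e ?p 0"
    using assms(2) by (simp_all add: i)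
  from euler_unique[OF euler_sol_interval[OF euler_curve(1)[OF assms(2)]] euler_sol_interval[OF sol] this t]
  show ?thesis by (simp add: euler_flow_def add.commute)
qed

lemma euler_flow_add:
  assumes "p \<in> S2"
  shows "euler_flow (s + t) p = euler_flow t (euler_flow s p)"
  using euler_flow_unique[OF euler_curve(1)[OF assms], of s t] euler_flow_in_S2[OF assms, of s]
  by (simp add: euler_flow_def)

lemma dist_euler_flow:
  assumes "p \<in> S2" "q \<in> S2"
  shows "dist (euler_flow t p) (euler_flow t q) \<le> exp (3 * \<bar>t\<bar>) * dist p q"
proof -
  have *: "(x, y, e) \<in> S2 \<Longrightarrow> x\<^sup>2 + y\<^sup>2 + e\<^sup>2 = 1" for x y e by simp
  have "- \<bar>t\<bar> - 1 < t" "t < \<bar>t\<bar> + 1" by linarith+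
  then have "(dist (euler_flow t p) (euler_flow t q))\<^sup>2 \<le> exp (6 * \<bar>t\<bar>) * (dist p q)\<^sup>2"
    using euler_dependence[OF euler_sol_interval[OF euler_curve(1)[OF assms(1)]]
        euler_sol_interval[OF euler_curve(1)[OF assms(2)]], of t "-\<bar>t\<bar>-1" "\<bar>t\<bar>+1"]
      euler_curve(2)[OF assms(1)] euler_curve(2)[OF assms(2)] assms
    by (cases p; cases q) (auto simp: euler_flow_def dist_r3)
  also have "\<dots> = (exp (3 * \<bar>t\<bar>) * dist p q)\<^sup>2"
    by (simp add: power_mult_distrib flip: exp_double)
  finally show ?thesis by (rule power2_le_imp_le) simp
qed

lemma continuous_on_euler_flow: "continuous_on S2 (euler_flow t)"
  by (rule lipschitz_on_continuous_on[of "exp (3 * \<bar>t\<bar>)"]) (auto simp: lipschitz_on_def dist_euler_flow)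

section \<open>The group coordinates integrated along an orbit\<close>

definition primitive :: "(real \<Rightarrow> real) \<Rightarrow> real \<Rightarrow> real" where
  "primitive f = (SOME F. F 0 = 0 \<and> (\<forall>t. (F has_real_derivative f t) (at t)))"

lemma primitive:
  assumes "\<And>t. isCont f t"
  shows "primitive f 0 = 0" "(primitive f has_real_derivative f t) (at t)"
proof -
  obtain F where F: "\<And>t. (F has_vector_derivative f t) (at t)"
    using einterval_antiderivative[of "-\<infinity>" "\<infinity>" f] assms by auto
  then have "((\<lambda>t. F t - F 0) has_real_derivative f t) (at t)" for t
    by (auto intro!: derivative_eq_intros simp: has_real_derivative_iff_has_vector_derivative)
  then have "\<exists>F. F 0 = 0 \<and> (\<forall>t. (F has_real_derivative f t) (at t))"
    by (intro exI[of _ "\<lambda>t. F t - F 0"]) auto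
  from someI_ex[OF this] show "primitive f 0 = 0" "(primitive f has_real_derivative f t) (at t)"
    unfolding primitive_def by auto
qed

lemma deriv_bound_imp:
  fixes f :: "real \<Rightarrow> real"
  assumes "\<And>s. min 0 t \<le> s \<Longrightarrow> s \<le> max 0 t \<Longrightarrow> (f has_real_derivative f' s) (at s)"
    and "\<And>s. min 0 t \<le> s \<Longrightarrow> s \<le> max 0 t \<Longrightarrow> \<bar>f' s\<bar> \<le> B"
  shows "\<bar>f t - f 0\<bar> \<le> B * \<bar>t\<bar>"
  using field_differentiable_bound[of "{min 0 t..max 0 t}" f f' B t 0] assms
  by (auto intro: has_field_derivative_at_within)

lemma euler_curve_deriv:
  assumes "p \<in> S2"
  shows "(euler_x p has_real_derivative - 2 * euler_e p t * euler_y p t) (at t)"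
    "(euler_y p has_real_derivative euler_e p t * euler_x p t) (at t)"
    "(euler_e p has_real_derivative euler_x p t * euler_y p t) (at t)"
  using euler_curve(1)[OF assms] by (auto simp: euler_sol_def)

lemma euler_curve_le1:
  assumes "p \<in> S2" shows "\<bar>euler_x p t\<bar> \<le> 1" "\<bar>euler_y p t\<bar> \<le> 1" "\<bar>euler_e p t\<bar> \<le> 1"
  using sphere_abs_le[of "euler_x p t" "euler_y p t" "euler_e p t"] euler_flow_in_S2[OF assms, of t]
  by (auto simp: euler_flow_def)

text \<open>For the solution over \<open>p\<close> that starts at the identity of the group,
  \<open>drift\<close> is the \<open>u\<close> coordinate, and \<open>fibre1 l1\<close>,
  \<open>fibre2 l2\<close> below are the two \<open>w\<close> coordinates, since the exponential of
  \<open>u L\<close> acts diagonally.\<close>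

definition drift :: "r3 \<Rightarrow> real \<Rightarrow> real" where "drift p = primitive (euler_e p)"

definition fibre1 :: "real \<Rightarrow> r3 \<Rightarrow> real \<Rightarrow> real" where
  "fibre1 l p = primitive (\<lambda>t. exp (l * drift p t) * euler_x p t)"
definition fibre2 :: "real \<Rightarrow> r3 \<Rightarrow> real \<Rightarrow> real" where
  "fibre2 l p = primitive (\<lambda>t. exp (l * drift p t) * euler_y p t)"

lemma drift:
  assumes "p \<in> S2"
  shows "drift p 0 = 0" "(drift p has_real_derivative euler_e p t) (at t)"
  unfolding drift_def using primitive[of "euler_e p"] euler_curve_deriv[OF assms] DERIV_isCont by blast+

lemma fibre1:
  assumes "p \<in> S2"
  shows "fibre1 l p 0 = 0" "(fibre1 l p has_real_derivative exp (l * drift p t) * euler_x p t) (at t)"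
proof -
  have "isCont (\<lambda>t. exp (l * drift p t) * euler_x p t) t" for t
    using euler_curve_deriv[OF assms] drift[OF assms]
    by (intro DERIV_isCont[OF DERIV_mult]) (auto intro!: derivative_eq_intros)
  from primitive[OF this] show "fibre1 l p 0 = 0" "(fibre1 l p has_real_derivative exp (l * drift p t) * euler_x p t) (at t)"
    unfolding fibre1_def by auto
qed

lemma fibre2:
  assumes "p \<in> S2"
  shows "fibre2 l p 0 = 0" "(fibre2 l p has_real_derivative exp (l * drift p t) * euler_y p t) (at t)"
proof -
  have "isCont (\<lambda>t. exp (l * drift p t) * euler_y p t) t" for t
    using euler_curve_deriv[OF assms] drift[OF assms]
    by (intro DERIV_isCont[OF DERIV_mult]) (auto intro!: derivative_eq_intros)
  from primitive[OF this] show "fibre2 l p 0 = 0" "(fibre2 l p has_real_derivative exp (l * drift p t) * euler_y p t) (at t)"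
    unfolding fibre2_def by auto
qed

lemma drift_le: "p \<in> S2 \<Longrightarrow> \<bar>drift p t\<bar> \<le> \<bar>t\<bar>"
  using deriv_bound_imp[of t "drift p" "euler_e p" 1] drift euler_curve_le1 by simp

lemma euler_comp_dist:
  assumes "p \<in> S2" "q \<in> S2" "\<bar>s\<bar> \<le> \<bar>t\<bar>"
  shows "\<bar>euler_x p s - euler_x q s\<bar> \<le> exp (3 * \<bar>t\<bar>) * dist p q" "\<bar>euler_y p s - euler_y q s\<bar> \<le> exp (3 * \<bar>t\<bar>) * dist p q"
    "\<bar>euler_e p s - euler_e q s\<bar> \<le> exp (3 * \<bar>t\<bar>) * dist p q"
proof -
  have "dist (euler_flow s p) (euler_flow s q) \<le> exp (3 * \<bar>s\<bar>) * dist p q" by (rule dist_euler_flow[OF assms(1,2)])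
  also have "\<dots> \<le> exp (3 * \<bar>t\<bar>) * dist p q" using assms(3) by (intro mult_right_mono) auto
  finally have *: "dist (euler_flow s p) (euler_flow s q) \<le> exp (3 * \<bar>t\<bar>) * dist p q" .
  show "\<bar>euler_x p s - euler_x q s\<bar> \<le> exp (3 * \<bar>t\<bar>) * dist p q"
    using order_trans[OF dist_fst_le *] by (simp add: euler_flow_def dist_real_def)
  show "\<bar>euler_y p s - euler_y q s\<bar> \<le> exp (3 * \<bar>t\<bar>) * dist p q"
    using order_trans[OF dist_fst_le order_trans[OF dist_snd_le *]] by (simp add: euler_flow_def dist_real_def)
  show "\<bar>euler_e p s - euler_e q s\<bar> \<le> exp (3 * \<bar>t\<bar>) * dist p q"
    using order_trans[OF dist_snd_le order_trans[OF dist_snd_le *]] by (simp add: euler_flow_def dist_real_def)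
qed

lemma drift_dist:
  assumes "p \<in> S2" "q \<in> S2" "\<bar>s\<bar> \<le> \<bar>t\<bar>"
  shows "\<bar>drift p s - drift q s\<bar> \<le> exp (3 * \<bar>t\<bar>) * \<bar>t\<bar> * dist p q"
proof -
  have "\<bar>(\<lambda>s. drift p s - drift q s) s - (\<lambda>s. drift p s - drift q s) 0\<bar> \<le> (exp (3 * \<bar>t\<bar>) * dist p q) * \<bar>s\<bar>"
  proof (rule deriv_bound_imp)
    fix r assume r: "min 0 s \<le> r" "r \<le> max 0 s"
    show "((\<lambda>s. drift p s - drift q s) has_real_derivative euler_e p r - euler_e q r) (at r)"
      by (intro derivative_intros drift assms)
    show "\<bar>euler_e p r - euler_e q r\<bar> \<le> exp (3 * \<bar>t\<bar>) * dist p q" using euler_comp_dist assms r by auto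
  qed
  also have "\<dots> \<le> (exp (3 * \<bar>t\<bar>) * dist p q) * \<bar>t\<bar>" using assms by (intro mult_left_mono) auto
  finally show ?thesis using drift(1) assms by (simp add: mult_ac)
qed

lemma exp_diff_bound:
  fixes a b M :: real
  assumes "\<bar>a\<bar> \<le> M" "\<bar>b\<bar> \<le> M"
  shows "\<bar>exp a - exp b\<bar> \<le> exp M * \<bar>a - b\<bar>"
  using field_differentiable_bound[of "{-M..M}" exp exp "exp M" a b] assms
  by (auto simp: abs_le_iff intro!: has_field_derivative_at_within[OF DERIV_exp])

lemma weighted_diff_bound:
  fixes x y :: "real"
  assumes pq: "p \<in> S2" "q \<in> S2" and s: "\<bar>s\<bar> \<le> \<bar>t\<bar>" and xy: "\<bar>y\<bar> \<le> 1" "\<bar>x - y\<bar> \<le> exp (3 * \<bar>t\<bar>) * dist p q"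
  shows "\<bar>exp (l * drift p s) * x - exp (l * drift q s) * y\<bar>
    \<le> exp (\<bar>l\<bar> * \<bar>t\<bar>) * exp (3 * \<bar>t\<bar>) * (1 + \<bar>l\<bar> * \<bar>t\<bar>) * dist p q"
proof -
  have b: "\<bar>l * drift r s\<bar> \<le> \<bar>l\<bar> * \<bar>t\<bar>" if "r \<in> S2" for r
    unfolding abs_mult using drift_le[OF that, of s] s by (intro mult_left_mono) auto
  have "\<bar>exp (l * drift p s) * x - exp (l * drift q s) * y\<bar>
    = \<bar>exp (l * drift p s) * (x - y) + (exp (l * drift p s) - exp (l * drift q s)) * y\<bar>" by (simp add: algebra_simps)
  also have "\<dots> \<le> exp (l * drift p s) * \<bar>x - y\<bar> + \<bar>exp (l * drift p s) - exp (l * drift q s)\<bar> * \<bar>y\<bar>"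
    by (rule order_trans[OF abs_triangle_ineq]) (simp add: abs_mult)
  also have "\<dots> \<le> exp (\<bar>l\<bar> * \<bar>t\<bar>) * (exp (3 * \<bar>t\<bar>) * dist p q) + exp (\<bar>l\<bar> * \<bar>t\<bar>) * (\<bar>l\<bar> * (exp (3 * \<bar>t\<bar>) * \<bar>t\<bar> * dist p q))"
  proof (rule add_mono)
    show "exp (l * drift p s) * \<bar>x - y\<bar> \<le> exp (\<bar>l\<bar> * \<bar>t\<bar>) * (exp (3 * \<bar>t\<bar>) * dist p q)"
      using b[OF pq(1)] xy by (intro mult_mono) auto
    have "\<bar>exp (l * drift p s) - exp (l * drift q s)\<bar> * \<bar>y\<bar> \<le> \<bar>exp (l * drift p s) - exp (l * drift q s)\<bar>"
      using xy by (simp add: mult_left_le)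
    also have "\<dots> \<le> exp (\<bar>l\<bar> * \<bar>t\<bar>) * \<bar>l * drift p s - l * drift q s\<bar>" by (rule exp_diff_bound[OF b b]) fact+
    also have "\<bar>l * drift p s - l * drift q s\<bar> = \<bar>l\<bar> * \<bar>drift p s - drift q s\<bar>" by (simp add: abs_mult flip: right_diff_distrib)
    also have "exp (\<bar>l\<bar> * \<bar>t\<bar>) * (\<bar>l\<bar> * \<bar>drift p s - drift q s\<bar>) \<le> exp (\<bar>l\<bar> * \<bar>t\<bar>) * (\<bar>l\<bar> * (exp (3 * \<bar>t\<bar>) * \<bar>t\<bar> * dist p q))"
      by (intro mult_left_mono drift_dist pq s) auto
    finally show "\<bar>exp (l * drift p s) - exp (l * drift q s)\<bar> * \<bar>y\<bar> \<le> exp (\<bar>l\<bar> * \<bar>t\<bar>) * (\<bar>l\<bar> * (exp (3 * \<bar>t\<bar>) * \<bar>t\<bar> * dist p q))" .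
  qed
  also have "\<dots> = exp (\<bar>l\<bar> * \<bar>t\<bar>) * exp (3 * \<bar>t\<bar>) * (1 + \<bar>l\<bar> * \<bar>t\<bar>) * dist p q" by (simp add: algebra_simps)
  finally show ?thesis .
qed

text \<open>The two velocities are compared by \<open>weighted_diff_bound\<close> and the difference
  is integrated. The constant depends on \<open>l\<close> and \<open>t\<close> only, which yields
  continuity on the sphere at each fixed time, and later measurability of the cocycle.\<close>

lemma fibre_dist:
  assumes "p \<in> S2" "q \<in> S2"
  shows "\<bar>fibre1 l p t - fibre1 l q t\<bar> \<le> (exp (\<bar>l\<bar> * \<bar>t\<bar>) * exp (3 * \<bar>t\<bar>) * (1 + \<bar>l\<bar> * \<bar>t\<bar>) * \<bar>t\<bar>) * dist p q"
    "\<bar>fibre2 l p t - fibre2 l q t\<bar> \<le> (exp (\<bar>l\<bar> * \<bar>t\<bar>) * exp (3 * \<bar>t\<bar>) * (1 + \<bar>l\<bar> * \<bar>t\<bar>) * \<bar>t\<bar>) * dist p q"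
proof -
  let ?B = "exp (\<bar>l\<bar> * \<bar>t\<bar>) * exp (3 * \<bar>t\<bar>) * (1 + \<bar>l\<bar> * \<bar>t\<bar>) * dist p q"
  have "\<bar>(\<lambda>s. fibre1 l p s - fibre1 l q s) t - (\<lambda>s. fibre1 l p s - fibre1 l q s) 0\<bar> \<le> ?B * \<bar>t\<bar>"
  proof (rule deriv_bound_imp)
    fix r assume r: "min 0 t \<le> r" "r \<le> max 0 t"
    show "((\<lambda>s. fibre1 l p s - fibre1 l q s) has_real_derivative
        exp (l * drift p r) * euler_x p r - exp (l * drift q r) * euler_x q r) (at r)"
      by (intro derivative_intros fibre1 assms)
    show "\<bar>exp (l * drift p r) * euler_x p r - exp (l * drift q r) * euler_x q r\<bar> \<le> ?B"
      using r by (intro weighted_diff_bound assms euler_comp_dist euler_curve_le1) auto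
  qed
  then show "\<bar>fibre1 l p t - fibre1 l q t\<bar> \<le> (exp (\<bar>l\<bar> * \<bar>t\<bar>) * exp (3 * \<bar>t\<bar>) * (1 + \<bar>l\<bar> * \<bar>t\<bar>) * \<bar>t\<bar>) * dist p q"
    using fibre1(1) assms by (simp add: mult_ac)
  have "\<bar>(\<lambda>s. fibre2 l p s - fibre2 l q s) t - (\<lambda>s. fibre2 l p s - fibre2 l q s) 0\<bar> \<le> ?B * \<bar>t\<bar>"
  proof (rule deriv_bound_imp)
    fix r assume r: "min 0 t \<le> r" "r \<le> max 0 t"
    show "((\<lambda>s. fibre2 l p s - fibre2 l q s) has_real_derivative
        exp (l * drift p r) * euler_y p r - exp (l * drift q r) * euler_y q r) (at r)"
      by (intro derivative_intros fibre2 assms)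
    show "\<bar>exp (l * drift p r) * euler_y p r - exp (l * drift q r) * euler_y q r\<bar> \<le> ?B"
      using r by (intro weighted_diff_bound assms euler_comp_dist euler_curve_le1) auto
  qed
  then show "\<bar>fibre2 l p t - fibre2 l q t\<bar> \<le> (exp (\<bar>l\<bar> * \<bar>t\<bar>) * exp (3 * \<bar>t\<bar>) * (1 + \<bar>l\<bar> * \<bar>t\<bar>) * \<bar>t\<bar>) * dist p q"
    using fibre2(1) assms by (simp add: mult_ac)
qed

lemma continuous_on_drift: "continuous_on S2 (\<lambda>p. drift p t)"
  by (rule lipschitz_on_continuous_on[of "exp (3 * \<bar>t\<bar>) * \<bar>t\<bar>"])
     (auto simp: lipschitz_on_def dist_real_def intro!: drift_dist)

lemma continuous_on_fibre: "continuous_on S2 (\<lambda>p. fibre1 l p t)" "continuous_on S2 (\<lambda>p. fibre2 l p t)"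
  by (rule lipschitz_on_continuous_on[of "exp (\<bar>l\<bar> * \<bar>t\<bar>) * exp (3 * \<bar>t\<bar>) * (1 + \<bar>l\<bar> * \<bar>t\<bar>) * \<bar>t\<bar>"],
      auto simp: lipschitz_on_def dist_real_def intro!: fibre_dist)+

text \<open>Along an orbit the second derivatives of the coordinates are cubic, with coefficients of
  total size at most 4 and monomials bounded by 1. Each coordinate therefore errs by at most
  \<open>4 * h\<^sup>2\<close>, and the three errors add up to less than the stated bound.\<close>

lemma euler_flow_first_order:
  assumes "(x, y, e) \<in> S2" "\<bar>h\<bar> \<le> 1"
  shows "dist (euler_flow h (x, y, e)) (x - h * (2 * e * y), y + h * (e * x), e + h * (x * y)) \<le> 20 * h\<^sup>2"
proof -
  let ?p = "(x, y, e)"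
  have i: "euler_x ?p 0 = x" "euler_y ?p 0 = y" "euler_e ?p 0 = e" using euler_curve(2)[OF assms(1)] by auto
  have b: "\<bar>f h - (f 0 + h * f' 0)\<bar> \<le> B * h\<^sup>2"
    if f: "\<And>t. (f has_real_derivative f' t) (at t)" and f': "\<And>t. (f' has_real_derivative f'' t) (at t)" 
      and "\<And>t. \<bar>f'' t\<bar> \<le> B" for f f' f'' :: "real \<Rightarrow> real" and B
  proof -
    have "\<bar>(\<lambda>t. f t - t * f' 0) h - (\<lambda>t. f t - t * f' 0) 0\<bar> \<le> (B * \<bar>h\<bar>) * \<bar>h\<bar>"
    proof (rule deriv_bound_imp)
      fix s assume s: "min 0 h \<le> s" "s \<le> max 0 h"
      show "((\<lambda>t. f t - t * f' 0) has_real_derivative f' s - f' 0) (at s)" by (auto intro!: derivative_eq_intros f)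
      have "\<bar>f' s - f' 0\<bar> \<le> B * \<bar>s\<bar>" by (rule deriv_bound_imp[where f' = f'']) (use f' that in auto)
      also have "\<dots> \<le> B * \<bar>h\<bar>" using s that(3)[of 0] by (intro mult_left_mono) auto
      finally show "\<bar>f' s - f' 0\<bar> \<le> B * \<bar>h\<bar>" .
    qed
    then show ?thesis by (simp add: power2_eq_square algebra_simps)
  qed
  note d = euler_curve_deriv[OF assms(1)]
  have m2: "\<bar>u * v\<bar> \<le> 1" if "\<bar>u\<bar> \<le> 1" "\<bar>v\<bar> \<le> 1" for u v :: real using that by (simp add: abs_mult mult_le_one)
  have sq: "\<bar>euler_x ?p t * euler_y ?p t\<bar> \<le> 1" "\<bar>euler_e ?p t * euler_x ?p t\<bar> \<le> 1" "\<bar>euler_e ?p t * euler_y ?p t\<bar> \<le> 1" for t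
    by (intro m2 euler_curve_le1 assms)+
  have cu: "\<bar>(euler_x ?p t * euler_y ?p t) * euler_y ?p t\<bar> \<le> 1" "\<bar>euler_e ?p t * (euler_e ?p t * euler_x ?p t)\<bar> \<le> 1"
    "\<bar>(euler_x ?p t * euler_y ?p t) * euler_x ?p t\<bar> \<le> 1" "\<bar>euler_e ?p t * (euler_e ?p t * euler_y ?p t)\<bar> \<le> 1"
    "\<bar>euler_x ?p t * (euler_e ?p t * euler_x ?p t)\<bar> \<le> 1" "\<bar>(euler_e ?p t * euler_y ?p t) * euler_y ?p t\<bar> \<le> 1" for t
    by (intro m2 sq euler_curve_le1 assms)+
  have lin: "\<bar>- 2 * u - 2 * v\<bar> \<le> 4" "\<bar>u - 2 * v\<bar> \<le> 4" if "\<bar>u\<bar> \<le> 1" "\<bar>v\<bar> \<le> 1" for u v :: real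
    using that by linarith+
  have 1: "\<bar>euler_x ?p h - (euler_x ?p 0 + h * (- 2 * euler_e ?p 0 * euler_y ?p 0))\<bar> \<le> 4 * h\<^sup>2"
  proof (rule b[where f'' = "\<lambda>t. - 2 * ((euler_x ?p t * euler_y ?p t) * euler_y ?p t) - 2 * (euler_e ?p t * (euler_e ?p t * euler_x ?p t))"])
    fix t show "((\<lambda>t. - 2 * euler_e ?p t * euler_y ?p t) has_real_derivative
      - 2 * ((euler_x ?p t * euler_y ?p t) * euler_y ?p t) - 2 * (euler_e ?p t * (euler_e ?p t * euler_x ?p t))) (at t)"
      by (rule derivative_eq_intros d refl)+ (simp add: algebra_simps)
  qed (rule d, rule lin(1), rule cu, rule cu)
  have 2: "\<bar>euler_y ?p h - (euler_y ?p 0 + h * (euler_e ?p 0 * euler_x ?p 0))\<bar> \<le> 4 * h\<^sup>2"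
  proof (rule b[where f'' = "\<lambda>t. ((euler_x ?p t * euler_y ?p t) * euler_x ?p t) - 2 * (euler_e ?p t * (euler_e ?p t * euler_y ?p t))"])
    fix t show "((\<lambda>t. euler_e ?p t * euler_x ?p t) has_real_derivative
      ((euler_x ?p t * euler_y ?p t) * euler_x ?p t) - 2 * (euler_e ?p t * (euler_e ?p t * euler_y ?p t))) (at t)"
      by (rule derivative_eq_intros d refl)+ (simp add: algebra_simps)
  qed (rule d, rule lin(2), rule cu, rule cu)
  have 3: "\<bar>euler_e ?p h - (euler_e ?p 0 + h * (euler_x ?p 0 * euler_y ?p 0))\<bar> \<le> 4 * h\<^sup>2"
  proof (rule b[where f'' = "\<lambda>t. (euler_x ?p t * (euler_e ?p t * euler_x ?p t)) - 2 * ((euler_e ?p t * euler_y ?p t) * euler_y ?p t)"])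
    fix t show "((\<lambda>t. euler_x ?p t * euler_y ?p t) has_real_derivative
      (euler_x ?p t * (euler_e ?p t * euler_x ?p t)) - 2 * ((euler_e ?p t * euler_y ?p t) * euler_y ?p t)) (at t)"
      by (rule derivative_eq_intros d refl)+ (simp add: algebra_simps)
  qed (rule d, rule lin(2), rule cu, rule cu)
  have tri: "dist (a, b, c) (a', b', c') \<le> \<bar>a - a'\<bar> + \<bar>b - b'\<bar> + \<bar>c - c'\<bar>" for a b c a' b' c' :: real
    unfolding dist_r3 by (rule real_le_lsqrt) (auto simp: power2_eq_square algebra_simps abs_mult_self_eq)
  show ?thesis unfolding euler_flow_def using tri[of "euler_x ?p h" "euler_y ?p h" "euler_e ?p h" "x - h * (2 * e * y)" "y + h * (e * x)" "e + h * (x * y)"] 1 2 3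
    unfolding i by (simp add: algebra_simps)
qed

section \<open>Invariance of the sphere measure\<close>

text \<open>The slice at \<open>y\<close> of the preimage of \<open>A\<close> is the
  \<open>T y\<close>-preimage of the slice of \<open>A\<close> at \<open>S y\<close>; Fubini does
  the rest. It serves twice: for shears of Lebesgue measure, and for the whole flow over the sphere
  flow.\<close>

lemma (in pair_sigma_finite) distr_skew_snd:
  assumes T: "(\<lambda>(x, y). T y x) \<in> measurable (M1 \<Otimes>\<^sub>M M2) M1" and S: "S \<in> measurable M2 M2"
    and inv: "\<And>y. y \<in> space M2 \<Longrightarrow> distr M1 M1 (T y) = M1" "distr M2 M2 S = M2"
  shows "distr (M1 \<Otimes>\<^sub>M M2) (M1 \<Otimes>\<^sub>M M2) (\<lambda>(x, y). (T y x, S y)) = M1 \<Otimes>\<^sub>M M2"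
proof (rule measure_eqI)
  have m: "(\<lambda>(x, y). (T y x, S y)) \<in> measurable (M1 \<Otimes>\<^sub>M M2) (M1 \<Otimes>\<^sub>M M2)"
    using T S by (auto intro!: measurable_Pair simp: split_beta')
  fix A assume "A \<in> sets (distr (M1 \<Otimes>\<^sub>M M2) (M1 \<Otimes>\<^sub>M M2) (\<lambda>(x, y). (T y x, S y)))"
  then have A: "A \<in> sets (M1 \<Otimes>\<^sub>M M2)" by simp
  let ?P = "(\<lambda>(x, y). (T y x, S y)) -` A \<inter> space (M1 \<Otimes>\<^sub>M M2)"
  have "emeasure (distr (M1 \<Otimes>\<^sub>M M2) (M1 \<Otimes>\<^sub>M M2) (\<lambda>(x, y). (T y x, S y))) A = emeasure (M1 \<Otimes>\<^sub>M M2) ?P"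
    by (rule emeasure_distr[OF m A])
  also have "\<dots> = (\<integral>\<^sup>+y. emeasure M1 ((\<lambda>x. (x, y)) -` ?P) \<partial>M2)"
    by (rule emeasure_pair_measure_alt2) (use measurable_sets[OF m A] in simp)
  also have "\<dots> = (\<integral>\<^sup>+y. emeasure M1 ((\<lambda>x. (x, S y)) -` A) \<partial>M2)"
  proof (rule nn_integral_cong)
    fix y assume y: "y \<in> space M2"
    have Ty: "T y \<in> measurable M1 M1"
      using measurable_compose[OF measurable_Pair2'[OF y, of M1] T] by simp
    have Sy: "S y \<in> space M2" using S y by (rule measurable_space)
    have "(\<lambda>x. (x, S y)) -` A \<in> sets M1" by (rule sets_Pair2[OF A])
    then have "emeasure M1 ((\<lambda>x. (x, S y)) -` A) = emeasure (distr M1 M1 (T y)) ((\<lambda>x. (x, S y)) -` A)"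
      by (simp add: inv y)
    also have "\<dots> = emeasure M1 (T y -` ((\<lambda>x. (x, S y)) -` A) \<inter> space M1)"
      by (rule emeasure_distr[OF Ty sets_Pair2[OF A]])
    also have "T y -` ((\<lambda>x. (x, S y)) -` A) \<inter> space M1 = (\<lambda>x. (x, y)) -` ?P"
      using y by (auto simp: space_pair_measure)
    finally show "emeasure M1 ((\<lambda>x. (x, y)) -` ?P) = emeasure M1 ((\<lambda>x. (x, S y)) -` A)" by simp
  qed
  also have "\<dots> = (\<integral>\<^sup>+y. emeasure M1 ((\<lambda>x. (x, y)) -` A) \<partial>distr M2 M2 S)"
    by (rule nn_integral_distr[symmetric, OF S]) (simp add: measurable_emeasure_Pair2[OF A])
  also have "\<dots> = emeasure (M1 \<Otimes>\<^sub>M M2) A" unfolding inv(2) by (rule emeasure_pair_measure_alt2[symmetric, OF A])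
  finally show "emeasure (distr (M1 \<Otimes>\<^sub>M M2) (M1 \<Otimes>\<^sub>M M2) (\<lambda>(x, y). (T y x, S y))) A = emeasure (M1 \<Otimes>\<^sub>M M2) A" .
qed simp

lemma (in pair_sigma_finite) distr_skew_fst:
  assumes T: "(\<lambda>(x, y). T x y) \<in> measurable (M1 \<Otimes>\<^sub>M M2) M2"
    and inv: "\<And>x. x \<in> space M1 \<Longrightarrow> distr M2 M2 (T x) = M2"
  shows "distr (M1 \<Otimes>\<^sub>M M2) (M1 \<Otimes>\<^sub>M M2) (\<lambda>(x, y). (x, T x y)) = M1 \<Otimes>\<^sub>M M2"
proof (rule measure_eqI)
  have m: "(\<lambda>(x, y). (x, T x y)) \<in> measurable (M1 \<Otimes>\<^sub>M M2) (M1 \<Otimes>\<^sub>M M2)"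
    using T by (auto intro!: measurable_Pair simp: split_beta')
  fix A assume "A \<in> sets (distr (M1 \<Otimes>\<^sub>M M2) (M1 \<Otimes>\<^sub>M M2) (\<lambda>(x, y). (x, T x y)))"
  then have A: "A \<in> sets (M1 \<Otimes>\<^sub>M M2)" by simp
  let ?P = "(\<lambda>(x, y). (x, T x y)) -` A \<inter> space (M1 \<Otimes>\<^sub>M M2)"
  have "emeasure (distr (M1 \<Otimes>\<^sub>M M2) (M1 \<Otimes>\<^sub>M M2) (\<lambda>(x, y). (x, T x y))) A = emeasure (M1 \<Otimes>\<^sub>M M2) ?P"
    by (rule emeasure_distr[OF m A])
  also have "\<dots> = (\<integral>\<^sup>+x. emeasure M2 (Pair x -` ?P) \<partial>M1)"
    by (rule M2.emeasure_pair_measure_alt) (use measurable_sets[OF m A] in simp)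
  also have "\<dots> = (\<integral>\<^sup>+x. emeasure M2 (Pair x -` A) \<partial>M1)"
  proof (rule nn_integral_cong)
    fix x assume x: "x \<in> space M1"
    have Tx: "T x \<in> measurable M2 M2"
      using measurable_compose[OF measurable_Pair1'[OF x, of M2] T] by simp
    have "emeasure M2 (Pair x -` A) = emeasure (distr M2 M2 (T x)) (Pair x -` A)" by (simp add: inv x)
    also have "\<dots> = emeasure M2 (T x -` (Pair x -` A) \<inter> space M2)"
      by (rule emeasure_distr[OF Tx sets_Pair1[OF A]])
    also have "T x -` (Pair x -` A) \<inter> space M2 = Pair x -` ?P" using x by (auto simp: space_pair_measure)
    finally show "emeasure M2 (Pair x -` ?P) = emeasure M2 (Pair x -` A)" by simp
  qed
  also have "\<dots> = emeasure (M1 \<Otimes>\<^sub>M M2) A" by (rule M2.emeasure_pair_measure_alt[symmetric, OF A])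
  finally show "emeasure (distr (M1 \<Otimes>\<^sub>M M2) (M1 \<Otimes>\<^sub>M M2) (\<lambda>(x, y). (x, T x y))) A = emeasure (M1 \<Otimes>\<^sub>M M2) A" .
qed simp

lemma distr_lborel_translate: "distr lborel lborel (\<lambda>x. x + a) = (lborel :: real measure)"
  using lborel_distr_plus[of a] distr_cong[OF refl sets_lborel[symmetric], of lborel "(+) a" "\<lambda>x. x + a"]
  by (simp add: add.commute)

lemma lborel_pair_sigma: "pair_sigma_finite (lborel :: 'a::euclidean_space measure) (lborel :: 'b::euclidean_space measure)"
  by (intro pair_sigma_finite.intro sigma_finite_lborel)

lemma distr_lborel_shear_fst:
  fixes f :: "'b::euclidean_space \<Rightarrow> real"
  assumes f: "f \<in> borel_measurable borel"
  shows "distr lborel lborel (\<lambda>(x, y). (x + f y, y)) = (lborel :: (real \<times> 'b) measure)"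
proof -
  have "distr (lborel \<Otimes>\<^sub>M lborel) (lborel \<Otimes>\<^sub>M lborel) (\<lambda>(x, y). ((\<lambda>y x. x + f y) y x, (\<lambda>y. y) y)) = (lborel \<Otimes>\<^sub>M (lborel :: 'b measure))"
    by (rule pair_sigma_finite.distr_skew_snd[OF lborel_pair_sigma]) (use f distr_lborel_translate in \<open>auto simp: split_beta'\<close>)
  then show ?thesis by (simp add: lborel_prod)
qed

lemma distr_lborel_skew:
  fixes T :: "'a::euclidean_space \<Rightarrow> 'b::euclidean_space \<Rightarrow> 'b"
  assumes T: "(\<lambda>(x, y). T x y) \<in> borel_measurable borel"
    and inv: "\<And>x. distr lborel lborel (T x) = lborel"
  shows "distr lborel lborel (\<lambda>(x, y). (x, T x y)) = (lborel :: ('a \<times> 'b) measure)"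
proof -
  have "distr (lborel \<Otimes>\<^sub>M lborel) (lborel \<Otimes>\<^sub>M lborel) (\<lambda>(x, y). (x, T x y)) = (lborel \<Otimes>\<^sub>M (lborel :: 'b measure))"
    by (rule pair_sigma_finite.distr_skew_fst[OF lborel_pair_sigma]) (use T inv in \<open>simp_all add: lborel_prod\<close>)
  then show ?thesis by (simp add: lborel_prod)
qed

definition preserves :: "'a measure \<Rightarrow> ('a \<Rightarrow> 'a) \<Rightarrow> bool" where
  "preserves M T \<longleftrightarrow> T \<in> measurable M M \<and> distr M M T = M"

lemma preserves_comp: "preserves M S \<Longrightarrow> preserves M T \<Longrightarrow> preserves M (S \<circ> T)"
  unfolding preserves_def using distr_distr[of S M M T M] by (auto intro: measurable_comp)

lemma preserves_emeasure:
  "preserves M T \<Longrightarrow> A \<in> sets M \<Longrightarrow> emeasure M (T -` A \<inter> space M) = emeasure M A"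
  unfolding preserves_def using emeasure_distr[of T M M A] by simp

lemma preserves_shear_fst:
  assumes "f \<in> borel_measurable borel"
  shows "preserves (lborel :: (real \<times> 'b::euclidean_space) measure) (\<lambda>(x, y). (x + f y, y))"
proof -
  have "(\<lambda>(x, y). (x + f y, y)) \<in> borel_measurable (borel :: (real \<times> 'b) measure)"
    using assms unfolding borel_prod[symmetric] split_beta' by measurable
  then show ?thesis unfolding preserves_def by (simp add: distr_lborel_shear_fst[OF assms])
qed

lemma preserves_skew:
  fixes T :: "'a::euclidean_space \<Rightarrow> 'b::euclidean_space \<Rightarrow> 'b"
  assumes "(\<lambda>(x, y). T x y) \<in> borel_measurable borel" "\<And>x. preserves lborel (T x)"
  shows "preserves lborel (\<lambda>(x, y). (x, T x y))"
proof -
  have "(\<lambda>(x, y). (x, T x y)) \<in> borel_measurable (borel :: ('a \<times> 'b) measure)"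
    using assms(1) unfolding borel_prod[symmetric] split_beta' by measurable
  then show ?thesis using assms distr_lborel_skew[of T] unfolding preserves_def by simp
qed

lemma preserves_shear_snd:
  assumes "f \<in> borel_measurable borel"
  shows "preserves (lborel :: ('b::euclidean_space \<times> real) measure) (\<lambda>(x, y). (x, y + f x))"
proof (rule preserves_skew[of "\<lambda>x y. y + f x"])
  show "(\<lambda>(x, y). y + f x) \<in> borel_measurable borel"
    using assms unfolding borel_prod[symmetric] split_beta' by measurable
qed (simp add: preserves_def distr_lborel_translate)

definition rot_e :: "real \<Rightarrow> r3 \<Rightarrow> r3" where
  "rot_e \<theta> = (\<lambda>(x, y, e). (cos \<theta> * x - sin \<theta> * y, sin \<theta> * x + cos \<theta> * y, e))"

definition rot_x :: "real \<Rightarrow> r3 \<Rightarrow> r3" where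
  "rot_x \<theta> = (\<lambda>(x, y, e). (x, cos \<theta> * y - sin \<theta> * e, sin \<theta> * y + cos \<theta> * e))"

text \<open>The classical factorisation of a plane rotation into three shears. Shears preserve
  Lebesgue measure by Fubini, so the invariance under rotations follows without determinants. The
  factor \<open>tan (\<theta> / 2)\<close> excludes the half turn.\<close>

lemma rotation_shears:
  fixes x y :: real
  assumes "cos (\<theta> / 2) \<noteq> 0"
  defines "a \<equiv> - tan (\<theta> / 2)" and "b \<equiv> sin \<theta>"
  shows "(x + a * y) + a * (y + b * (x + a * y)) = cos \<theta> * x - sin \<theta> * y"
    "y + b * (x + a * y) = sin \<theta> * x + cos \<theta> * y"
proof -
  let ?s = "sin (\<theta>/2)" and ?c = "cos (\<theta>/2)"
  have sc: "?s\<^sup>2 = 1 - ?c\<^sup>2" by (simp add: sin_squared_eq)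
  have b: "b = 2 * ?s * ?c" unfolding b_def using sin_double[of "\<theta>/2"] by simp
  have c: "cos \<theta> = 2 * ?c\<^sup>2 - 1" using cos_double_cos[of "\<theta>/2"] by simp
  have "a * b = - 2 * ?s\<^sup>2" unfolding b a_def tan_def using assms(1) by (simp add: power2_eq_square)
  then have ab: "a * b = cos \<theta> - 1" unfolding c using sc by simp
  have aab: "2 * a + a * b * a = - sin \<theta>"
  proof -
    have "2 * a + a * b * a = a * (1 + cos \<theta>)" by (simp add: ab algebra_simps)
    also have "\<dots> = - sin \<theta>" unfolding c b[unfolded b_def] a_def tan_def using assms(1) by (simp add: field_simps power2_eq_square)
    finally show ?thesis .
  qed
  have "(x + a * y) + a * (y + b * (x + a * y)) = x * (1 + a * b) + y * (2 * a + a * b * a)" by (simp add: algebra_simps)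
  also have "\<dots> = cos \<theta> * x - sin \<theta> * y" unfolding aab unfolding ab by (simp add: algebra_simps)
  finally show "(x + a * y) + a * (y + b * (x + a * y)) = cos \<theta> * x - sin \<theta> * y" .
  have "y + b * (x + a * y) = b * x + (1 + a * b) * y" by (simp add: algebra_simps)
  also have "\<dots> = sin \<theta> * x + cos \<theta> * y" unfolding ab by (simp add: b_def)
  finally show "y + b * (x + a * y) = sin \<theta> * x + cos \<theta> * y" .
qed

lemma cos_half_nonzero: "cos (\<theta> / 2) \<noteq> 0 \<or> cos (\<theta> / 4) \<noteq> (0::real) \<and> cos (\<theta> / 2 / 2) \<noteq> 0"
proof -
  have "cos (\<theta> / 2) = 2 * (cos (\<theta> / 4))\<^sup>2 - 1" using cos_double_cos[of "\<theta>/4"] by simp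
  then show ?thesis by auto
qed

lemma rot_add: "rot_e (\<alpha> + \<beta>) = rot_e \<alpha> \<circ> rot_e \<beta>" "rot_x (\<alpha> + \<beta>) = rot_x \<alpha> \<circ> rot_x \<beta>"
  by (auto simp: rot_e_def rot_x_def fun_eq_iff cos_add sin_add algebra_simps)

text \<open>Three shears when \<open>cos (\<theta> / 2)\<close> is nonzero; in the exceptional case
  the rotation by half the angle is covered and is applied twice.\<close>

lemma preserves_rot_e: "preserves lborel (rot_e \<theta>)"
proof -
  have *: "preserves lborel (rot_e \<theta>)" if "cos (\<theta> / 2) \<noteq> 0" for \<theta>
  proof -
    let ?a = "- tan (\<theta> / 2)" and ?b = "sin \<theta>"
    have 1: "preserves (lborel :: r3 measure) (\<lambda>(x, y). (x + ?a * fst y, y))"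
      by (rule preserves_shear_fst) (intro borel_measurable_continuous_onI continuous_intros)
    have 2: "preserves (lborel :: r3 measure) (\<lambda>(x, y). (x, (\<lambda>(y, e). (y + ?b * x, e)) y))"
    proof (rule preserves_skew)
      show "(\<lambda>(x, y). (\<lambda>(y, e). (y + ?b * x, e)) y) \<in> borel_measurable (borel :: r3 measure)"
        unfolding split_beta' by (intro borel_measurable_continuous_onI continuous_intros)
    qed (rule preserves_shear_fst, simp)
    have "rot_e \<theta> = (\<lambda>(x, y). (x + ?a * fst y, y)) \<circ> (\<lambda>(x, y). (x, (\<lambda>(y, e). (y + ?b * x, e)) y)) \<circ> (\<lambda>(x, y). (x + ?a * fst y, y))"
      using rotation_shears[OF that] by (auto simp: rot_e_def fun_eq_iff)
    then show ?thesis using preserves_comp[OF preserves_comp[OF 1 2] 1] by simp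
  qed
  show ?thesis
  proof (cases "cos (\<theta> / 2) = 0")
    case True
    then have "cos (\<theta> / 2 / 2) \<noteq> 0" using cos_half_nonzero[of \<theta>] by auto
    from preserves_comp[OF *[OF this] *[OF this]] show ?thesis by (simp flip: rot_add)
  qed (rule *)
qed

lemma preserves_rot_x: "preserves lborel (rot_x \<theta>)"
proof -
  have *: "preserves lborel (rot_x \<theta>)" if "cos (\<theta> / 2) \<noteq> 0" for \<theta>
  proof -
    let ?a = "- tan (\<theta> / 2)" and ?b = "sin \<theta>"
    have 1: "preserves (lborel :: r3 measure) (\<lambda>(x, p). (x, (\<lambda>(y, e). (y + ?a * e, e)) p))"
    proof (rule preserves_skew)
      show "(\<lambda>(x, p). (\<lambda>(y, e). (y + ?a * e, e)) p) \<in> borel_measurable (borel :: r3 measure)"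
        unfolding split_beta' by (intro borel_measurable_continuous_onI continuous_intros)
    qed (rule preserves_shear_fst, simp)
    have 2: "preserves (lborel :: r3 measure) (\<lambda>(x, p). (x, (\<lambda>(y, e). (y, e + ?b * y)) p))"
    proof (rule preserves_skew)
      show "(\<lambda>(x, p). (\<lambda>(y, e). (y, e + ?b * y)) p) \<in> borel_measurable (borel :: r3 measure)"
        unfolding split_beta' by (intro borel_measurable_continuous_onI continuous_intros)
    qed (rule preserves_shear_snd, simp)
    have "rot_x \<theta> = (\<lambda>(x, p). (x, (\<lambda>(y, e). (y + ?a * e, e)) p)) \<circ> (\<lambda>(x, p). (x, (\<lambda>(y, e). (y, e + ?b * y)) p)) \<circ> (\<lambda>(x, p). (x, (\<lambda>(y, e). (y + ?a * e, e)) p))"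
      using rotation_shears[OF that] by (auto simp: rot_x_def fun_eq_iff)
    then show ?thesis using preserves_comp[OF preserves_comp[OF 1 2] 1] by simp
  qed
  show ?thesis
  proof (cases "cos (\<theta> / 2) = 0")
    case True
    then have "cos (\<theta> / 2 / 2) \<noteq> 0" using cos_half_nonzero[of \<theta>] by auto
    from preserves_comp[OF *[OF this] *[OF this]] show ?thesis by (simp flip: rot_add)
  qed (rule *)
qed

section \<open>The sphere measure and its piecewise isometries\<close>

lemma norm_r3: "norm (x, y, e) = sqrt (x\<^sup>2 + y\<^sup>2 + e\<^sup>2)" for x y e :: real
  by (simp add: norm_Pair)

lemma norm_rot: "norm (rot_e \<theta> p) = norm p" "norm (rot_x \<theta> p) = norm p"
proof -
  have sc: "(sin \<theta>)\<^sup>2 = 1 - (cos \<theta>)\<^sup>2" by (simp add: sin_squared_eq)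
  obtain x y e where p: "p = (x, y, e)" by (cases p)
  have *: "(cos \<theta> * u - sin \<theta> * v)\<^sup>2 + (sin \<theta> * u + cos \<theta> * v)\<^sup>2 = u\<^sup>2 + v\<^sup>2" for u v :: real
  proof -
    have "(cos \<theta> * u - sin \<theta> * v)\<^sup>2 + (sin \<theta> * u + cos \<theta> * v)\<^sup>2 = ((sin \<theta>)\<^sup>2 + (cos \<theta>)\<^sup>2) * (u\<^sup>2 + v\<^sup>2)" by algebra
    then show ?thesis by simp
  qed
  show "norm (rot_e \<theta> p) = norm p" unfolding p rot_e_def split_conv norm_r3 by (simp add: *)
  show "norm (rot_x \<theta> p) = norm p" unfolding p rot_x_def split_conv norm_r3 by (simp add: * add.assoc)
qed

lemma rot_scaleR: "rot_e \<theta> (c *\<^sub>R p) = c *\<^sub>R rot_e \<theta> p" "rot_x \<theta> (c *\<^sub>R p) = c *\<^sub>R rot_x \<theta> p"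
  by (cases p; simp add: rot_e_def rot_x_def algebra_simps)+

lemma S2_eq_sphere: "S2 = sphere 0 1"
  by (auto simp: S2_def norm_r3)

text \<open>Volume of the cone over a set, that is, surface measure up to the factor 3, in the
  concrete type where Lebesgue measure is available.\<close>

definition cone_measure :: "r3 measure" where
  "cone_measure = distr (restrict_space lborel (cball 0 1 - {0})) (restrict_space borel S2) sgn"

lemma sgn_measurable: "sgn \<in> measurable (restrict_space lborel (cball (0::r3) 1 - {0})) (restrict_space borel S2)"
proof (rule measurable_restrict_space2)
  show "sgn \<in> space (restrict_space lborel (cball (0::r3) 1 - {0})) \<rightarrow> S2"
    by (auto simp: space_restrict_space S2_eq_sphere norm_sgn)
  have "continuous_on (cball (0::r3) 1 - {0}) (\<lambda>x. sgn x)"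
    unfolding sgn_div_norm by (intro continuous_intros) auto
  from borel_measurable_continuous_on_restrict[OF this]
  show "sgn \<in> borel_measurable (restrict_space lborel (cball (0::r3) 1 - {0}))" 
    by (simp add: measurable_def space_restrict_space sets_restrict_space)
qed

lemma space_cone_measure [simp]: "space cone_measure = S2"
  by (simp add: cone_measure_def space_restrict_space)

lemma sets_cone_measure [simp]: "sets cone_measure = sets (restrict_space borel S2)"
  by (simp add: cone_measure_def)

lemma closed_S2: "closed S2" by (simp add: S2_eq_sphere)

lemma S2_borel: "S2 \<in> sets borel" using closed_S2 by simp

lemma sets_restrict_S2: "A \<in> sets (restrict_space borel S2) \<longleftrightarrow> A \<subseteq> S2 \<and> A \<in> sets borel"
  using S2_borel by (auto simp: sets_restrict_space_iff)

lemma emeasure_cone_measure: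
  assumes "A \<in> sets borel" "A \<subseteq> S2"
  shows "emeasure cone_measure A = emeasure lborel {p \<in> cball 0 1 - {0}. sgn p \<in> A}"
proof -
  have "A \<in> sets (restrict_space borel S2)" using assms by (simp add: sets_restrict_S2)
  then have "emeasure cone_measure A = emeasure (restrict_space lborel (cball 0 1 - {0})) (sgn -` A \<inter> (cball 0 1 - {0}))"
    unfolding cone_measure_def by (subst emeasure_distr[OF sgn_measurable]) (auto simp: space_restrict_space)
  also have "\<dots> = emeasure lborel (sgn -` A \<inter> (cball 0 1 - {0}))"
    by (rule emeasure_restrict_space) auto
  finally show ?thesis by (simp add: vimage_def Int_def conj_commute)
qed

lemma finite_measure_cone: "finite_measure cone_measure"
proof (rule finite_measureI)
  have "emeasure cone_measure S2 \<le> emeasure lborel (cball 0 1 :: r3 set)"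
    unfolding emeasure_cone_measure[OF S2_borel order_refl] by (intro emeasure_mono) auto
  also have "\<dots> < \<infinity>" by (intro emeasure_bounded_finite) simp
  finally show "emeasure cone_measure (space cone_measure) \<noteq> \<infinity>" by simp
qed

text \<open>A homogeneous map that keeps norms commutes with \<open>sgn\<close>, so the cone over
  the preimage of a set is the preimage of its cone.\<close>

lemma cone_measure_linear_isometry:
  fixes R :: "r3 \<Rightarrow> r3"
  assumes R: "preserves lborel R" and n: "\<And>p. norm (R p) = norm p" and sc: "\<And>c p. R (c *\<^sub>R p) = c *\<^sub>R R p"
  shows "preserves cone_measure R"
  unfolding preserves_def
proof
  have Rm: "R \<in> borel_measurable borel" using R by (simp add: preserves_def)
  have RS: "R p \<in> S2 \<longleftrightarrow> p \<in> S2" for p using n by (simp add: S2_eq_sphere)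
  have "R \<in> measurable (restrict_space borel S2) (restrict_space borel S2)"
    by (rule measurable_restrict_space2) (use RS Rm in \<open>auto intro: measurable_restrict_space1 simp: space_restrict_space\<close>)
  moreover have "measurable (restrict_space borel S2) (restrict_space borel S2) = measurable cone_measure cone_measure"
    by (rule measurable_cong_sets) simp_all
  ultimately show m: "R \<in> measurable cone_measure cone_measure" by simp
  show "distr cone_measure cone_measure R = cone_measure"
  proof (rule measure_eqI)
    fix A assume "A \<in> sets (distr cone_measure cone_measure R)"
    then have A: "A \<in> sets borel" "A \<subseteq> S2" by (auto simp: sets_restrict_S2)
    have RA: "R -` A \<in> sets borel" "R -` A \<subseteq> S2"
      using measurable_sets[OF Rm A(1)] A(2) RS by (simp, blast)
    have sg: "sgn (R p) = R (sgn p)" for p by (simp add: sgn_div_norm n sc)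
    have n0: "R p = 0 \<longleftrightarrow> p = 0" for p using n by (metis norm_eq_zero)
    let ?C = "{p \<in> cball 0 1 - {0}. sgn p \<in> A}"
    have C: "?C \<in> sets borel"
    proof -
      have "sgn -` A \<inter> (cball 0 1 - {0}) \<in> sets (restrict_space lborel (cball (0::r3) 1 - {0}))"
        using measurable_sets[OF sgn_measurable, of A] A by (simp add: sets_restrict_S2 space_restrict_space)
      then have "sgn -` A \<inter> (cball 0 1 - {0}) \<in> sets borel" by (subst (asm) sets_restrict_space_iff) auto
      then show ?thesis by (simp add: vimage_def Int_def conj_commute)
    qed
    have "emeasure (distr cone_measure cone_measure R) A = emeasure cone_measure (R -` A \<inter> S2)"
      using emeasure_distr[OF m, of A] A by (simp add: sets_restrict_S2)
    also have "R -` A \<inter> S2 = R -` A" using RA by auto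
    also have "emeasure cone_measure (R -` A) = emeasure lborel {p \<in> cball 0 1 - {0}. sgn p \<in> R -` A}"
      by (rule emeasure_cone_measure[OF RA])
    also have "{p \<in> cball 0 1 - {0}. sgn p \<in> R -` A} = R -` ?C" by (auto simp: sg n n0)
    also have "emeasure lborel (R -` ?C) = emeasure lborel ?C"
      using preserves_emeasure[OF R, of ?C] C by simp
    also have "\<dots> = emeasure cone_measure A" by (rule emeasure_cone_measure[OF A, symmetric])
    finally show "emeasure (distr cone_measure cone_measure R) A = emeasure cone_measure A" .
  qed simp
qed

text \<open>Each \<open>R j\<close> respects the level sets of \<kappa>, so the preimage of
  \<open>A\<close> is the disjoint union over \<open>j\<close> of the \<open>R j\<close>-preimages
  of the part of \<open>A\<close> on level \<open>j\<close>. Countably many levels are essential for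
  adding up the measures; this is why the rotation angles are rounded below.\<close>

lemma preserves_piecewise:
  fixes \<kappa> :: "'a \<Rightarrow> int"
  assumes R: "\<And>j. preserves M (R j)" and \<kappa>: "\<kappa> \<in> measurable M (count_space UNIV)"
    and inv: "\<And>j p. p \<in> space M \<Longrightarrow> \<kappa> (R j p) = \<kappa> p"
  shows "preserves M (\<lambda>p. R (\<kappa> p) p)"
  unfolding preserves_def
proof
  have Rm: "R j \<in> measurable M M" for j using R by (simp add: preserves_def)
  show m: "(\<lambda>p. R (\<kappa> p) p) \<in> measurable M M"
    by (rule measurable_compose_countable[OF Rm \<kappa>])
  show "distr M M (\<lambda>p. R (\<kappa> p) p) = M"
  proof (rule measure_eqI)
    fix A assume "A \<in> sets (distr M M (\<lambda>p. R (\<kappa> p) p))"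
    then have A: "A \<in> sets M" by simp
    define B where "B = (\<lambda>j. \<kappa> -` {j} \<inter> space M)"
    have B: "B j \<in> sets M" for j unfolding B_def using measurable_sets[OF \<kappa>] by simp
    have RB: "R j -` (B j \<inter> A) \<inter> space M \<in> sets M" for j
      by (rule measurable_sets[OF Rm]) (use A B in auto)
    have "emeasure (distr M M (\<lambda>p. R (\<kappa> p) p)) A = emeasure M ((\<lambda>p. R (\<kappa> p) p) -` A \<inter> space M)"
      by (rule emeasure_distr[OF m A])
    also have "(\<lambda>p. R (\<kappa> p) p) -` A \<inter> space M = (\<Union>j. R j -` (B j \<inter> A) \<inter> space M)"
      using inv measurable_space[OF Rm] by (auto simp: B_def)
    also have "emeasure M \<dots> = (\<integral>\<^sup>+j. emeasure M (R j -` (B j \<inter> A) \<inter> space M) \<partial>count_space UNIV)"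
      by (rule emeasure_UN_countable) (use RB inv in \<open>auto simp: disjoint_family_on_def, auto simp: B_def\<close>)
    also have "\<dots> = (\<integral>\<^sup>+j. emeasure M (B j \<inter> A) \<partial>count_space UNIV)"
      by (intro nn_integral_cong preserves_emeasure[OF R] sets.Int B A)
    also have "\<dots> = emeasure M (\<Union>j. B j \<inter> A)"
      by (rule emeasure_UN_countable[symmetric]) (use B A in \<open>auto simp: disjoint_family_on_def B_def\<close>)
    also have "(\<Union>j. B j \<inter> A) = A" using sets.sets_into_space[OF A] by (auto simp: B_def)
    finally show "emeasure (distr M M (\<lambda>p. R (\<kappa> p) p)) A = emeasure M A" .
  qed simp
qed

text \<open>\<open>euler_step h\<close> follows the rotations generating the two summands of the vector field for time
  \<open>h\<close>, with angles rounded to multiples of \<open>h\<^sup>2\<close>. It is piecewise a rotation, hence preserves the measure, and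
  it differs from the flow by \<open>O(h\<^sup>2)\<close>.\<close>

definition quantize :: "real \<Rightarrow> real \<Rightarrow> real" where
  "quantize h v = h\<^sup>2 * of_int \<lfloor>v / h\<rfloor>"

lemma quantize_error:
  assumes "0 < h"
  shows "\<bar>quantize h v - h * v\<bar> \<le> h\<^sup>2"
proof -
  have "quantize h v - h * v = h\<^sup>2 * (of_int \<lfloor>v / h\<rfloor> - v / h)"
    using assms by (simp add: quantize_def field_simps power2_eq_square)
  moreover have "\<bar>of_int \<lfloor>v / h\<rfloor> - v / h\<bar> \<le> 1" by linarith
  ultimately show ?thesis using mult_left_le[of "\<bar>of_int \<lfloor>v / h\<rfloor> - v / h\<bar>" "h\<^sup>2"] by (simp add: abs_mult)
qed

text \<open>The field \<open>(- 2 e y, e x, x y)\<close> is the sum of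
  \<open>2 e (- y, x, 0)\<close> and \<open>x (0, - e, y)\<close>. Each summand rotates about a
  coordinate axis with a speed given by the coordinate along that axis, which the rotation leaves
  unchanged.\<close>

definition step_e :: "real \<Rightarrow> r3 \<Rightarrow> r3" where "step_e h p = rot_e (quantize h (2 * snd (snd p))) p"
definition step_x :: "real \<Rightarrow> r3 \<Rightarrow> r3" where "step_x h p = rot_x (quantize h (fst p)) p"

definition euler_step :: "real \<Rightarrow> r3 \<Rightarrow> r3" where "euler_step h = step_x h \<circ> step_e h"

lemma measurable_cone_measure: "f \<in> measurable borel N \<Longrightarrow> f \<in> measurable cone_measure N"
  unfolding measurable_cong_sets[OF sets_cone_measure refl] by (rule measurable_restrict_space1)

lemma preserves_step_e: "preserves cone_measure (step_e h)"
proof -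
  have "(\<lambda>p::r3. 2 * snd (snd p)) \<in> borel_measurable borel"
    by (intro borel_measurable_continuous_onI continuous_intros)
  then have "(\<lambda>p::r3. 2 * snd (snd p) / h) \<in> borel_measurable borel"
    by (rule borel_measurable_divide[OF _ borel_measurable_const])
  then have m: "(\<lambda>p::r3. \<lfloor>2 * snd (snd p) / h\<rfloor>) \<in> measurable cone_measure (count_space UNIV)"
    by (rule measurable_compose[OF measurable_cone_measure measurable_real_floor])
  have r: "preserves cone_measure (rot_e (h\<^sup>2 * of_int j))" for j
    by (rule cone_measure_linear_isometry) (simp_all add: preserves_rot_e norm_rot rot_scaleR)
  have i: "snd (snd (rot_e \<theta> p)) = snd (snd p)" for \<theta> p by (simp add: rot_e_def split_beta)
  show ?thesis
    unfolding step_e_def[abs_def] quantize_def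
    by (rule preserves_piecewise[OF r m]) (simp only: i)
qed

lemma preserves_step_x: "preserves cone_measure (step_x h)"
proof -
  have "(fst :: r3 \<Rightarrow> real) \<in> borel_measurable borel"
    by (intro borel_measurable_continuous_onI continuous_intros)
  then have "(\<lambda>p::r3. fst p / h) \<in> borel_measurable borel"
    by (rule borel_measurable_divide[OF _ borel_measurable_const])
  then have m: "(\<lambda>p::r3. \<lfloor>fst p / h\<rfloor>) \<in> measurable cone_measure (count_space UNIV)"
    by (rule measurable_compose[OF measurable_cone_measure measurable_real_floor])
  have r: "preserves cone_measure (rot_x (h\<^sup>2 * of_int j))" for j
    by (rule cone_measure_linear_isometry) (simp_all add: preserves_rot_x norm_rot rot_scaleR)
  have i: "fst (rot_x \<theta> p) = fst p" for \<theta> p by (simp add: rot_x_def split_beta)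
  show ?thesis
    unfolding step_x_def[abs_def] quantize_def
    by (rule preserves_piecewise[OF r m]) (simp only: i)
qed

lemma preserves_euler_step: "preserves cone_measure (euler_step h)"
  unfolding euler_step_def by (rule preserves_comp[OF preserves_step_x preserves_step_e])

section \<open>Comparison of the flow with the rotation steps\<close>

lemma sin_cos_first_order: "\<bar>sin a - a\<bar> \<le> a\<^sup>2" "\<bar>cos a - 1\<bar> \<le> a\<^sup>2" for a :: real
proof -
  have "\<bar>(\<lambda>t. sin t - t) a - (\<lambda>t. sin t - t) 0\<bar> \<le> \<bar>a\<bar> * \<bar>a\<bar>"
  proof (rule deriv_bound_imp)
    fix s assume s: "min 0 a \<le> s" "s \<le> max 0 a"
    show "((\<lambda>t. sin t - t) has_real_derivative cos s - 1) (at s)" by (auto intro!: derivative_eq_intros)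
    have "\<bar>cos s - cos 0\<bar> \<le> 1 * \<bar>s\<bar>"
      by (rule deriv_bound_imp[where f' = "\<lambda>s. - sin s"]) (auto intro!: derivative_eq_intros)
    then show "\<bar>cos s - 1\<bar> \<le> \<bar>a\<bar>" using s by auto
  qed
  then show "\<bar>sin a - a\<bar> \<le> a\<^sup>2" by (simp add: power2_eq_square)
  have "\<bar>cos a - cos 0\<bar> \<le> \<bar>a\<bar> * \<bar>a\<bar>"
  proof (rule deriv_bound_imp)
    fix s assume s: "min 0 a \<le> s" "s \<le> max 0 a"
    show "(cos has_real_derivative - sin s) (at s)" by (auto intro!: derivative_eq_intros)
    show "\<bar>- sin s\<bar> \<le> \<bar>a\<bar>" using abs_sin_x_le_abs_x[of s] s by auto
  qed
  then show "\<bar>cos a - 1\<bar> \<le> a\<^sup>2" by (simp add: power2_eq_square)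
qed

text \<open>The rounded angle is at most \<open>3 * h\<close>, so replacing cosine by 1 costs
  \<open>9 * h\<^sup>2\<close>, and replacing sine by \<open>h * w\<close> costs
  \<open>9 * h\<^sup>2\<close> plus the rounding error \<open>h\<^sup>2\<close>.\<close>

lemma rotation_first_order:
  fixes u v w h :: real
  assumes h: "0 < h" "h \<le> 1" and "\<bar>u\<bar> \<le> 1" "\<bar>v\<bar> \<le> 1" "\<bar>w\<bar> \<le> 2"
  defines "\<alpha> \<equiv> quantize h w"
  shows "\<bar>(cos \<alpha> * u - sin \<alpha> * v) - (u - h * w * v)\<bar> \<le> 19 * h\<^sup>2"
    "\<bar>(sin \<alpha> * u + cos \<alpha> * v) - (v + h * w * u)\<bar> \<le> 19 * h\<^sup>2"
proof -
  have q: "\<bar>\<alpha> - h * w\<bar> \<le> h\<^sup>2" unfolding \<alpha>_def by (rule quantize_error[OF h(1)])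
  have "h\<^sup>2 \<le> h" using h by (simp add: power2_eq_square mult_left_le)
  moreover have "\<bar>h * w\<bar> \<le> 2 * h" using h assms(5) by (simp add: abs_mult mult.commute)
  ultimately have "\<bar>\<alpha>\<bar> \<le> 3 * h" using q by linarith
  then have "\<bar>\<alpha>\<bar>\<^sup>2 \<le> (3 * h)\<^sup>2" by (intro power_mono) auto
  then have a2: "\<alpha>\<^sup>2 \<le> 9 * h\<^sup>2" by (simp add: power_mult_distrib)
  have s: "\<bar>sin \<alpha> - h * w\<bar> \<le> 10 * h\<^sup>2" using sin_cos_first_order(1)[of \<alpha>] a2 q by linarith
  have c: "\<bar>cos \<alpha> - 1\<bar> \<le> 9 * h\<^sup>2" using sin_cos_first_order(2)[of \<alpha>] a2 by linarith
  have m: "\<bar>p * r\<bar> \<le> B" if "\<bar>p\<bar> \<le> B" "\<bar>r\<bar> \<le> 1" for p r B :: real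
    using that mult_mono[of "\<bar>p\<bar>" B "\<bar>r\<bar>" 1] by (simp add: abs_mult)
  have "(cos \<alpha> * u - sin \<alpha> * v) - (u - h * w * v) = (cos \<alpha> - 1) * u - (sin \<alpha> - h * w) * v" by (simp add: algebra_simps)
  then show "\<bar>(cos \<alpha> * u - sin \<alpha> * v) - (u - h * w * v)\<bar> \<le> 19 * h\<^sup>2"
    using m[OF c assms(3)] m[OF s assms(4)] by linarith
  have "(sin \<alpha> * u + cos \<alpha> * v) - (v + h * w * u) = (cos \<alpha> - 1) * v + (sin \<alpha> - h * w) * u" by (simp add: algebra_simps)
  then show "\<bar>(sin \<alpha> * u + cos \<alpha> * v) - (v + h * w * u)\<bar> \<le> 19 * h\<^sup>2"
    using m[OF c assms(4)] m[OF s assms(3)] by linarith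
qed

text \<open>The first rotation moves \<open>x\<close> and \<open>y\<close> by at most
  \<open>21 * h\<close>. Replacing a moved coordinate by the original one in a product of the second
  rotation therefore costs \<open>21 * h\<^sup>2\<close>, of the same order as the errors of the
  rotations themselves.\<close>

lemma euler_step_first_order:
  assumes p: "(x, y, e) \<in> S2" and h: "0 < h" "h \<le> 1"
  shows "dist (euler_step h (x, y, e)) (x - h * (2 * e * y), y + h * (e * x), e + h * (x * y)) \<le> 200 * h\<^sup>2"
proof -
  obtain x' y' where xy': "step_e h (x, y, e) = (x', y', e)"
    by (simp add: step_e_def rot_e_def)
  have p': "(x', y', e) \<in> S2"
    using p norm_rot(1)[of "quantize h (2 * e)" "(x, y, e)"] xy' by (simp add: S2_eq_sphere step_e_def del: S2_iff)
  have b: "\<bar>x\<bar> \<le> 1" "\<bar>y\<bar> \<le> 1" "\<bar>e\<bar> \<le> 1" using sphere_abs_le[of x y e] p by auto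
  have b': "\<bar>x'\<bar> \<le> 1" "\<bar>y'\<bar> \<le> 1" using sphere_abs_le[of x' y' e] p' by auto
  have 1: "\<bar>x' - (x - h * (2 * e) * y)\<bar> \<le> 19 * h\<^sup>2" "\<bar>y' - (y + h * (2 * e) * x)\<bar> \<le> 19 * h\<^sup>2"
    using rotation_first_order[OF h b(1,2), of "2 * e"] b(3) xy' by (auto simp: step_e_def rot_e_def)
  obtain y'' e'' where st: "step_x h (x', y', e) = (x', y'', e'')"
    by (simp add: step_x_def rot_x_def)
  have 2: "\<bar>y'' - (y' - h * x' * e)\<bar> \<le> 19 * h\<^sup>2" "\<bar>e'' - (e + h * x' * y')\<bar> \<le> 19 * h\<^sup>2"
    using rotation_first_order[OF h b'(2) b(3), of "x'"] b'(1) st by (auto simp: step_x_def rot_x_def)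
  have m1: "\<bar>u * v\<bar> \<le> 1" if "\<bar>u\<bar> \<le> 1" "\<bar>v\<bar> \<le> 1" for u v :: real using that by (simp add: abs_mult mult_le_one)
  have mh: "\<bar>h * u\<bar> \<le> h" if "\<bar>u\<bar> \<le> 1" for u using that h by (simp add: abs_mult mult_left_le)
  have hh: "h\<^sup>2 \<le> h" using h by (simp add: power2_eq_square mult_left_le)
  have dx: "\<bar>x' - x\<bar> \<le> 21 * h"
  proof -
    have "\<bar>h * (2 * e) * y\<bar> \<le> 2 * h" using mh[OF m1[OF b(3) b(2)]] by (simp add: mult_ac)
    then show ?thesis using 1(1) hh by linarith
  qed
  have dy: "\<bar>y' - y\<bar> \<le> 21 * h"
  proof -
    have "\<bar>h * (2 * e) * x\<bar> \<le> 2 * h" using mh[OF m1[OF b(3) b(1)]] by (simp add: mult_ac)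
    then show ?thesis using 1(2) hh by linarith
  qed
  have hd: "\<bar>h * (d * u)\<bar> \<le> 21 * h\<^sup>2" if "\<bar>d\<bar> \<le> 21 * h" "\<bar>u\<bar> \<le> 1" for d u
  proof -
    have "\<bar>d * u\<bar> \<le> (21 * h) * 1" unfolding abs_mult using that h by (intro mult_mono) auto
    then have "h * \<bar>d * u\<bar> \<le> h * (21 * h)" using h by (intro mult_left_mono) auto
    then show ?thesis using h by (simp add: abs_mult power2_eq_square)
  qed
  have ey: "\<bar>y'' - (y + h * (e * x))\<bar> \<le> 60 * h\<^sup>2"
  proof -
    have "y'' - (y + h * (e * x)) = (y'' - (y' - h * x' * e)) + (y' - (y + h * (2 * e) * x)) - h * ((x' - x) * e)"
      by (simp add: algebra_simps)
    then show ?thesis using 2(1) 1(2) hd[OF dx b(3)] by linarith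
  qed
  have ee: "\<bar>e'' - (e + h * (x * y))\<bar> \<le> 62 * h\<^sup>2"
  proof -
    have "e'' - (e + h * (x * y)) = (e'' - (e + h * x' * y')) + h * ((x' - x) * y') + h * ((y' - y) * x)"
      by (simp add: algebra_simps)
    then show ?thesis using 2(2) hd[OF dx b'(2)] hd[OF dy b(1)] by linarith
  qed
  have ex: "\<bar>x' - (x - h * (2 * e * y))\<bar> \<le> 19 * h\<^sup>2" using 1(1) by (simp add: mult_ac)
  have tri: "dist (a, b, c) (a', b', c') \<le> \<bar>a - a'\<bar> + \<bar>b - b'\<bar> + \<bar>c - c'\<bar>" for a b c a' b' c' :: real
    unfolding dist_r3 by (rule real_le_lsqrt) (auto simp: power2_eq_square algebra_simps abs_mult_self_eq)
  have "euler_step h (x, y, e) = (x', y'', e'')" using xy' st by (simp add: euler_step_def)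
  then show ?thesis using tri[of x' y'' e'' "x - h * (2 * e * y)" "y + h * (e * x)" "e + h * (x * y)"] ex ey ee
    by simp
qed


lemma euler_flow_measurable: "euler_flow t \<in> measurable cone_measure cone_measure"
proof -
  have "euler_flow t \<in> measurable (restrict_space borel S2) (restrict_space borel S2)"
    by (rule measurable_restrict_space2)
       (auto simp: space_restrict_space euler_flow_in_S2 intro!: borel_measurable_continuous_on_restrict continuous_on_euler_flow)
  moreover have "measurable (restrict_space borel S2) (restrict_space borel S2) = measurable cone_measure cone_measure"
    by (rule measurable_cong_sets) simp_all
  ultimately show ?thesis by simp
qed

text \<open>Since \<open>euler_step h\<close> preserves the measure, precomposing with it leaves the
  integral at time \<open>t\<close> unchanged. This replaces it by an integrand that is pointwise
  within order h^2 of the one at time \<open>t + h\<close>, because both apply the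
  time-\<open>t\<close> flow to points at distance at most \<open>220 * h\<^sup>2\<close>.\<close>

lemma integral_euler_flow_increment:
  fixes f :: "r3 \<Rightarrow> real"
  assumes lip: "\<And>p q. \<bar>f p - f q\<bar> \<le> K * dist p q" and bd: "\<And>p. \<bar>f p\<bar> \<le> B" and K: "K \<ge> 0"
    and h: "0 < h" "h \<le> 1" and t: "0 \<le> t" "t \<le> T"
  shows "\<bar>(\<integral>p. f (euler_flow (t + h) p) \<partial>cone_measure) - (\<integral>p. f (euler_flow t p) \<partial>cone_measure)\<bar>
    \<le> K * exp (3 * T) * 220 * measure cone_measure S2 * h\<^sup>2"
proof -
  interpret finite_measure cone_measure by (rule finite_measure_cone)
  have "K-lipschitz_on UNIV f" using lip K by (auto simp: lipschitz_on_def dist_real_def)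
  then have fm: "f \<in> borel_measurable borel"
    by (intro borel_measurable_continuous_onI lipschitz_on_continuous_on)
  have fc: "f \<in> borel_measurable cone_measure" by (rule measurable_cone_measure[OF fm])
  have ef: "(\<lambda>p. f (euler_flow s p)) \<in> borel_measurable cone_measure" for s
    by (rule measurable_compose[OF euler_flow_measurable fc])
  have st: "euler_step h \<in> measurable cone_measure cone_measure" using preserves_euler_step by (simp add: preserves_def)
  let ?F = "\<lambda>p. f (euler_flow t p)"
  have i: "integrable cone_measure (\<lambda>p. f (euler_flow s p))" for s
    by (rule integrable_const_bound[of _ B]) (use bd ef in auto)
  have i2: "integrable cone_measure (\<lambda>p. ?F (euler_step h p))"
    by (rule integrable_const_bound[of _ B]) (use bd measurable_compose[OF st ef] in auto)
  have eq: "(\<integral>p. ?F (euler_step h p) \<partial>cone_measure) = (\<integral>p. ?F p \<partial>cone_measure)"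
    using integral_distr[OF st ef[of t]] preserves_euler_step[of h] by (simp add: preserves_def)
  have "(\<integral>p. f (euler_flow (t + h) p) \<partial>cone_measure) - (\<integral>p. ?F p \<partial>cone_measure)
    = (\<integral>p. f (euler_flow (t + h) p) - ?F (euler_step h p) \<partial>cone_measure)"
    using eq i i2 by (subst Bochner_Integration.integral_diff) auto
  also have "\<bar>\<dots>\<bar> \<le> (\<integral>p. \<bar>f (euler_flow (t + h) p) - ?F (euler_step h p)\<bar> \<partial>cone_measure)"
    by (rule integral_abs_bound)
  also have "\<dots> \<le> (\<integral>p. K * (exp (3 * T) * (220 * h\<^sup>2)) \<partial>cone_measure)"
  proof (rule integral_mono)
    show "integrable cone_measure (\<lambda>p. \<bar>f (euler_flow (t + h) p) - ?F (euler_step h p)\<bar>)"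
      using i i2 by (intro integrable_abs Bochner_Integration.integrable_diff) auto
    fix p assume "p \<in> space cone_measure"
    then have p: "p \<in> S2" by simp
    obtain x y e where xye: "p = (x, y, e)" by (cases p)
    have sp: "euler_step h p \<in> S2" using measurable_space[OF st, of p] p by simp
    have "dist (euler_flow h p) (euler_step h p) \<le> 20 * h\<^sup>2 + 200 * h\<^sup>2"
      using euler_flow_first_order[of x y e h] euler_step_first_order[of x y e h] p h unfolding xye
      by (intro order_trans[OF dist_triangle2 add_mono]) auto
    then have d: "dist (euler_flow h p) (euler_step h p) \<le> 220 * h\<^sup>2" by simp
    have "euler_flow (t + h) p = euler_flow t (euler_flow h p)" using euler_flow_add[OF p, of h t] by (simp add: add.commute)
    then have "\<bar>f (euler_flow (t + h) p) - ?F (euler_step h p)\<bar> \<le> K * dist (euler_flow t (euler_flow h p)) (euler_flow t (euler_step h p))"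
      using lip by simp
    also have "\<dots> \<le> K * (exp (3 * \<bar>t\<bar>) * dist (euler_flow h p) (euler_step h p))"
      by (intro mult_left_mono dist_euler_flow euler_flow_in_S2 p sp K)
    also have "\<dots> \<le> K * (exp (3 * T) * (220 * h\<^sup>2))"
      using K t d by (intro mult_left_mono mult_mono) auto
    finally show "\<bar>f (euler_flow (t + h) p) - ?F (euler_step h p)\<bar> \<le> K * (exp (3 * T) * (220 * h\<^sup>2))" .
  qed auto
  finally show ?thesis by (simp add: mult_ac)
qed

text \<open>With \<open>n\<close> steps of length \<open>T / n\<close> the errors of second order
  add up to a multiple of \<open>T\<^sup>2 / n\<close>, which tends to 0.\<close>

lemma integral_euler_flow_pos:
  fixes f :: "r3 \<Rightarrow> real"
  assumes lip: "\<And>p q. \<bar>f p - f q\<bar> \<le> K * dist p q" and bd: "\<And>p. \<bar>f p\<bar> \<le> B" and K: "K \<ge> 0" and T: "T > 0"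
  shows "(\<integral>p. f (euler_flow T p) \<partial>cone_measure) = (\<integral>p. f p \<partial>cone_measure)"
proof -
  define g where "g = (\<lambda>t. \<integral>p. f (euler_flow t p) \<partial>cone_measure)"
  define C where "C = K * exp (3 * T) * 220 * measure cone_measure S2"
  have C: "C \<ge> 0" using K by (simp add: C_def)
  have bound: "\<bar>g T - g 0\<bar> \<le> C * T\<^sup>2 / real n" if n: "real n \<ge> T" "n > 0" for n
  proof -
    define h where "h = T / real n"
    have h: "0 < h" "h \<le> 1" using T n by (auto simp: h_def)
    have "\<bar>g (real k * h) - g 0\<bar> \<le> real k * (C * h\<^sup>2)" if "k \<le> n" for k
      using that
    proof (induction k)
      case (Suc k)
      have "real k * h \<le> real n * h" using Suc.prems h by (intro mult_right_mono) auto
      also have "\<dots> = T" using n by (simp add: h_def)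
      finally have "\<bar>g (real k * h + h) - g (real k * h)\<bar> \<le> C * h\<^sup>2"
        unfolding g_def C_def using h by (intro integral_euler_flow_increment[OF lip bd K]) auto
      moreover have "\<bar>g (real k * h) - g 0\<bar> \<le> real k * (C * h\<^sup>2)" using Suc by simp
      ultimately show ?case by (simp add: algebra_simps)
    qed simp
    from this[of n] have "\<bar>g T - g 0\<bar> \<le> real n * (C * h\<^sup>2)" using n by (simp add: h_def)
    also have "\<dots> = C * T\<^sup>2 / real n" using n by (simp add: h_def power2_eq_square)
    finally show ?thesis .
  qed
  have "(\<lambda>n. C * T\<^sup>2 / real n) \<longlonglongrightarrow> 0" by (rule lim_const_over_n)
  moreover have "\<forall>\<^sub>F n in sequentially. \<bar>g T - g 0\<bar> \<le> C * T\<^sup>2 / real n"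
    using eventually_ge_at_top[of "nat \<lceil>T\<rceil> + 1"] by eventually_elim (rule bound; linarith)
  ultimately have "\<bar>g T - g 0\<bar> \<le> 0" by (rule tendsto_lowerbound) simp
  moreover have "g 0 = (\<integral>p. f p \<partial>cone_measure)"
    unfolding g_def by (rule Bochner_Integration.integral_cong) auto
  ultimately show ?thesis by (simp add: g_def)
qed

text \<open>Closed sets generate the Borel sets and are stable under intersection, and the indicator
  of a closed set is the bounded limit of the Lipschitz functions \<open>max 0 (1 - k * d)\<close>,
  with \<open>d\<close> the distance to the set.\<close>

lemma finite_borel_measure_eqI:
  fixes M N :: "'a::metric_space measure"
  assumes sets: "sets M = sets borel" "sets N = sets borel" and fin: "finite_measure M" "finite_measure N"
    and eq: "\<And>f K. (\<And>p q. \<bar>f p - f q\<bar> \<le> K * dist p q) \<Longrightarrow> K \<ge> 0 \<Longrightarrow> (\<And>p. 0 \<le> f p \<and> f p \<le> 1) \<Longrightarrow> (\<integral>p. f p \<partial>M) = (\<integral>p. f p \<partial>N)"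
  shows "M = N"
proof (rule measure_eqI_generator_eq[where E = "Collect closed" and \<Omega> = UNIV and A = "\<lambda>_. UNIV"])
  show "Int_stable (Collect (closed :: 'a set \<Rightarrow> bool))" by (auto simp: Int_stable_def)
  show "sets M = sigma_sets UNIV (Collect closed)" "sets N = sigma_sets UNIV (Collect closed)"
    using sets by (simp_all add: borel_eq_closed)
  show "emeasure M UNIV \<noteq> \<infinity>" using finite_measure.emeasure_finite[OF fin(1)] by simp
  fix C :: "'a set" assume "C \<in> Collect closed"
  then have C: "closed C" by simp
  define f where "f = (\<lambda>k p. max 0 (1 - real k * setdist {p} C))"
  have lim: "(\<lambda>k. \<integral>p. f k p \<partial>L) \<longlonglongrightarrow> measure L C" if L: "sets L = sets borel" "finite_measure L" and ne: "C \<noteq> {}" for L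
  proof -
    interpret finite_measure L by fact
    have Cs: "C \<in> sets L" using C L by simp
    have "(\<lambda>k. \<integral>p. f k p \<partial>L) \<longlonglongrightarrow> (\<integral>p. indicator C p \<partial>L)"
    proof (rule integral_dominated_convergence[where w = "\<lambda>_. 1"])
      have "continuous_on UNIV (f k)" for k unfolding f_def by (intro continuous_intros continuous_on_setdist)
      then have "f k \<in> borel_measurable borel" for k by (rule borel_measurable_continuous_onI)
      then show "f k \<in> borel_measurable L" for k using L measurable_cong_sets[of L borel] by auto
      show "AE x in L. norm (f i x) \<le> 1" for i by (auto simp: f_def setdist_pos_le)
      have "(\<lambda>i. f i x) \<longlonglongrightarrow> indicator C x" for x
      proof (cases "x \<in> C")
        case True
        then have "setdist {x} C = 0" by (simp add: setdist_sing_in_set)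
        then show ?thesis using True by (simp add: f_def)
      next
        case False
        have "setdist {x} C \<noteq> 0" using setdist_eq_0_closed[OF C, of x] False ne by simp
        then have d: "setdist {x} C > 0" using setdist_pos_le[of "{x}" C] by linarith
        have "\<forall>\<^sub>F i in sequentially. f i x = 0"
          using eventually_ge_at_top[of "nat \<lceil>1 / setdist {x} C\<rceil>"]
        proof eventually_elim
          case (elim i)
          then have "1 / setdist {x} C \<le> real i" by linarith
          then have "1 \<le> real i * setdist {x} C" using d by (simp add: field_simps)
          then show ?case by (simp add: f_def)
        qed
        then show ?thesis using False by (simp add: tendsto_eventually)
      qed
      then show "AE x in L. (\<lambda>i. f i x) \<longlonglongrightarrow> indicator C x" by simp
    qed (use Cs in auto)
    then show ?thesis using Cs by simp
  qed
  have "measure M C = measure N C"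
  \<comment> \<open>The empty set is treated apart because \<open>setdist\<close> to it is
    \<open>0\<close>, which would make the approximating functions constantly
    \<open>1\<close>.\<close>
  proof (cases "C = {}")
    case False
    have "(\<integral>p. f k p \<partial>M) = (\<integral>p. f k p \<partial>N)" for k
    proof (rule eq)
      show "\<bar>f k p - f k q\<bar> \<le> real k * dist p q" for p q
      proof -
        have "\<bar>setdist {p} C - setdist {q} C\<bar> \<le> dist p q" by (rule setdist_Lipschitz)
        then have "real k * \<bar>setdist {p} C - setdist {q} C\<bar> \<le> real k * dist p q" by (intro mult_left_mono) auto
        moreover have "real k * \<bar>setdist {p} C - setdist {q} C\<bar> = \<bar>real k * setdist {p} C - real k * setdist {q} C\<bar>"
          by (simp add: abs_mult flip: right_diff_distrib)
        ultimately show ?thesis by (auto simp: f_def)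
      qed
    qed (auto simp: f_def setdist_pos_le)
    then show ?thesis using lim[OF sets(1) fin(1) False] lim[OF sets(2) fin(2) False] LIMSEQ_unique by simp
  qed simp
  then show "emeasure M C = emeasure N C"
    using finite_measure.emeasure_eq_measure[OF fin(1)] finite_measure.emeasure_eq_measure[OF fin(2)] by simp
qed auto

text \<open>Integrals of Lipschitz functions settle positive times. At a negative time the flow is
  the inverse of a map already known to preserve the measure.\<close>

lemma preserves_euler_flow: "preserves cone_measure (euler_flow t)"
proof -
  interpret finite_measure cone_measure by (rule finite_measure_cone)
  have id: "(\<lambda>p. p) \<in> measurable cone_measure borel" by (rule measurable_cone_measure) simp
  have pos: "distr cone_measure cone_measure (euler_flow t) = cone_measure" if t: "t > 0" for t
  proof -
    have fm: "euler_flow t \<in> measurable cone_measure borel"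
      using measurable_comp[OF euler_flow_measurable id] by (simp add: comp_def)
    have "distr cone_measure borel (euler_flow t) = distr cone_measure borel (\<lambda>p. p)"
    proof (rule finite_borel_measure_eqI)
      fix f :: "r3 \<Rightarrow> real" and K
      assume f: "\<And>p q. \<bar>f p - f q\<bar> \<le> K * dist p q" "K \<ge> 0" "\<And>p. 0 \<le> f p \<and> f p \<le> 1"
      have "K-lipschitz_on UNIV f" using f by (auto simp: lipschitz_on_def dist_real_def)
      then have m: "f \<in> borel_measurable borel"
        by (intro borel_measurable_continuous_onI lipschitz_on_continuous_on)
      have "\<bar>f p\<bar> \<le> 1" for p using f(3)[of p] by simp
      from integral_euler_flow_pos[OF f(1) this f(2) t]
      show "(\<integral>p. f p \<partial>distr cone_measure borel (euler_flow t)) = (\<integral>p. f p \<partial>distr cone_measure borel (\<lambda>p. p))"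
        by (simp add: integral_distr[OF fm m] integral_distr[OF id m])
    qed (auto intro: finite_measure_distr fm id)
    then have eq: "emeasure (distr cone_measure borel (euler_flow t)) A = emeasure (distr cone_measure borel (\<lambda>p. p)) A" for A by simp
    show ?thesis
    proof (rule measure_eqI)
      fix A assume "A \<in> sets (distr cone_measure cone_measure (euler_flow t))"
      then have A: "A \<in> sets borel" "A \<subseteq> S2" by (auto simp: sets_restrict_S2)
      then show "emeasure (distr cone_measure cone_measure (euler_flow t)) A = emeasure cone_measure A"
        using eq[of A] by (simp add: emeasure_distr fm id euler_flow_measurable sets_restrict_S2 Int_absorb2)
    qed simp
  qed
  have inv: "distr cone_measure cone_measure (euler_flow t) = cone_measure" if "distr cone_measure cone_measure (euler_flow (- t)) = cone_measure" for t
  proof -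
    have "distr cone_measure cone_measure (euler_flow t) = distr (distr cone_measure cone_measure (euler_flow (- t))) cone_measure (euler_flow t)"
      using that by simp
    also have "\<dots> = distr cone_measure cone_measure (euler_flow t \<circ> euler_flow (- t))"
      by (rule distr_distr) (rule euler_flow_measurable)+
    also have "\<dots> = distr cone_measure cone_measure (\<lambda>p. p)"
      using euler_flow_add[of _ "- t" t] by (intro distr_cong) auto
    finally show ?thesis by (simp add: distr_id2)
  qed
  have "distr cone_measure cone_measure (euler_flow 0) = distr cone_measure cone_measure (\<lambda>p. p)"
    by (intro distr_cong) auto
  then have zero: "distr cone_measure cone_measure (euler_flow 0) = cone_measure" by (simp add: distr_id2)
  have "distr cone_measure cone_measure (euler_flow t) = cone_measure"
    using pos[of t] inv[OF pos[of "-t"]] zero by (cases t "0::real" rule: linorder_cases) auto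
  then show ?thesis by (simp add: preserves_def euler_flow_measurable)
qed

section \<open>The solvable group and its lattice\<close>

definition t1 :: real where "t1 = (1 - sqrt 5) / 2"
definition t2 :: real where "t2 = (1 + sqrt 5) / 2"

lemma t_square: "t1 * t1 = t1 + 1" "t2 * t2 = t2 + 1"
  by (simp_all add: t1_def t2_def field_simps)

lemma t_diff: "t2 - t1 = sqrt 5" by (simp add: t1_def t2_def field_simps)

lemma t_plus1_pos: "t1 + 1 > 0" "t2 + 1 > 0"
proof -
  have "sqrt 5 < 3" by (rule real_less_lsqrt) simp_all
  moreover have "2 * t1 = 1 - sqrt 5" "2 * t2 = 1 + sqrt 5" "0 \<le> sqrt 5" by (simp_all add: t1_def t2_def field_simps)
  ultimately show "t1 + 1 > 0" "t2 + 1 > 0" by - linarith+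
qed

text \<open>For both roots \<open>t + 1 = t\<^sup>2\<close>, so \<open>exp l1\<close> and
  \<open>exp l2\<close> are the conjugates of the unit of the lattice, with
  \<open>l1 < 0 < l2\<close>. The first coordinate becomes the expanding one when a point is brought
  back to the fundamental domain, which applies the power \<open>- \<lfloor>u\<rfloor>\<close> of
  the monodromy.\<close>

definition l1 :: real where "l1 = ln (t1 + 1)"
definition l2 :: real where "l2 = ln (t2 + 1)"

lemma exp_l: "exp l1 = t1 + 1" "exp l2 = t2 + 1"
  using t_plus1_pos by (simp_all add: l1_def l2_def)

lemma exp_neg_l: "exp (- l1) = 2 - t1" "exp (- l2) = 2 - t2"
proof -
  have "(t1 + 1) * (2 - t1) = 1" "(t2 + 1) * (2 - t2) = 1" using t_square by (simp_all add: algebra_simps)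
  then show "exp (- l1) = 2 - t1" "exp (- l2) = 2 - t2"
    unfolding exp_minus exp_l by (intro inverse_unique; simp)+
qed

text \<open>The unit has norm 1. This is tr L = 0, the source of the left invariance of Lebesgue
  measure.\<close>

lemma l_sum: "l1 + l2 = 0"
proof -
  have "exp (l1 + l2) = 1" unfolding exp_add exp_l by (simp add: t1_def t2_def field_simps)
  then show ?thesis by simp
qed

text \<open>The group law of \<open>LieG\<close> in the coordinates
  \<open>(w\<^sub>1, w\<^sub>2, u)\<close>; the analysis is done in this type and transported by
  \<open>Jm\<close>.\<close>

definition mul :: "r3 \<Rightarrow> r3 \<Rightarrow> r3" where
  "mul = (\<lambda>(a, b, u) (a', b', u'). (a + exp (u * l1) * a', b + exp (u * l2) * b', u + u'))"

definition ivs :: "r3 \<Rightarrow> r3" where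
  "ivs = (\<lambda>(a, b, u). (- exp (- u * l1) * a, - exp (- u * l2) * b, - u))"

lemma mul_simp: "mul (a, b, u) (a', b', u') = (a + exp (u * l1) * a', b + exp (u * l2) * b', u + u')"
  by (simp add: mul_def)

lemma mul_assoc: "mul (mul p q) r = mul p (mul q r)"
  by (cases p; cases q; cases r) (simp add: mul_simp algebra_simps exp_add)

lemma mul_one [simp]: "mul (0, 0, 0) p = p" "mul p (0, 0, 0) = p"
  by (cases p; simp add: mul_simp)+

lemma mul_ivs [simp]: "mul (ivs p) p = (0, 0, 0)" "mul p (ivs p) = (0, 0, 0)"
  by (cases p; simp add: mul_simp ivs_def mult.assoc[symmetric] exp_add[symmetric])+

lemma mul_ivs_cancel [simp]: "mul (ivs p) (mul p q) = q" "mul p (mul (ivs p) q) = q"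
  by (simp_all flip: mul_assoc)

lemma mul_ivs_cancel_right [simp]: "mul (mul q p) (ivs p) = q" "mul (mul q (ivs p)) p = q"
  by (simp_all add: mul_assoc)

definition Gam3 :: "r3 set" where
  "Gam3 = {(of_int m + of_int n * t1, of_int m + of_int n * t2, of_int k) | m n k :: int. True}"

text \<open>Coordinates of \<open>(a, b)\<close> in the lattice basis \<open>(1, 1)\<close>,
  \<open>(t1, t2)\<close>; the divisor is \<open>t2 - t1\<close>.\<close>

definition coord_n :: "real \<Rightarrow> real \<Rightarrow> real" where "coord_n a b = (b - a) / sqrt 5"
definition coord_m :: "real \<Rightarrow> real \<Rightarrow> real" where "coord_m a b = a - t1 * coord_n a b"

lemma coord_inverse: "a = coord_m a b + coord_n a b * t1" "b = coord_m a b + coord_n a b * t2"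
proof -
  show "a = coord_m a b + coord_n a b * t1" by (simp add: coord_m_def)
  have "coord_n a b * (t2 - t1) = b - a" unfolding t_diff by (simp add: coord_n_def)
  then show "b = coord_m a b + coord_n a b * t2" by (simp add: coord_m_def algebra_simps)
qed

lemma coord_lattice [simp]: "coord_n (x + y * t1) (x + y * t2) = y" "coord_m (x + y * t1) (x + y * t2) = x"
proof -
  have "y * t2 - y * t1 = y * sqrt 5" unfolding t_diff[symmetric] by (simp add: algebra_simps)
  then show "coord_n (x + y * t1) (x + y * t2) = y" by (simp add: coord_n_def)
  then show "coord_m (x + y * t1) (x + y * t2) = x" by (simp add: coord_m_def algebra_simps)
qed

lemma coord_add: "coord_n (a + a') (b + b') = coord_n a b + coord_n a' b'" "coord_m (a + a') (b + b') = coord_m a b + coord_m a' b'"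
  by (simp_all add: coord_n_def coord_m_def add_divide_distrib diff_divide_distrib algebra_simps)

lemma Gam3_iff: "(a, b, u) \<in> Gam3 \<longleftrightarrow> coord_m a b \<in> \<int> \<and> coord_n a b \<in> \<int> \<and> u \<in> \<int>"
proof
  assume "(a, b, u) \<in> Gam3"
  then show "coord_m a b \<in> \<int> \<and> coord_n a b \<in> \<int> \<and> u \<in> \<int>" by (auto simp: Gam3_def)
next
  assume "coord_m a b \<in> \<int> \<and> coord_n a b \<in> \<int> \<and> u \<in> \<int>"
  then obtain m n k where *: "coord_m a b = of_int m" "coord_n a b = of_int n" "u = of_int k" by (auto simp: Ints_def)
  have "(a, b, u) = (of_int m + of_int n * t1, of_int m + of_int n * t2, of_int k)"
    using coord_inverse[where a = a and b = b] unfolding * by simp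
  then show "(a, b, u) \<in> Gam3" unfolding Gam3_def by blast
qed

text \<open>In the basis \<open>1\<close>, \<open>t\<close> multiplication by \<open>t + 1\<close>
  sends \<open>(m, n)\<close> to \<open>(m + n, m + 2 n)\<close>, and its inverse sends
  \<open>(m, n)\<close> to \<open>(2 m - n, n - m)\<close>. Both are integral, so all integer powers
  act on the lattice, with the same integers for the two conjugates.\<close>

lemma Gam3_exp_nat:
  fixes m n :: int and k :: nat
  shows "\<exists>m' n' :: int. exp (real k * l1) * (of_int m + of_int n * t1) = of_int m' + of_int n' * t1
     \<and> exp (real k * l2) * (of_int m + of_int n * t2) = of_int m' + of_int n' * t2"
    "\<exists>m' n' :: int. exp (- real k * l1) * (of_int m + of_int n * t1) = of_int m' + of_int n' * t1
     \<and> exp (- real k * l2) * (of_int m + of_int n * t2) = of_int m' + of_int n' * t2"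
proof -
  have up: "exp l1 * (of_int m + of_int n * t1) = of_int (m + n) + of_int (m + 2 * n) * t1"
    "exp l2 * (of_int m + of_int n * t2) = of_int (m + n) + of_int (m + 2 * n) * t2" for m n :: int
  proof -
    have "exp l1 * (of_int m + of_int n * t1) = of_int m + of_int m * t1 + of_int n * t1 + of_int n * (t1 * t1)"
      unfolding exp_l by (simp add: algebra_simps)
    then show "exp l1 * (of_int m + of_int n * t1) = of_int (m + n) + of_int (m + 2 * n) * t1"
      unfolding t_square by (simp add: algebra_simps)
    have "exp l2 * (of_int m + of_int n * t2) = of_int m + of_int m * t2 + of_int n * t2 + of_int n * (t2 * t2)"
      unfolding exp_l by (simp add: algebra_simps)
    then show "exp l2 * (of_int m + of_int n * t2) = of_int (m + n) + of_int (m + 2 * n) * t2"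
      unfolding t_square by (simp add: algebra_simps)
  qed
  have dn: "exp (- l1) * (of_int m + of_int n * t1) = of_int (2 * m - n) + of_int (n - m) * t1"
    "exp (- l2) * (of_int m + of_int n * t2) = of_int (2 * m - n) + of_int (n - m) * t2" for m n :: int
  proof -
    have "exp (- l1) * (of_int m + of_int n * t1) = 2 * of_int m + 2 * of_int n * t1 - of_int m * t1 - of_int n * (t1 * t1)"
      unfolding exp_neg_l by (simp add: algebra_simps)
    then show "exp (- l1) * (of_int m + of_int n * t1) = of_int (2 * m - n) + of_int (n - m) * t1"
      unfolding t_square by (simp add: algebra_simps)
    have "exp (- l2) * (of_int m + of_int n * t2) = 2 * of_int m + 2 * of_int n * t2 - of_int m * t2 - of_int n * (t2 * t2)"
      unfolding exp_neg_l by (simp add: algebra_simps)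
    then show "exp (- l2) * (of_int m + of_int n * t2) = of_int (2 * m - n) + of_int (n - m) * t2"
      unfolding t_square by (simp add: algebra_simps)
  qed
  show "\<exists>m' n' :: int. exp (real k * l1) * (of_int m + of_int n * t1) = of_int m' + of_int n' * t1
     \<and> exp (real k * l2) * (of_int m + of_int n * t2) = of_int m' + of_int n' * t2"
  proof (induction k)
    case (Suc k)
    then obtain m' n' :: int where IH: "exp (real k * l1) * (of_int m + of_int n * t1) = of_int m' + of_int n' * t1"
     "exp (real k * l2) * (of_int m + of_int n * t2) = of_int m' + of_int n' * t2" by blast
    have e: "exp (real (Suc k) * l) * c = exp l * (exp (real k * l) * c)" for l c by (simp add: ring_distribs exp_add)
    show ?case unfolding e IH up by blast
  qed (rule exI[of _ m], rule exI[of _ n], simp)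
  show "\<exists>m' n' :: int. exp (- real k * l1) * (of_int m + of_int n * t1) = of_int m' + of_int n' * t1
     \<and> exp (- real k * l2) * (of_int m + of_int n * t2) = of_int m' + of_int n' * t2"
  proof (induction k)
    case (Suc k)
    then obtain m' n' :: int where IH: "exp (- real k * l1) * (of_int m + of_int n * t1) = of_int m' + of_int n' * t1"
     "exp (- real k * l2) * (of_int m + of_int n * t2) = of_int m' + of_int n' * t2" by blast
    have e: "exp (- real (Suc k) * l) * c = exp (- l) * (exp (- real k * l) * c)" for l c
      by (simp add: mult.assoc[symmetric] exp_add[symmetric]) (simp add: algebra_simps)
    show ?case unfolding e IH dn by blast
  qed (rule exI[of _ m], rule exI[of _ n], simp)
qed

lemma Gam3_exp:
  fixes m n k :: int
  obtains m' n' :: int where "exp (of_int k * l1) * (of_int m + of_int n * t1) = of_int m' + of_int n' * t1"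
    "exp (of_int k * l2) * (of_int m + of_int n * t2) = of_int m' + of_int n' * t2"
proof (cases "k \<ge> 0")
  case True
  then obtain j where "k = int j" by (metis nonneg_int_cases)
  then show ?thesis using Gam3_exp_nat(1)[where k = j and m = m and n = n] that by auto
next
  case False
  then obtain j where "k = - int j" by (metis int_cases4 linorder_not_le nat_int_comparison(2) zle_int neg_int_cases order_less_imp_le)
  then show ?thesis using Gam3_exp_nat(2)[where k = j and m = m and n = n] that by auto
qed

lemma Gam3_one: "(0, 0, 0) \<in> Gam3"
  by (auto simp: Gam3_iff coord_m_def coord_n_def)

lemma Gam3_mul: assumes "p \<in> Gam3" "q \<in> Gam3" shows "mul p q \<in> Gam3"
proof -
  obtain m n k :: int where p: "p = (of_int m + of_int n * t1, of_int m + of_int n * t2, of_int k)" using assms by (auto simp: Gam3_def)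
  obtain m' n' k' :: int where q: "q = (of_int m' + of_int n' * t1, of_int m' + of_int n' * t2, of_int k')" using assms by (auto simp: Gam3_def)
  obtain m'' n'' :: int where "exp (of_int k * l1) * (of_int m' + of_int n' * t1) = of_int m'' + of_int n'' * t1"
    "exp (of_int k * l2) * (of_int m' + of_int n' * t2) = of_int m'' + of_int n'' * t2" by (rule Gam3_exp)
  then have "mul p q = (of_int (m + m'') + of_int (n + n'') * t1, of_int (m + m'') + of_int (n + n'') * t2, of_int (k + k'))"
    unfolding p q mul_simp by (simp add: algebra_simps)
  then show ?thesis unfolding Gam3_def by blast
qed

lemma Gam3_ivs: assumes "p \<in> Gam3" shows "ivs p \<in> Gam3"
proof -
  obtain m n k :: int where p: "p = (of_int m + of_int n * t1, of_int m + of_int n * t2, of_int k)" using assms by (auto simp: Gam3_def)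
  obtain m'' n'' :: int where *: "exp (of_int (-k) * l1) * (of_int (-m) + of_int (-n) * t1) = of_int m'' + of_int n'' * t1"
    "exp (of_int (-k) * l2) * (of_int (-m) + of_int (-n) * t2) = of_int m'' + of_int n'' * t2" by (rule Gam3_exp)
  have "ivs p = (exp (of_int (-k) * l1) * (of_int (-m) + of_int (-n) * t1), exp (of_int (-k) * l2) * (of_int (-m) + of_int (-n) * t2), of_int (-k))"
    unfolding p ivs_def by (simp add: algebra_simps)
  then show ?thesis unfolding * by (simp add: Gam3_iff)
qed

section \<open>Identification of the abstract spaces with three-dimensional space\<close>

definition vec2 :: "real \<Rightarrow> real \<Rightarrow> rvec" where "vec2 a b = (\<lambda>i\<in>{..<2}. if i = 0 then a else b)"

text \<open>The same map serves for group elements \<open>(w, u)\<close> and for Lie algebra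
  elements \<open>(\<xi>, \<eta>)\<close>.\<close>

definition Jm :: "r3 \<Rightarrow> rvec \<times> real" where "Jm = (\<lambda>(a, b, u). (vec2 a b, u))"

definition Jinv :: "rvec \<times> real \<Rightarrow> r3" where "Jinv = (\<lambda>(v, u). (v 0, v 1, u))"

lemma less2: "i < (2::nat) \<longleftrightarrow> i = 0 \<or> i = 1" by auto

lemma sum_less2: "(\<Sum>i<2. f i) = f 0 + f (1::nat)" by (simp add: numeral_2_eq_2)

lemma vec2_simps [simp]: "vec2 a b 0 = a" "vec2 a b 1 = b" "vec2 a b (Suc 0) = b" by (simp_all add: vec2_def)

lemma vec2_PiE [simp]: "vec2 a b \<in> {..<2} \<rightarrow>\<^sub>E UNIV" by (simp add: vec2_def)

lemma vec2_Rn [simp]: "vec2 a b \<in> Rn 2" by (simp add: vec2_def Rn_def)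

lemma Rn2_eqI: "v \<in> Rn 2 \<Longrightarrow> w \<in> Rn 2 \<Longrightarrow> v 0 = w 0 \<Longrightarrow> v 1 = w 1 \<Longrightarrow> v = w"
  by (rule ext) (metis PiE_E Rn_def less2 lessThan_iff)

lemma Rn2_vec2: "v \<in> Rn 2 \<Longrightarrow> v = vec2 (v 0) (v 1)" by (rule Rn2_eqI) simp_all

lemma vec2_eq_iff [simp]: "vec2 a b = vec2 c d \<longleftrightarrow> a = c \<and> b = d"
  by (metis vec2_simps(1,2))

lemma Jm_simp: "Jm (a, b, u) = (vec2 a b, u)" by (simp add: Jm_def)

lemma Jinv_Jm [simp]: "Jinv (Jm p) = p" by (cases p) (simp add: Jm_def Jinv_def)
lemma Jm_Jinv: "x \<in> Rn 2 \<times> UNIV \<Longrightarrow> Jm (Jinv x) = x" using Rn2_vec2 by (auto simp: Jm_def Jinv_def)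
lemma range_Jm: "range Jm = Rn 2 \<times> UNIV"
  using Jm_Jinv by (auto simp: Jm_def image_iff) (metis Rn2_vec2)
lemma inj_Jm: "inj Jm" by (metis injI Jinv_Jm)
lemma Jm_eq_iff [simp]: "Jm p = Jm q \<longleftrightarrow> p = q" using inj_Jm by (auto dest: injD)

definition Lop :: "rvec \<Rightarrow> rvec" where "Lop x = (\<lambda>i\<in>{..<2}. (if i = 0 then l1 else l2) * x i)"

definition Fop :: "rvec \<Rightarrow> rvec" where "Fop x = (\<lambda>i\<in>{..<2}. if i = 0 then - 2 * x 1 else x 0)"

lemma Lop_vec2: "Lop (vec2 a b) = vec2 (l1 * a) (l2 * b)"
  by (rule Rn2_eqI) (simp_all add: Lop_def Rn_def)

lemma Fop_vec2: "Fop (vec2 a b) = vec2 (- 2 * b) a"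
  by (rule Rn2_eqI) (simp_all add: Fop_def Rn_def)

lemma vadd_vec2: "vadd 2 (vec2 a b) (vec2 c d) = vec2 (a + c) (b + d)"
  by (rule Rn2_eqI) (simp_all add: vadd_def Rn_def)

lemma vscale_vec2: "vscale 2 r (vec2 a b) = vec2 (r * a) (r * b)"
  by (rule Rn2_eqI) (simp_all add: vscale_def Rn_def)

lemma vzero_vec2: "vzero 2 = vec2 0 0" by (rule Rn2_eqI) (simp_all add: vzero_def Rn_def)

lemma vinner_vec2: "vinner 2 (vec2 a b) (vec2 c d) = a * c + b * d" by (simp add: vinner_def sum_less2)

lemma linear_op_Lop: "linear_op 2 Lop"
  unfolding linear_op_def
proof (intro conjI ballI allI)
  show "Lop \<in> Rn 2 \<rightarrow> Rn 2" by (auto simp: Lop_def Rn_def)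
  fix x y c assume "x \<in> Rn 2"
  then show "Lop (vscale 2 c x) = vscale 2 c (Lop x)"
    by (subst (1 2) Rn2_vec2) (simp_all add: vscale_vec2 Lop_vec2)
  assume "y \<in> Rn 2"
  with \<open>x \<in> Rn 2\<close> obtain a b c d where "x = vec2 a b" "y = vec2 c d" using Rn2_vec2 by blast
  then show "Lop (vadd 2 x y) = vadd 2 (Lop x) (Lop y)" by (simp add: vadd_vec2 Lop_vec2 algebra_simps)
qed

lemma linear_op_Fop: "linear_op 2 Fop"
  unfolding linear_op_def
proof (intro conjI ballI allI)
  show "Fop \<in> Rn 2 \<rightarrow> Rn 2" by (auto simp: Fop_def Rn_def)
  fix x y c assume "x \<in> Rn 2"
  then show "Fop (vscale 2 c x) = vscale 2 c (Fop x)"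
    by (subst (1 2) Rn2_vec2) (simp_all add: vscale_vec2 Fop_vec2)
  assume "y \<in> Rn 2"
  with \<open>x \<in> Rn 2\<close> obtain a b c d where "x = vec2 a b" "y = vec2 c d" using Rn2_vec2 by blast
  then show "Fop (vadd 2 x y) = vadd 2 (Fop x) (Fop y)" by (simp add: vadd_vec2 Fop_vec2 algebra_simps)
qed

lemma exp_op_vec2: "exp_op 2 Lop u (vec2 a b) = vec2 (exp (u * l1) * a) (exp (u * l2) * b)"
proof -
  have pow: "(Lop ^^ k) (vec2 a b) = vec2 (l1 ^ k * a) (l2 ^ k * b)" for k
    by (induction k) (simp_all add: Lop_vec2 mult_ac)
  have "(\<Sum>k. u ^ k / fact k * (l ^ k * c)) = exp (u * l) * c" for l c :: real
  proof -
    have "(\<lambda>k. (u * l) ^ k /\<^sub>R fact k) sums exp (u * l)" by (rule exp_converges)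
    then have "(\<lambda>k. (u * l) ^ k /\<^sub>R fact k * c) sums (exp (u * l) * c)" by (rule sums_mult2)
    then show ?thesis by (simp add: sums_iff power_mult_distrib field_simps)
  qed
  then show ?thesis by (intro Rn2_eqI) (simp_all add: exp_op_def pow Rn_def)
qed

definition golden_lattice :: "rvec set" where
  "golden_lattice = {vec2 (of_int m + of_int n * t1) (of_int m + of_int n * t2) | m n :: int. True}"

lemma full_rank_golden_lattice: "full_rank_lattice 2 golden_lattice"
  unfolding full_rank_lattice_def
proof (intro exI conjI allI impI)
  let ?b = "\<lambda>j::nat. if j = 0 then vec2 1 1 else vec2 t1 t2"
  show "?b j \<in> Rn 2" for j by simp
  have lc: "lincomb 2 c ?b = vec2 (c 0 + c 1 * t1) (c 0 + c 1 * t2)" for c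
    by (rule Rn2_eqI) (simp_all add: lincomb_def Rn_def sum_less2)
  show "c j = 0" if "lincomb 2 c ?b = vzero 2" "j < 2" for c j
  proof -
    have z: "c 0 + c 1 * t1 = 0" "c 0 + c 1 * t2 = 0" using that(1) by (auto simp: lc vzero_vec2)
    have "c 1 = 0" using coord_lattice(1)[of "c 0" "c 1"] unfolding z by (simp add: coord_n_def)
    then show ?thesis using z that(2) by (auto simp: less2)
  qed
  show "golden_lattice = {lincomb 2 (\<lambda>j. of_int (k j)) ?b | k :: nat \<Rightarrow> int. True}"
    unfolding lc golden_lattice_def
  proof (rule equalityI; rule subsetI)
    fix v assume "v \<in> {vec2 (of_int m + of_int n * t1) (of_int m + of_int n * t2) | m n :: int. True}"
    then obtain m n :: int where "v = vec2 (of_int m + of_int n * t1) (of_int m + of_int n * t2)" by blast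
    then show "v \<in> {vec2 (of_int (k 0) + of_int (k 1) * t1) (of_int (k 0) + of_int (k 1) * t2) | k :: nat \<Rightarrow> int. True}"
      by (auto intro!: exI[of _ "\<lambda>j. if j = 0 then m else n"])
  qed auto
qed

lemma exp_op_golden_lattice: "exp_op 2 Lop 1 ` golden_lattice = golden_lattice"
proof (rule equalityI; rule subsetI)
  fix v assume "v \<in> exp_op 2 Lop 1 ` golden_lattice"
  then obtain m n :: int where v: "v = vec2 (exp (of_int 1 * l1) * (of_int m + of_int n * t1)) (exp (of_int 1 * l2) * (of_int m + of_int n * t2))"
    by (auto simp: golden_lattice_def exp_op_vec2)
  obtain m' n' :: int where *: "exp (of_int 1 * l1) * (of_int m + of_int n * t1) = of_int m' + of_int n' * t1"
    "exp (of_int 1 * l2) * (of_int m + of_int n * t2) = of_int m' + of_int n' * t2" by (rule Gam3_exp)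
  show "v \<in> golden_lattice" unfolding v golden_lattice_def * by blast
next
  fix v assume "v \<in> golden_lattice"
  then obtain m n :: int where v: "v = vec2 (of_int m + of_int n * t1) (of_int m + of_int n * t2)" by (auto simp: golden_lattice_def)
  obtain m' n' :: int where *: "exp (of_int (-1) * l1) * (of_int m + of_int n * t1) = of_int m' + of_int n' * t1"
    "exp (of_int (-1) * l2) * (of_int m + of_int n * t2) = of_int m' + of_int n' * t2" by (rule Gam3_exp)
  have "exp l * (exp (of_int (-1) * l) * c) = c" for l c :: real by (simp add: mult.assoc[symmetric] flip: exp_add)
  then have "v = exp_op 2 Lop 1 (vec2 (of_int m' + of_int n' * t1) (of_int m' + of_int n' * t2))"
    unfolding exp_op_vec2 v *[symmetric] by simp
  then show "v \<in> exp_op 2 Lop 1 ` golden_lattice" by (auto simp: golden_lattice_def)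
qed

abbreviation "LG \<equiv> LieG 2 Lop"

lemma LG_mult: "Jm p \<otimes>\<^bsub>LG\<^esub> Jm q = Jm (mul p q)"
  by (cases p; cases q) (simp add: LieG_def Jm_simp exp_op_vec2 vadd_vec2 mul_simp)

lemma LG_carrier: "carrier LG = range Jm" by (simp add: LieG_def range_Jm)

lemma LG_one: "\<one>\<^bsub>LG\<^esub> = Jm (0, 0, 0)" by (simp add: LieG_def Jm_simp vzero_vec2)

lemma group_LG: "group LG"
proof (rule groupI)
  show "\<one>\<^bsub>LG\<^esub> \<in> carrier LG" by (simp add: LG_one LG_carrier)
  show "x \<otimes>\<^bsub>LG\<^esub> y \<in> carrier LG" if "x \<in> carrier LG" "y \<in> carrier LG" for x y
    using that by (auto simp: LG_carrier LG_mult)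
  show "x \<otimes>\<^bsub>LG\<^esub> y \<otimes>\<^bsub>LG\<^esub> z = x \<otimes>\<^bsub>LG\<^esub> (y \<otimes>\<^bsub>LG\<^esub> z)" if "x \<in> carrier LG" "y \<in> carrier LG" "z \<in> carrier LG" for x y z
    using that by (auto simp: LG_carrier LG_mult mul_assoc)
  show "\<one>\<^bsub>LG\<^esub> \<otimes>\<^bsub>LG\<^esub> x = x" if "x \<in> carrier LG" for x using that by (auto simp: LG_carrier LG_one LG_mult)
  show "\<exists>y\<in>carrier LG. y \<otimes>\<^bsub>LG\<^esub> x = \<one>\<^bsub>LG\<^esub>" if x: "x \<in> carrier LG" for x
  proof -
    obtain p where "x = Jm p" using x by (auto simp: LG_carrier)
    then show ?thesis by (intro bexI[of _ "Jm (ivs p)"]) (simp_all add: LG_mult LG_one LG_carrier)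
  qed
qed

lemma LG_inv: "inv\<^bsub>LG\<^esub> (Jm p) = Jm (ivs p)"
  by (rule group.inv_equality[OF group_LG]) (simp_all add: LG_mult LG_one LG_carrier)

text \<open>The explicit set contains the generators and is closed under the group operations.
  Conversely \<open>(\<gamma>, k)\<close> is the lattice translation by \<gamma> followed on the
  right by the \<open>k\<close>-th power of \<open>(0, 1)\<close>.\<close>

lemma Gam_eq: "Gam 2 Lop golden_lattice = Jm ` Gam3"
proof
  let ?S = "(\<lambda>\<gamma>. (\<gamma>, 0)) ` golden_lattice \<union> {(vzero 2, 1)}"
  have S: "x \<in> Jm ` Gam3" if "x \<in> ?S" for x
  proof -
    have "(vzero 2, 1) = Jm (0, 0, 1)" by (simp add: Jm_simp vzero_vec2)
    moreover have "(0, 0, 1) \<in> Gam3" by (simp add: Gam3_iff coord_m_def coord_n_def)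
    moreover have "(\<gamma>, 0) \<in> Jm ` Gam3" if g: "\<gamma> \<in> golden_lattice" for \<gamma>
    proof -
      obtain m n :: int where "\<gamma> = vec2 (of_int m + of_int n * t1) (of_int m + of_int n * t2)" using g by (auto simp: golden_lattice_def)
      then have "(\<gamma>, 0) = Jm (of_int m + of_int n * t1, of_int m + of_int n * t2, 0)" by (simp add: Jm_simp)
      then show ?thesis by (auto simp: Gam3_iff)
    qed
    ultimately show ?thesis using that by auto
  qed
  show "Gam 2 Lop golden_lattice \<subseteq> Jm ` Gam3"
  proof
    fix x assume "x \<in> Gam 2 Lop golden_lattice"
    then have "x \<in> generate LG ?S" by (simp add: Gam_def)
    then show "x \<in> Jm ` Gam3"
    proof (induction rule: generate.induct)
      case one then show ?case by (simp add: LG_one Gam3_one)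
    next
      case (incl h) then show ?case by (rule S)
    next
      case (inv h)
      then obtain p where "h = Jm p" "p \<in> Gam3" using S by blast
      then show ?case by (simp add: LG_inv Gam3_ivs)
    next
      case (eng h1 h2) then show ?case by (auto simp: LG_mult Gam3_mul)
    qed
  qed
  have G: "subgroup (Gam 2 Lop golden_lattice) LG" unfolding Gam_def
    by (rule group.generate_is_subgroup[OF group_LG]) (use S in \<open>unfold LG_carrier, blast\<close>)
  have zN: "Jm (0, 0, real k) \<in> Gam 2 Lop golden_lattice" for k
  proof (induction k)
    case 0 then show ?case using subgroup.one_closed[OF G] by (simp add: LG_one)
  next
    case (Suc k)
    have "Jm (0, 0, 1) \<in> Gam 2 Lop golden_lattice" unfolding Gam_def by (rule generate.incl) (simp add: Jm_simp vzero_vec2)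
    from subgroup.m_closed[OF G Suc this] show ?case by (simp add: LG_mult mul_simp add.commute)
  qed
  have z: "Jm (0, 0, of_int k) \<in> Gam 2 Lop golden_lattice" for k :: int
  proof (cases "k \<ge> 0")
    case True then show ?thesis using zN[of "nat k"] by simp
  next
    case False
    then show ?thesis using subgroup.m_inv_closed[OF G zN[of "nat (-k)"]] by (simp add: LG_inv ivs_def)
  qed
  show "Jm ` Gam3 \<subseteq> Gam 2 Lop golden_lattice"
  proof
    fix x assume "x \<in> Jm ` Gam3"
    then obtain m n k :: int where x: "x = Jm (of_int m + of_int n * t1, of_int m + of_int n * t2, of_int k)" by (auto simp: Gam3_def)
    have "Jm (of_int m + of_int n * t1, of_int m + of_int n * t2, 0) \<in> Gam 2 Lop golden_lattice"
      unfolding Gam_def by (rule generate.incl) (auto simp: Jm_simp golden_lattice_def)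
    from subgroup.m_closed[OF G this z[of k]] show "x \<in> Gam 2 Lop golden_lattice" by (simp add: x LG_mult mul_simp)
  qed
qed

definition quo :: "r3 \<Rightarrow> (rvec \<times> real) set" where "quo p = coset_proj 2 Lop golden_lattice (Jm p)"

lemma quo_eq: "quo p = (\<lambda>\<gamma>. Jm (mul \<gamma> p)) ` Gam3"
  by (auto simp: quo_def coset_proj_def r_coset_def Gam_eq LG_mult)

lemma quo_eq_iff: "quo p = quo p' \<longleftrightarrow> (\<exists>\<gamma>\<in>Gam3. p' = mul \<gamma> p)"
proof
  assume *: "quo p = quo p'"
  have "Jm p' \<in> quo p'" unfolding quo_eq using Gam3_one by (force intro!: image_eqI[of _ _ "(0,0,0)"])
  then show "\<exists>\<gamma>\<in>Gam3. p' = mul \<gamma> p" unfolding *[symmetric] by (auto simp: quo_eq)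
next
  assume "\<exists>\<gamma>\<in>Gam3. p' = mul \<gamma> p"
  then obtain g where g: "g \<in> Gam3" "p' = mul g p" by blast
  then have p: "p = mul (ivs g) p'" by simp
  show "quo p = quo p'"
  proof (rule equalityI; rule subsetI)
    fix x assume "x \<in> quo p"
    then obtain h where h: "h \<in> Gam3" "x = Jm (mul h p)" by (auto simp: quo_eq)
    then have "x = Jm (mul (mul h (ivs g)) p')" using p by (simp add: mul_assoc)
    then show "x \<in> quo p'" using h g Gam3_mul Gam3_ivs unfolding quo_eq by blast
  next
    fix x assume "x \<in> quo p'"
    then obtain h where h: "h \<in> Gam3" "x = Jm (mul h p')" by (auto simp: quo_eq)
    then have "x = Jm (mul (mul h g) p)" using g by (simp add: mul_assoc)
    then show "x \<in> quo p" using h g Gam3_mul unfolding quo_eq by blast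
  qed
qed

lemma Nspace_eq: "Nspace 2 Lop golden_lattice = range quo"
  by (auto simp: Nspace_def RCOSETS_def quo_def coset_proj_def LG_carrier)

lemma quo_mul: "quo p #>\<^bsub>LG\<^esub> Jm g = quo (mul p g)"
  unfolding quo_eq r_coset_def by (auto simp: LG_mult mul_assoc)

lemma quo_mul_left: "\<gamma> \<in> Gam3 \<Longrightarrow> quo (mul \<gamma> p) = quo p"
  using quo_eq_iff by blast

section \<open>Transport of measure and topology\<close>

lemma space_Emeasure: "space (Emeasure 2) = Rn 2 \<times> UNIV"
  by (simp add: Emeasure_def space_pair_measure space_PiM Rn_def)

lemma Jinv_measurable: "Jinv \<in> measurable (Emeasure 2) borel"
  unfolding Emeasure_def Jinv_def split_beta' borel_prod[symmetric]
  by (intro measurable_Pair) measurable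

lemma vec2_measurable: "(\<lambda>p. vec2 (fst p) (snd p)) \<in> measurable borel (PiM {..<2} (\<lambda>_. lborel))"
  unfolding vec2_def borel_prod[symmetric]
  by (intro measurable_restrict) measurable

lemma Jm_measurable: "Jm \<in> measurable borel (Emeasure 2)"
proof -
  have a: "(\<lambda>p :: r3. (fst p, fst (snd p))) \<in> measurable borel borel"
    by (intro borel_measurable_continuous_onI continuous_intros)
  have b: "(\<lambda>p :: r3. snd (snd p)) \<in> measurable borel lborel"
    unfolding measurable_lborel1 measurable_lborel2 by (intro borel_measurable_continuous_onI continuous_intros)
  have "(\<lambda>p. (vec2 (fst p) (fst (snd p)), snd (snd p))) \<in> measurable borel (Emeasure 2)"
    unfolding Emeasure_def using measurable_Pair[OF measurable_compose[OF a vec2_measurable] b] by simp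
  then show ?thesis by (simp add: Jm_def split_beta')
qed

lemma emeasure_lborel_Times:
  fixes A :: "'a::euclidean_space set" and B :: "'b::euclidean_space set"
  assumes "A \<in> sets borel" "B \<in> sets borel"
  shows "emeasure lborel (A \<times> B) = emeasure lborel A * emeasure lborel B"
  using sigma_finite_measure.emeasure_pair_measure_Times[OF sigma_finite_lborel, of A lborel B] assms
  by (simp add: lborel_prod)

text \<open>Lebesgue measure is determined by its values on boxes, and the preimage of a box is a
  product set on which the product measure factors.\<close>

lemma lborel_eq_distr_Jinv: "lborel = distr (Emeasure 2) borel Jinv"
proof (rule lborel_eqI)
  interpret P: product_sigma_finite "\<lambda>_::nat. lborel :: real measure" by standard
  interpret F: finite_product_sigma_finite "\<lambda>_::nat. lborel :: real measure" "{..<2::nat}" by standard simp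
  fix l u :: r3 assume lu: "\<And>b. b \<in> Basis \<Longrightarrow> l \<bullet> b \<le> u \<bullet> b"
  obtain a b c where l: "l = (a, b, c)" by (cases l)
  obtain a' b' c' where u: "u = (a', b', c')" by (cases u)
  have bx: "box l u = {a<..<a'} \<times> ({b<..<b'} \<times> {c<..<c'})" by (simp add: l u box_prod box_real)
  have "(\<Prod>b\<in>Basis. (u - l) \<bullet> b) = emeasure lborel (box l u)" by (rule emeasure_lborel_box[symmetric, OF lu])
  also have "\<dots> = emeasure (lborel :: real measure) {a<..<a'} * (emeasure (lborel :: real measure) {b<..<b'} * emeasure (lborel :: real measure) {c<..<c'})"
    unfolding bx by (simp add: emeasure_lborel_Times borel_Times)
  finally have R: "ennreal (\<Prod>b\<in>Basis. (u - l) \<bullet> b) = emeasure (lborel :: real measure) {a<..<a'} * (emeasure (lborel :: real measure) {b<..<b'} * emeasure (lborel :: real measure) {c<..<c'})" .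
  define I where "I = (\<lambda>i::nat. if i = 0 then {a<..<a'} else {b<..<b'})"
  have pre: "Jinv -` box l u \<inter> space (Emeasure 2) = Pi\<^sub>E {..<2} I \<times> {c<..<c'}"
  proof (rule Set.set_eqI)
    fix x :: "rvec \<times> real"
    obtain v r where x: "x = (v, r)" by (cases x)
    have two: "{..<2::nat} = {0, 1}" by auto
    have "v \<in> Pi\<^sub>E {..<2} I \<longleftrightarrow> v \<in> Rn 2 \<and> v 0 \<in> {a<..<a'} \<and> v 1 \<in> {b<..<b'}"
      unfolding Rn_def PiE_iff two by (auto simp: I_def)
    then show "x \<in> Jinv -` box l u \<inter> space (Emeasure 2) \<longleftrightarrow> x \<in> Pi\<^sub>E {..<2} I \<times> {c<..<c'}"
      unfolding bx space_Emeasure x by (simp add: Jinv_def) blast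
  qed
  have "emeasure (distr (Emeasure 2) borel Jinv) (box l u) = emeasure (Emeasure 2) (Pi\<^sub>E {..<2} I \<times> {c<..<c'})"
    by (subst emeasure_distr[OF Jinv_measurable]) (auto simp: pre)
  also have "\<dots> = emeasure (PiM {..<2} (\<lambda>_. lborel :: real measure)) (Pi\<^sub>E {..<2} I) * emeasure (lborel :: real measure) {c<..<c'}"
    unfolding Emeasure_def by (rule lborel.emeasure_pair_measure_Times) (auto intro!: sets_PiM_I_finite simp: I_def)
  also have "emeasure (PiM {..<2} (\<lambda>_. lborel :: real measure)) (Pi\<^sub>E {..<2} I) = (\<Prod>i<2. emeasure lborel (I i))"
    by (rule P.emeasure_PiM) (auto simp: I_def)
  also have "\<dots> = emeasure (lborel :: real measure) {a<..<a'} * emeasure (lborel :: real measure) {b<..<b'}"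
    by (simp add: numeral_2_eq_2 I_def)
  finally show "emeasure (distr (Emeasure 2) borel Jinv) (box l u) = ennreal (\<Prod>b\<in>Basis. (u - l) \<bullet> b)"
    unfolding R by (simp add: mult.assoc)
qed simp

lemma Emeasure_eq_distr_Jm: "Emeasure 2 = distr lborel (Emeasure 2) Jm"
proof -
  have "distr (distr (Emeasure 2) borel Jinv) (Emeasure 2) Jm = distr (Emeasure 2) (Emeasure 2) (Jm \<circ> Jinv)"
    by (rule distr_distr[OF Jm_measurable Jinv_measurable])
  also have "\<dots> = distr (Emeasure 2) (Emeasure 2) (\<lambda>x. x)"
    by (intro distr_cong) (auto simp: space_Emeasure Jm_Jinv)
  finally show ?thesis by (simp add: distr_id2 flip: lborel_eq_distr_Jinv)
qed

lemma sets_Emeasure_iff: "A \<in> sets (Emeasure 2) \<longleftrightarrow> A \<subseteq> range Jm \<and> Jm -` A \<in> sets borel"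
proof
  assume A: "A \<in> sets (Emeasure 2)"
  then show "A \<subseteq> range Jm \<and> Jm -` A \<in> sets borel"
    using measurable_sets[OF Jm_measurable A] sets.sets_into_space[OF A] by (simp add: space_Emeasure range_Jm)
next
  assume A: "A \<subseteq> range Jm \<and> Jm -` A \<in> sets borel"
  have "A = Jinv -` (Jm -` A) \<inter> space (Emeasure 2)"
  proof (rule Set.set_eqI)
    fix x show "x \<in> A \<longleftrightarrow> x \<in> Jinv -` (Jm -` A) \<inter> space (Emeasure 2)"
      using A Jm_Jinv[of x] unfolding space_Emeasure range_Jm[symmetric] by auto
  qed
  then show "A \<in> sets (Emeasure 2)" using measurable_sets[OF Jinv_measurable, of "Jm -` A"] A by simp
qed

lemma emeasure_Emeasure: "A \<in> sets (Emeasure 2) \<Longrightarrow> emeasure (Emeasure 2) A = emeasure lborel (Jm -` A)"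
  by (subst Emeasure_eq_distr_Jm, subst emeasure_distr) (use Jm_measurable in \<open>simp_all add: measurable_lborel1\<close>)

lemma topspace_Etop: "topspace (Etop 2) = Rn 2 \<times> UNIV"
  by (simp add: Etop_def Rn_def)

lemma continuous_map_Jm: "continuous_map euclidean (Etop 2) Jm"
proof -
  have "continuous_map euclidean (product_topology (\<lambda>_. euclideanreal) {..<2}) (\<lambda>p::r3. vec2 (fst p) (fst (snd p)))"
    unfolding continuous_map_componentwise by (auto simp: vec2_def less2 intro!: continuous_intros)
  then have "continuous_map euclidean (Etop 2) (\<lambda>p. (vec2 (fst p) (fst (snd p)), snd (snd p)))"
    unfolding Etop_def by (intro continuous_map_pairedI) (auto intro!: continuous_intros)
  then show ?thesis by (simp add: Jm_def split_beta')
qed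

lemma continuous_map_Jinv: "continuous_map (Etop 2) euclidean Jinv"
proof -
  have c: "continuous_map (Etop 2) euclideanreal (\<lambda>x. fst x i)" if "i < 2" for i
    using continuous_map_compose[OF continuous_map_fst continuous_map_product_projection, of i "{..<2}" "\<lambda>_. euclideanreal" euclideanreal] that
    by (simp add: Etop_def comp_def)
  have d: "continuous_map (Etop 2) euclideanreal snd" unfolding Etop_def by (rule continuous_map_snd)
  have "continuous_map (Etop 2) (prod_topology euclideanreal (prod_topology euclideanreal euclideanreal)) (\<lambda>x. (fst x 0, fst x 1, snd x))"
    by (intro continuous_map_pairedI c d) auto
  then show ?thesis by (simp add: Jinv_def split_beta')
qed

lemma openin_Etop_iff: "openin (Etop 2) W \<longleftrightarrow> W \<subseteq> range Jm \<and> open (Jm -` W)"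
proof
  assume W: "openin (Etop 2) W"
  then show "W \<subseteq> range Jm \<and> open (Jm -` W)"
    using openin_continuous_map_preimage[OF continuous_map_Jm W] openin_subset[OF W] by (simp add: topspace_Etop range_Jm vimage_def)
next
  assume W: "W \<subseteq> range Jm \<and> open (Jm -` W)"
  have "W = {x \<in> topspace (Etop 2). Jinv x \<in> Jm -` W}"
    using W by (auto simp: topspace_Etop Jm_Jinv range_Jm)
  then show "openin (Etop 2) W" using openin_continuous_map_preimage[OF continuous_map_Jinv, of "Jm -` W"] W by simp
qed

lemma openin_Ntop_iff: "openin (Ntop 2 Lop golden_lattice) U \<longleftrightarrow> U \<subseteq> range quo \<and> open (quo -` U)"
proof -
  have "coset_proj 2 Lop golden_lattice ` topspace (Etop 2) = range quo"
    by (auto simp: topspace_Etop quo_def simp flip: range_Jm)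
  moreover have "Jm -` {x \<in> topspace (Etop 2). coset_proj 2 Lop golden_lattice x \<in> U} = quo -` U"
    by (auto simp: topspace_Etop quo_def simp flip: range_Jm)
  moreover have "{x \<in> topspace (Etop 2). coset_proj 2 Lop golden_lattice x \<in> U} \<subseteq> range Jm"
    by (auto simp: topspace_Etop range_Jm)
  ultimately show ?thesis unfolding Ntop_def openin_quotient_topology openin_Etop_iff by simp
qed

abbreviation "NT \<equiv> Ntop 2 Lop golden_lattice"

lemma topspace_NT: "topspace NT = range quo"
proof -
  have "quo -` range quo = UNIV" by auto
  then have "openin NT (range quo)" by (simp add: openin_Ntop_iff)
  then show ?thesis using openin_Ntop_iff[of "topspace NT"] openin_subset by fastforce
qed

abbreviation "NB \<equiv> borel_of NT"

lemma space_borel_of [simp]: "space (borel_of X) = topspace X"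
  unfolding borel_of_def by (rule space_measure_of) (auto dest: openin_subset)

lemma sets_borel_of: "sets (borel_of X) = sigma_sets (topspace X) {U. openin X U}"
  unfolding borel_of_def by (rule sets_measure_of) (auto dest: openin_subset)

lemma openin_borel_of: "openin X U \<Longrightarrow> U \<in> sets (borel_of X)"
  by (simp add: sets_borel_of sigma_sets.Basic)

lemma quo_measurable: "quo \<in> measurable borel NB"
  unfolding borel_of_def
proof (rule measurable_measure_of)
  show "quo \<in> space borel \<rightarrow> topspace NT" by (simp add: topspace_NT)
  show "quo -` U \<inter> space borel \<in> sets borel" if "U \<in> {U. openin NT U}" for U
    using that by (simp add: openin_Ntop_iff)
qed (auto dest: openin_subset)

lemma continuous_mul: "continuous_on UNIV (\<lambda>p. mul (f p) (g p))" if "continuous_on UNIV f" "continuous_on UNIV g"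
  for f g :: "'a::topological_space \<Rightarrow> r3"
  unfolding mul_def split_beta' using that by (intro continuous_intros)

lemma continuous_ivs: "continuous_on UNIV (\<lambda>p. ivs (f p))" if "continuous_on UNIV f" for f :: "'a::topological_space \<Rightarrow> r3"
  unfolding ivs_def split_beta' using that by (intro continuous_intros)

lemma quo_vimage_image: "quo -` (quo ` V) = (\<Union>\<gamma>\<in>Gam3. mul (ivs \<gamma>) -` V)"
proof (intro equalityI subsetI)
  fix p assume "p \<in> quo -` (quo ` V)"
  then obtain v where "v \<in> V" "quo v = quo p" by auto
  then obtain g where "g \<in> Gam3" "p = mul g v" by (auto simp: quo_eq_iff)
  then show "p \<in> (\<Union>\<gamma>\<in>Gam3. mul (ivs \<gamma>) -` V)" using \<open>v \<in> V\<close> by (auto intro!: bexI[of _ g])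
next
  fix p assume "p \<in> (\<Union>\<gamma>\<in>Gam3. mul (ivs \<gamma>) -` V)"
  then obtain g where "g \<in> Gam3" "mul (ivs g) p \<in> V" by auto
  then show "p \<in> quo -` (quo ` V)" using quo_mul_left[OF Gam3_ivs, of g p] by (auto simp: image_iff intro!: bexI[of _ "mul (ivs g) p"])
qed

lemma quo_open: "open V \<Longrightarrow> openin NT (quo ` V)"
  unfolding openin_Ntop_iff quo_vimage_image
  by (auto intro!: open_UN open_vimage continuous_mul continuous_intros)

section \<open>The Borel structure of the quotient\<close>

lemma countable_Gam3: "countable Gam3"
proof -
  have "Gam3 \<subseteq> (\<lambda>(m, n, k). (of_int m + of_int n * t1, of_int m + of_int n * t2, of_int k)) ` (UNIV :: (int \<times> int \<times> int) set)"
  proof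
    fix p assume "p \<in> Gam3"
    then obtain m n k :: int where "p = (of_int m + of_int n * t1, of_int m + of_int n * t2, of_int k)" by (auto simp: Gam3_def)
    then show "p \<in> (\<lambda>(m, n, k). (of_int m + of_int n * t1, of_int m + of_int n * t2, of_int k)) ` (UNIV :: (int \<times> int \<times> int) set)"
      by (intro image_eqI[of _ _ "(m, n, k)"]) simp_all
  qed
  then show ?thesis by (rule countable_subset) simp
qed

text \<open>Two points of a box differ by less than \<open>1 / 2\<close>, \<open>1 / 2\<close> and
  \<open>1\<close> in the three coordinates, and the identity is the only element of
  \<open>Gam3\<close> of that size. The box therefore embeds in the quotient.\<close>

definition small_box :: "r3 \<Rightarrow> r3 set" where
  "small_box p = {q. \<bar>fst q - fst p\<bar> < 1/4 \<and> \<bar>fst (snd q) - fst (snd p)\<bar> < 1/4 \<and> \<bar>snd (snd q) - snd (snd p)\<bar> < 1/2}"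

lemma open_small_box: "open (small_box p)"
  unfolding small_box_def by (intro open_Collect_conj open_Collect_less continuous_intros)

lemma small_box_self: "p \<in> small_box p" by (simp add: small_box_def)

lemma Ints_abs_less1: "x \<in> \<int> \<Longrightarrow> \<bar>x\<bar> < (1::real) \<Longrightarrow> x = 0"
  using Ints_nonzero_abs_less1 by auto

lemma Gam3_small:
  assumes "(a, b, u) \<in> Gam3" "\<bar>a\<bar> < 1/2" "\<bar>b\<bar> < 1/2" "\<bar>u\<bar> < 1"
  shows "(a, b, u) = (0, 0, 0)"
proof -
  have i: "coord_m a b \<in> \<int>" "coord_n a b \<in> \<int>" "u \<in> \<int>" using assms(1) by (auto simp: Gam3_iff)
  have u: "u = 0" using Ints_abs_less1 i(3) assms(4) by blast
  have "1 < sqrt (5::real)" by (rule real_less_rsqrt) simp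
  then have "\<bar>b - a\<bar> < sqrt 5" using assms(2,3) by linarith
  then have "\<bar>coord_n a b\<bar> < 1" by (simp add: coord_n_def abs_divide)
  then have n: "coord_n a b = 0" using Ints_abs_less1 i(2) by blast
  then have "coord_m a b = a" by (simp add: coord_m_def)
  then have m: "a = 0" using Ints_abs_less1[of a] i(1) assms(2) by simp
  show ?thesis using n m u by (simp add: coord_n_def)
qed

lemma inj_on_small_box: "inj_on quo (small_box p)"
proof (rule inj_onI)
  fix q q' assume q: "q \<in> small_box p" "q' \<in> small_box p" "quo q = quo q'"
  obtain g where g: "g \<in> Gam3" "q' = mul g q" using q(3) by (auto simp: quo_eq_iff)
  obtain a b u where ge: "g = (a, b, u)" by (cases g)
  obtain x y z where qe: "q = (x, y, z)" by (cases q)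
  have q'e: "q' = (a + exp (u * l1) * x, b + exp (u * l2) * y, u + z)" by (simp add: g ge qe mul_simp)
  have "\<bar>z - snd (snd p)\<bar> < 1/2" "\<bar>u + z - snd (snd p)\<bar> < 1/2" using q(1,2) unfolding q'e qe small_box_def by simp_all
  then have "\<bar>u\<bar> < 1" by linarith
  moreover have "u \<in> \<int>" using g(1) ge by (simp add: Gam3_iff)
  ultimately have u: "u = 0" using Ints_abs_less1 by blast
  have "\<bar>x - fst p\<bar> < 1/4" "\<bar>a + x - fst p\<bar> < 1/4" using q(1,2) unfolding q'e qe small_box_def u by simp_all
  then have a: "\<bar>a\<bar> < 1/2" by linarith
  have "\<bar>y - fst (snd p)\<bar> < 1/4" "\<bar>b + y - fst (snd p)\<bar> < 1/4" using q(1,2) unfolding q'e qe small_box_def u by simp_all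
  then have b: "\<bar>b\<bar> < 1/2" by linarith
  have "g = (0, 0, 0)" using Gam3_small[of a b u] g(1) u a b unfolding ge by simp
  then show "q = q'" using g(2) by simp
qed

text \<open>Induction over the generation of the Borel sets: injectivity on the box is what lets
  images commute with complements, and images of open sets are open.\<close>

lemma quo_image_borel_small:
  assumes "B \<in> sets borel" "B \<subseteq> small_box p"
  shows "quo ` B \<in> sets NB"
proof -
  let ?V = "small_box p"
  have "A \<subseteq> UNIV \<longrightarrow> quo ` (A \<inter> ?V) \<in> sets NB" if "A \<in> sigma_sets UNIV {S :: r3 set. open S}" for A
    using that
  proof (induction rule: sigma_sets.induct)
    case (Basic a)
    then show ?case by (intro impI openin_borel_of quo_open open_Int open_small_box) simp
  next
    case (Compl a)
    have "quo ` ((UNIV - a) \<inter> ?V) = quo ` ?V - quo ` (a \<inter> ?V)"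
      using inj_on_small_box[of p] by (auto dest: inj_onD)
    then show ?case using Compl openin_borel_of[OF quo_open[OF open_small_box, of p]] by auto
  next
    case (Union a)
    have "quo ` ((\<Union>i. a i) \<inter> ?V) = (\<Union>i. quo ` (a i \<inter> ?V))" by auto
    then show ?case using Union by auto
  qed simp
  moreover have "B \<in> sigma_sets UNIV {S :: r3 set. open S}" using assms(1) by (simp add: borel_def sets_measure_of_conv)
  ultimately have "quo ` (B \<inter> ?V) \<in> sets NB" by blast
  moreover have "B \<inter> ?V = B" using assms(2) by blast
  ultimately show ?thesis by simp
qed

lemma quo_image_borel:
  assumes "B \<in> sets borel"
  shows "quo ` B \<in> sets NB"
proof -
  obtain \<F> where F: "\<F> \<subseteq> range small_box" "countable \<F>" "\<Union>\<F> = \<Union>(range small_box)"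
    by (rule Lindelof[of "range small_box"]) (use open_small_box in auto)
  have "\<Union>\<F> = UNIV" using F(3) small_box_self by blast
  then have "quo ` B = (\<Union>V\<in>\<F>. quo ` (B \<inter> V))" by blast
  moreover have "quo ` (B \<inter> V) \<in> sets NB" if V': "V \<in> \<F>" for V
  proof -
    obtain p where V: "V = small_box p" using V' F(1) by blast
    have "V \<in> sets borel" using open_small_box V by simp
    then show ?thesis using quo_image_borel_small[of "B \<inter> V" p] assms V by simp
  qed
  ultimately show ?thesis using F(2) by auto
qed

text \<open>The direction from right to left is the substantial one: a set with Borel preimage is
  the image of that preimage, and images of Borel sets are Borel by covering the group with
  countably many boxes that embed.\<close>

lemma sets_NB_iff: "A \<in> sets NB \<longleftrightarrow> A \<subseteq> range quo \<and> quo -` A \<in> sets borel"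
proof
  assume "A \<in> sets NB"
  then show "A \<subseteq> range quo \<and> quo -` A \<in> sets borel"
    using measurable_sets[OF quo_measurable] sets.sets_into_space[of A NB] by (auto simp: topspace_NT)
next
  assume A: "A \<subseteq> range quo \<and> quo -` A \<in> sets borel"
  then have "A = quo ` (quo -` A)" by auto
  then show "A \<in> sets NB" using quo_image_borel[of "quo -` A"] A by simp
qed

section \<open>Fundamental domains and the invariant measure on the quotient\<close>

definition D0 :: "r3 set" where
  "D0 = {(a, b, u). 0 \<le> coord_m a b \<and> coord_m a b < 1 \<and> 0 \<le> coord_n a b \<and> coord_n a b < 1 \<and> 0 \<le> u \<and> u < 1}"

definition fdom :: "r3 set \<Rightarrow> bool" where "fdom D \<longleftrightarrow> D \<in> sets borel \<and> inj_on quo D \<and> quo ` D = range quo"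

lemma fundamental_domain_iff: "fundamental_domain 2 Lop golden_lattice D \<longleftrightarrow> D \<subseteq> range Jm \<and> fdom (Jm -` D)"
proof -
  have *: "bij_betw (coset_proj 2 Lop golden_lattice) D (range quo) \<longleftrightarrow> inj_on quo (Jm -` D) \<and> quo ` (Jm -` D) = range quo" if "D \<subseteq> range Jm"
  proof -
    have D: "Jm ` (Jm -` D) = D" using that by (rule image_vimage_eq[THEN trans, OF Int_absorb2])
    have "coset_proj 2 Lop golden_lattice ` (Jm ` X) = quo ` X" for X by (simp add: image_image quo_def)
    moreover have "inj_on (coset_proj 2 Lop golden_lattice) (Jm ` X) \<longleftrightarrow> inj_on quo X" for X
      by (auto simp: quo_def inj_on_def)
    ultimately show ?thesis unfolding bij_betw_def by (metis D)
  qed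
  show ?thesis unfolding fundamental_domain_def fdom_def Nspace_eq sets_Emeasure_iff using * by auto
qed

lemma coord_scale_unique: "coord_m a b = coord_m a' b' \<Longrightarrow> coord_n a b = coord_n a' b' \<Longrightarrow> a = a' \<and> b = b'"
  using coord_inverse(1)[where a = a and b = b] coord_inverse(2)[where a = a and b = b]
    coord_inverse(1)[where a = a' and b = b'] coord_inverse(2)[where a = a' and b = b'] by simp

lemma continuous_on_coord: "continuous_on S f \<Longrightarrow> continuous_on S g \<Longrightarrow> continuous_on S (\<lambda>p. coord_m (f p) (g p))"
  "continuous_on S f \<Longrightarrow> continuous_on S g \<Longrightarrow> continuous_on S (\<lambda>p. coord_n (f p) (g p))"
  unfolding coord_m_def coord_n_def by (intro continuous_intros; simp)+

lemma fdom_D0: "fdom D0"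
  unfolding fdom_def
proof (intro conjI)
  have m [measurable]: "(\<lambda>p::r3. coord_m (fst p) (fst (snd p))) \<in> borel_measurable borel"
    "(\<lambda>p::r3. coord_n (fst p) (fst (snd p))) \<in> borel_measurable borel" "(\<lambda>p::r3. snd (snd p)) \<in> borel_measurable borel"
    by (intro borel_measurable_continuous_onI continuous_on_coord continuous_intros)+
  have "D0 = {p \<in> space borel. 0 \<le> coord_m (fst p) (fst (snd p)) \<and> coord_m (fst p) (fst (snd p)) < 1
     \<and> 0 \<le> coord_n (fst p) (fst (snd p)) \<and> coord_n (fst p) (fst (snd p)) < 1 \<and> 0 \<le> snd (snd p) \<and> snd (snd p) < 1}"
    by (auto simp: D0_def)
  also have "\<dots> \<in> sets borel" by measurable
  finally show "D0 \<in> sets borel" .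
  show "inj_on quo D0"
  proof (rule inj_onI)
    fix q q' assume q: "q \<in> D0" "q' \<in> D0" "quo q = quo q'"
    obtain g where g: "g \<in> Gam3" "q' = mul g q" using q(3) by (auto simp: quo_eq_iff)
    obtain a b u where ge: "g = (a, b, u)" by (cases g)
    obtain x y z where qe: "q = (x, y, z)" by (cases q)
    have q'e: "q' = (a + exp (u * l1) * x, b + exp (u * l2) * y, u + z)" by (simp add: g ge qe mul_simp)
    have gi: "coord_m a b \<in> \<int>" "coord_n a b \<in> \<int>" "u \<in> \<int>" using g(1) ge by (auto simp: Gam3_iff)
    have "\<bar>u\<bar> < 1" using q(1,2) unfolding q'e qe D0_def by auto
    then have u: "u = 0" using Ints_abs_less1 gi(3) by blast
    have "\<bar>coord_m a b\<bar> < 1" "\<bar>coord_n a b\<bar> < 1" using q(1,2) unfolding q'e qe D0_def u by (auto simp: coord_add)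
    then have "coord_m a b = 0" "coord_n a b = 0" using Ints_abs_less1 gi by auto
    then have "a = 0 \<and> b = 0" using coord_scale_unique[of a b 0 0] by (simp add: coord_m_def coord_n_def)
    then show "q = q'" by (simp add: q'e qe u)
  qed
  have "quo p \<in> quo ` D0" for p
  proof -
    obtain a b u where p: "p = (a, b, u)" by (cases p)
    \<comment> \<open>The height is reduced first, since this rescales the other two coordinates;
      the lattice translation is then chosen for the rescaled point \<open>(a', b')\<close>.\<close>
    define k where "k = - \<lfloor>u\<rfloor>"
    define a' b' where "a' = exp (of_int k * l1) * a" and "b' = exp (of_int k * l2) * b"
    define m n where "m = - \<lfloor>coord_m a' b'\<rfloor>" and "n = - \<lfloor>coord_n a' b'\<rfloor>"
    let ?g = "(of_int m + of_int n * t1, of_int m + of_int n * t2, of_int k) :: r3"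
    have g: "?g \<in> Gam3" by (auto simp: Gam3_def)
    have "mul ?g p = (of_int m + of_int n * t1 + a', of_int m + of_int n * t2 + b', of_int k + u)"
      by (simp add: p mul_simp a'_def b'_def)
    also have "\<dots> \<in> D0"
      unfolding D0_def split_conv mem_Collect_eq coord_add[of "of_int m + of_int n * t1" _ "of_int m + of_int n * t2"] coord_lattice
      unfolding k_def m_def n_def by simp linarith
    finally have "mul ?g p \<in> D0" .
    then show ?thesis using quo_mul_left[OF g, of p] by (metis image_eqI)
  qed
  then show "quo ` D0 = range quo" by blast
qed

text \<open>A left translation is an affine map with diagonal linear part, whose determinant
  \<open>exp (u * (l1 + l2))\<close> equals 1.\<close>

lemma preserves_mul_left: "preserves lborel (mul g)"
proof -
  obtain a b u where g: "g = (a, b, u)" by (cases g)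
  define s where "s = exp (u * l1)"
  have s: "s > 0" by (simp add: s_def)
  have "l2 = - l1" using l_sum by simp
  then have "u * l2 = - (u * l1)" unfolding \<open>l2 = - l1\<close> by simp
  then have es: "exp (u * l2) = inverse s" by (simp only: s_def exp_minus)
  have B: "Basis = {(1, 0, 0), (0, 1, 0), (0, 0, 1) :: r3}" by (simp add: Basis_prod_def zero_prod_def image_Un insert_commute)
  define c :: "r3 \<Rightarrow> real" where "c = (\<lambda>j. if j = (1, 0, 0) then s else if j = (0, 1, 0) then inverse s else 1)"
  have mg: "mul g = (\<lambda>p. (a, b, u) + (\<Sum>j\<in>Basis. (c j * (p \<bullet> j)) *\<^sub>R j))"
  proof
    fix p :: r3
    obtain x y z where p: "p = (x, y, z)" by (cases p)
    have S: "sum f {(1, 0, 0), (0, 1, 0), (0, 0, 1) :: r3} = f (1, 0, 0) + f (0, 1, 0) + f (0, 0, 1)" for f :: "r3 \<Rightarrow> r3"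
      by (simp add: add.assoc)
    have c: "c (1, 0, 0) = s" "c (0, 1, 0) = inverse s" "c (0, 0, 1) = 1" by (simp_all add: c_def)
    show "mul g p = (a, b, u) + (\<Sum>j\<in>Basis. (c j * (p \<bullet> j)) *\<^sub>R j)"
      unfolding B S c p g mul_simp s_def[symmetric] es by simp
  qed
  have "c j \<noteq> 0" for j using s by (simp add: c_def)
  then have "lborel = density (distr lborel borel (mul g)) (\<lambda>_. (\<Prod>j\<in>Basis. \<bar>c j\<bar>))"
    unfolding mg by (rule lborel_affine_euclidean)
  moreover have "(\<Prod>j\<in>Basis. \<bar>c j\<bar>) = 1" unfolding B using s by (simp add: c_def)
  ultimately have "lborel = distr lborel borel (mul g)" by (simp add: density_1)
  moreover have "mul g \<in> borel_measurable borel"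
    using borel_measurable_continuous_onI[OF continuous_mul[OF continuous_on_const continuous_on_id], of g] by simp
  moreover have "distr lborel lborel (mul g) = distr lborel borel (mul g)" by (rule distr_cong) simp_all
  ultimately show ?thesis unfolding preserves_def by simp
qed

text \<open>A right translation shifts each coordinate by an amount that depends at most on
  \<open>u\<close>, so it is a composition of shears.\<close>

lemma preserves_mul_right: "preserves lborel (\<lambda>p. mul p g)"
proof -
  obtain a b u where g: "g = (a, b, u)" by (cases g)
  have 1: "preserves (lborel :: r3 measure) (\<lambda>(x, y). (x + exp (snd y * l1) * a, y))"
    by (rule preserves_shear_fst) (intro borel_measurable_continuous_onI continuous_intros)
  have 2: "preserves (lborel :: r3 measure) (\<lambda>(x, p). (x, (\<lambda>(y, v). (y + exp (v * l2) * b, v)) p))"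
  proof (rule preserves_skew)
    show "(\<lambda>(x, p). (\<lambda>(y, v). (y + exp (v * l2) * b, v)) p) \<in> borel_measurable (borel :: r3 measure)"
      unfolding split_beta' by (intro borel_measurable_continuous_onI continuous_intros)
  qed (rule preserves_shear_fst, intro borel_measurable_continuous_onI continuous_intros)
  have 3: "preserves (lborel :: r3 measure) (\<lambda>(x, p). (x, (\<lambda>(y, v). (y, v + u)) p))"
  proof (rule preserves_skew)
    show "(\<lambda>(x, p). (\<lambda>(y, v). (y, v + u)) p) \<in> borel_measurable (borel :: r3 measure)"
      unfolding split_beta' by (intro borel_measurable_continuous_onI continuous_intros)
  qed (rule preserves_shear_snd, simp)
  \<comment> \<open>The shift of \<open>u\<close> is applied last because the other two shears read
    the old value of \<open>u\<close>.\<close>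
  have "(\<lambda>p. mul p g) = (\<lambda>(x, p). (x, (\<lambda>(y, v). (y, v + u)) p)) \<circ> (\<lambda>(x, p). (x, (\<lambda>(y, v). (y + exp (v * l2) * b, v)) p)) \<circ> (\<lambda>(x, y). (x + exp (snd y * l1) * a, y))"
    by (auto simp: fun_eq_iff g mul_simp)
  then show ?thesis using preserves_comp[OF preserves_comp[OF 3 2] 1] by simp
qed

lemma mul_left_borel: "A \<in> sets borel \<Longrightarrow> mul g -` A \<in> sets borel"
  using measurable_sets_borel[of "mul g" borel A] preserves_mul_left[of g] by (simp add: preserves_def)

text \<open>Both sides are the sum over \<open>\<gamma>\<close> of the volumes of \<open>A \<inter> D \<inter> \<gamma>D'\<close>.\<close>

lemma fdom_emeasure_eq:
  assumes D: "fdom D" "fdom D'" and A: "A \<in> sets borel" and inv: "\<And>\<gamma> p. \<gamma> \<in> Gam3 \<Longrightarrow> mul \<gamma> p \<in> A \<longleftrightarrow> p \<in> A"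
  shows "emeasure lborel (D \<inter> A) = emeasure lborel (D' \<inter> A)"
proof -
  have DB: "D \<in> sets borel" "D' \<in> sets borel" using D by (auto simp: fdom_def)
  have free: "\<gamma> = \<gamma>'" if "mul \<gamma> p = mul \<gamma>' p" for \<gamma> \<gamma>' p
    using arg_cong[OF that, of "\<lambda>x. mul x (ivs p)"] by simp
  \<comment> \<open>Each point is moved into a fundamental domain by exactly one element of the
    group; uniqueness uses injectivity of \<open>quo\<close> on the domain together with freeness of
    the action.\<close>
  have part: "\<exists>!\<gamma>. \<gamma> \<in> Gam3 \<and> mul \<gamma> p \<in> E" if "fdom E" for E p
  proof -
    have "quo p \<in> quo ` E" using that by (auto simp: fdom_def)
    then obtain e where e: "e \<in> E" "quo p = quo e" by auto
    then obtain g where g: "g \<in> Gam3" "e = mul g p" by (auto simp: quo_eq_iff)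
    show ?thesis
    proof (rule ex1I[of _ g])
      show "g \<in> Gam3 \<and> mul g p \<in> E" using g e by simp
      fix h assume h: "h \<in> Gam3 \<and> mul h p \<in> E"
      then have "quo (mul h p) = quo (mul g p)" using g quo_mul_left by simp
      then have "mul h p = mul g p" using that h e(1) g(2) by (auto simp: fdom_def dest: inj_onD)
      then show "h = g" by (rule free)
    qed
  qed
  have sum: "emeasure lborel (E \<inter> A) = (\<integral>\<^sup>+\<gamma>. emeasure lborel (E \<inter> A \<inter> mul \<gamma> -` E') \<partial>count_space Gam3)"
    if E: "E \<in> sets borel" "E' \<in> sets borel" "fdom E'" for E E'
  proof -
    have "E \<inter> A = (\<Union>\<gamma>\<in>Gam3. E \<inter> A \<inter> mul \<gamma> -` E')"
    proof (intro equalityI subsetI)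
      fix p assume p: "p \<in> E \<inter> A"
      obtain g where "g \<in> Gam3" "mul g p \<in> E'" using ex1_implies_ex[OF part[OF E(3), of p]] by blast
      then show "p \<in> (\<Union>\<gamma>\<in>Gam3. E \<inter> A \<inter> mul \<gamma> -` E')" using p by auto
    qed auto
    also have "emeasure lborel \<dots> = (\<integral>\<^sup>+\<gamma>. emeasure lborel (E \<inter> A \<inter> mul \<gamma> -` E') \<partial>count_space Gam3)"
    proof (rule emeasure_UN_countable)
      show "disjoint_family_on (\<lambda>\<gamma>. E \<inter> A \<inter> mul \<gamma> -` E') Gam3"
      proof (unfold disjoint_family_on_def, intro ballI impI equals0I)
        fix g h p assume "g \<in> Gam3" "h \<in> Gam3" "g \<noteq> h" "p \<in> E \<inter> A \<inter> mul g -` E' \<inter> (E \<inter> A \<inter> mul h -` E')"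
        then show False using part[OF E(3), of p] by (metis IntD2 IntD1 vimageD)
      qed
    qed (use E A countable_Gam3 mul_left_borel in auto)
    finally show ?thesis .
  qed
  have "emeasure lborel (D \<inter> A) = (\<integral>\<^sup>+\<gamma>. emeasure lborel (D \<inter> A \<inter> mul \<gamma> -` D') \<partial>count_space Gam3)"
    by (rule sum) (use D DB in auto)
  also have "\<dots> = (\<integral>\<^sup>+\<gamma>. emeasure lborel (D' \<inter> A \<inter> mul (ivs \<gamma>) -` D) \<partial>count_space Gam3)"
  proof (rule nn_integral_cong)
    fix \<gamma> assume "\<gamma> \<in> space (count_space Gam3)"
    then have g: "\<gamma> \<in> Gam3" by simp
    \<comment> \<open>Left translation by \<gamma> preserves both Lebesgue measure and the invariant
      set \<open>A\<close>; replacing \<gamma> by its inverse afterwards exchanges the roles of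
      \<open>D\<close> and \<open>D'\<close>.\<close>
    have "D \<inter> A \<inter> mul \<gamma> -` D' = mul \<gamma> -` (D' \<inter> A \<inter> mul (ivs \<gamma>) -` D)"
      by (rule Set.set_eqI) (simp add: inv[OF g] conj_ac)
    then show "emeasure lborel (D \<inter> A \<inter> mul \<gamma> -` D') = emeasure lborel (D' \<inter> A \<inter> mul (ivs \<gamma>) -` D)"
      using preserves_emeasure[OF preserves_mul_left, of "D' \<inter> A \<inter> mul (ivs \<gamma>) -` D" \<gamma>] DB A mul_left_borel by simp
  qed
  also have "\<dots> = (\<integral>\<^sup>+\<gamma>. emeasure lborel (D' \<inter> A \<inter> mul \<gamma> -` D) \<partial>count_space Gam3)"
  proof -
    have bij: "bij_betw ivs Gam3 Gam3"
    proof (rule bij_betw_byWitness[of _ ivs])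
      have "ivs (ivs p) = p" for p by (cases p) (simp add: ivs_def mult.assoc[symmetric] flip: exp_add)
      then show "\<forall>a\<in>Gam3. ivs (ivs a) = a" "\<forall>a\<in>Gam3. ivs (ivs a) = a" by auto
    qed (auto simp: Gam3_ivs)
    show ?thesis by (rule nn_integral_bij_count_space[OF bij, of "\<lambda>\<gamma>. emeasure lborel (D' \<inter> A \<inter> mul \<gamma> -` D)"])
  qed
  also have "\<dots> = emeasure lborel (D' \<inter> A)"
    by (rule sum[symmetric]) (use D DB in auto)
  finally show ?thesis .
qed

abbreviation "NM \<equiv> Nmeasure 2 Lop golden_lattice"

lemma sets_NM [simp]: "sets NM = sets NB" by (simp add: Nmeasure_def)
lemma space_NM [simp]: "space NM = range quo" by (simp add: Nmeasure_def topspace_NT)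

text \<open>The definition of the measure picks an unspecified fundamental domain. \<open>D0\<close>
  shows that there is one, and the independence of the choice allows any other to be
  substituted.\<close>

lemma emeasure_NM:
  assumes A: "A \<in> sets NB" and D: "fdom D"
  shows "emeasure NM A = emeasure lborel (D \<inter> quo -` A)"
proof -
  define E where "E = (SOME D. fundamental_domain 2 Lop golden_lattice D)"
  have "fundamental_domain 2 Lop golden_lattice (Jm ` D0)"
    using fdom_D0 by (simp add: fundamental_domain_iff inj_vimage_image_eq[OF inj_Jm] image_mono)
  then have E: "fundamental_domain 2 Lop golden_lattice E" unfolding E_def by (rule someI)
  then have E': "E \<subseteq> range Jm" "fdom (Jm -` E)" by (auto simp: fundamental_domain_iff)
  have Es: "E \<in> sets (Emeasure 2)" using E by (simp add: fundamental_domain_def)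
  have Emsr: "coset_proj 2 Lop golden_lattice \<in> measurable (Emeasure 2) NB"
  proof -
    have "(\<lambda>x. quo (Jinv x)) \<in> measurable (Emeasure 2) NB"
      by (rule measurable_compose[OF Jinv_measurable quo_measurable])
    then show ?thesis
      by (rule measurable_cong[THEN iffD1, rotated]) (simp add: quo_def space_Emeasure Jm_Jinv)
  qed
  have m: "coset_proj 2 Lop golden_lattice \<in> measurable (restrict_space (Emeasure 2) E) NB"
    by (rule measurable_restrict_space1[OF Emsr])
  let ?P = "coset_proj 2 Lop golden_lattice -` A \<inter> E"
  have EE: "E \<subseteq> space (Emeasure 2)" using Es by (rule sets.sets_into_space)
  have P: "?P \<in> sets (Emeasure 2)"
  proof -
    have "coset_proj 2 Lop golden_lattice -` A \<inter> space (Emeasure 2) \<inter> E \<in> sets (Emeasure 2)"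
      using measurable_sets[OF Emsr A] Es by blast
    moreover have "coset_proj 2 Lop golden_lattice -` A \<inter> space (Emeasure 2) \<inter> E = ?P" using EE by auto
    ultimately show ?thesis by simp
  qed
  have "emeasure NM A = emeasure (restrict_space (Emeasure 2) E) (coset_proj 2 Lop golden_lattice -` A \<inter> space (restrict_space (Emeasure 2) E))"
    unfolding Nmeasure_def E_def[symmetric] by (rule emeasure_distr[OF m A])
  also have "space (restrict_space (Emeasure 2) E) = E" using EE by (auto simp: space_restrict_space)
  also have "emeasure (restrict_space (Emeasure 2) E) ?P = emeasure (Emeasure 2) ?P"
    by (rule emeasure_restrict_space) (use Es in auto)
  also have "\<dots> = emeasure lborel (Jm -` ?P)" by (rule emeasure_Emeasure[OF P])
  also have "Jm -` ?P = Jm -` E \<inter> quo -` A" by (auto simp: quo_def)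
  also have "emeasure lborel (Jm -` E \<inter> quo -` A) = emeasure lborel (D \<inter> quo -` A)"
    by (rule fdom_emeasure_eq[OF E'(2) D]) (use A quo_mul_left in \<open>auto simp: sets_NB_iff\<close>)
  finally show ?thesis .
qed

text \<open>Right translations commute with the left action of the lattice subgroup.\<close>

lemma fdom_mul_right: "fdom D \<Longrightarrow> fdom ((\<lambda>p. mul p g) -` D)"
  unfolding fdom_def
proof (elim conjE, intro conjI)
  assume D: "D \<in> sets borel" "inj_on quo D" "quo ` D = range quo"
  show "(\<lambda>p. mul p g) -` D \<in> sets borel"
    using measurable_sets_borel[of "\<lambda>p. mul p g" borel D] preserves_mul_right[of g] D(1) by (simp add: preserves_def)
  show "inj_on quo ((\<lambda>p. mul p g) -` D)"
  proof (rule inj_onI)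
    fix p q assume "p \<in> (\<lambda>p. mul p g) -` D" "q \<in> (\<lambda>p. mul p g) -` D" "quo p = quo q"
    moreover from this have "quo (mul p g) = quo (mul q g)" by (metis quo_mul)
    ultimately have "mul p g = mul q g" using D(2) by (auto dest: inj_onD)
    then show "p = q" by (metis mul_ivs_cancel_right(1))
  qed
  show "quo ` (\<lambda>p. mul p g) -` D = range quo"
  proof -
    have "quo p \<in> quo ` (\<lambda>p. mul p g) -` D" for p
    proof -
      have "quo (mul p g) \<in> quo ` D" using D(3) by simp
      then obtain d where d: "d \<in> D" "quo (mul p g) = quo d" by auto
      then have "quo p = quo (mul d (ivs g))" by (metis quo_mul mul_ivs_cancel_right(1))
      then show ?thesis using d by (auto intro!: image_eqI[of _ _ "mul d (ivs g)"])
    qed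
    then show ?thesis by auto
  qed
qed

text \<open>A Borel section of the quotient map; it turns maps on cosets into maps on points, both
  for measurability and for the partition of the entropy argument.\<close>

definition sec :: "(rvec \<times> real) set \<Rightarrow> r3" where "sec = inv_into D0 quo"

lemma sec: "C \<in> range quo \<Longrightarrow> sec C \<in> D0" "C \<in> range quo \<Longrightarrow> quo (sec C) = C"
  using fdom_D0 unfolding fdom_def sec_def by (metis inv_into_into, metis f_inv_into_f)

lemma sec_quo: "p \<in> D0 \<Longrightarrow> sec (quo p) = p"
  using fdom_D0 unfolding fdom_def sec_def by simp

lemma sec_measurable: "sec \<in> measurable NB borel"
proof (rule measurableI)
  fix B :: "r3 set" assume B: "B \<in> sets borel"
  have "sec -` B \<inter> space NB = quo ` (B \<inter> D0)"
  proof (intro equalityI subsetI)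
    fix C assume "C \<in> sec -` B \<inter> space NB"
    then have "sec C \<in> B \<inter> D0" "quo (sec C) = C" using sec[of C] by (auto simp: topspace_NT)
    then show "C \<in> quo ` (B \<inter> D0)" by (metis imageI)
  next
    fix C assume "C \<in> quo ` (B \<inter> D0)"
    then show "C \<in> sec -` B \<inter> space NB" using sec_quo by (auto simp: topspace_NT)
  qed
  then show "sec -` B \<inter> space NB \<in> sets NB"
    using quo_image_borel[OF sets.Int, of B D0] B fdom_D0 by (simp add: fdom_def)
qed simp

lemma D0_bounded: "D0 \<subseteq> cbox (-3, -3, 0) (3, 3, 1)"
proof
  fix p assume p: "p \<in> D0"
  obtain a b u where pe: "p = (a, b, u)" by (cases p)
  have c: "0 \<le> coord_m a b" "coord_m a b \<le> 1" "0 \<le> coord_n a b" "coord_n a b \<le> 1" "0 \<le> u" "u \<le> 1" using p by (auto simp: D0_def pe)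
  have "sqrt 5 \<le> 3" by (rule real_le_lsqrt) simp_all
  moreover have "1 \<le> sqrt 5" by (rule real_le_rsqrt) simp
  moreover have "2 * t1 = 1 - sqrt 5" "2 * t2 = 1 + sqrt 5" by (simp_all add: t1_def t2_def)
  ultimately have t: "\<bar>t1\<bar> \<le> 2" "\<bar>t2\<bar> \<le> 2" by - linarith+
  have "\<bar>coord_n a b * t\<bar> \<le> 2" if "\<bar>t\<bar> \<le> 2" for t
    using mult_mono[of "\<bar>coord_n a b\<bar>" 1 "\<bar>t\<bar>" 2] c that by (simp add: abs_mult)
  from this[OF t(1)] this[OF t(2)] have "\<bar>a\<bar> \<le> 3" "\<bar>b\<bar> \<le> 3"
    using coord_inverse[where a = a and b = b] c(1,2) by - linarith+
  then show "p \<in> cbox (-3, -3, 0) (3, 3, 1)" using c unfolding pe by auto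
qed

lemma finite_measure_NM: "finite_measure NM"
proof (rule finite_measureI)
  have "emeasure NM (space NM) \<le> emeasure lborel (cbox (-3, -3, 0) (3, 3, 1) :: r3 set)"
    using D0_bounded by (subst emeasure_NM[OF _ fdom_D0]) (auto intro!: emeasure_mono sets.top[of NM, simplified])
  also have "\<dots> < \<infinity>" by (intro emeasure_bounded_finite) simp
  finally show "emeasure NM (space NM) \<noteq> \<infinity>" by simp
qed

text \<open>The measure of the preimage is computed on the translated domain and that of the set
  itself on \<open>D0\<close>; the translation carries one region onto the other and preserves
  volume, so no pieces have to be rearranged.\<close>

lemma NM_mul_right:
  shows "(\<lambda>C. C #>\<^bsub>LG\<^esub> Jm g) \<in> measurable NM NM" "distr NM NM (\<lambda>C. C #>\<^bsub>LG\<^esub> Jm g) = NM"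
proof -
  have *: "(\<lambda>C. quo (mul (sec C) g)) \<in> measurable NB NB"
    using measurable_compose[OF sec_measurable measurable_compose[OF _ quo_measurable], of "\<lambda>p. mul p g"]
      preserves_mul_right[of g] by (simp add: preserves_def)
  have eq: "C #>\<^bsub>LG\<^esub> Jm g = quo (mul (sec C) g)" if "C \<in> range quo" for C
    using quo_mul[of "sec C" g] sec(2)[OF that] by simp
  have "(\<lambda>C. C #>\<^bsub>LG\<^esub> Jm g) \<in> measurable NB NB"
    using * by (rule measurable_cong[THEN iffD1, rotated]) (simp add: eq topspace_NT)
  then show m: "(\<lambda>C. C #>\<^bsub>LG\<^esub> Jm g) \<in> measurable NM NM"
    using measurable_cong_sets[of NM NB NM NB] by simp
  show "distr NM NM (\<lambda>C. C #>\<^bsub>LG\<^esub> Jm g) = NM"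
  proof (rule measure_eqI)
    fix A assume "A \<in> sets (distr NM NM (\<lambda>C. C #>\<^bsub>LG\<^esub> Jm g))"
    then have A: "A \<in> sets NB" by simp
    let ?B = "(\<lambda>C. C #>\<^bsub>LG\<^esub> Jm g) -` A \<inter> range quo"
    have B: "?B \<in> sets NB" using measurable_sets[OF m, of A] A by simp
    have qB: "quo -` ?B = (\<lambda>p. mul p g) -` (quo -` A)" by (auto simp: quo_mul)
    have "emeasure (distr NM NM (\<lambda>C. C #>\<^bsub>LG\<^esub> Jm g)) A = emeasure NM ?B"
      using emeasure_distr[OF m, of A] A by simp
    also have "\<dots> = emeasure lborel ((\<lambda>p. mul p g) -` D0 \<inter> quo -` ?B)"
      by (rule emeasure_NM[OF B fdom_mul_right[OF fdom_D0]])
    also have "\<dots> = emeasure lborel ((\<lambda>p. mul p g) -` (D0 \<inter> quo -` A))" unfolding qB by simp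
    also have "\<dots> = emeasure lborel (D0 \<inter> quo -` A)"
    proof -
      have "D0 \<inter> quo -` A \<in> sets lborel" using fdom_D0 A by (auto simp: fdom_def sets_NB_iff)
      from preserves_emeasure[OF preserves_mul_right this, of g] show ?thesis by simp
    qed
    also have "\<dots> = emeasure NM A" by (rule emeasure_NM[OF A fdom_D0, symmetric])
    finally show "emeasure (distr NM NM (\<lambda>C. C #>\<^bsub>LG\<^esub> Jm g)) A = emeasure NM A" .
  qed simp
qed

section \<open>The sphere measure in coordinates\<close>

abbreviation "SM \<equiv> Smeasure 2"

lemma Enorm_Jm: "Enorm 2 (Jm p) = norm p"
  by (cases p) (simp add: Enorm_def Jm_simp vinner_vec2 norm_r3 power2_eq_square)

lemma Sph_eq: "Sph 2 = Jm ` S2"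
proof (intro equalityI subsetI)
  fix z assume z: "z \<in> Sph 2"
  then obtain v e where ve: "z = (v, e)" "v \<in> Rn 2" "vinner 2 v v + e\<^sup>2 = 1" by (auto simp: Sph_def)
  then have "v = vec2 (v 0) (v 1)" using Rn2_vec2 by blast
  then obtain a b where "v = vec2 a b" by blast
  then show "z \<in> Jm ` S2" using ve by (auto simp: vinner_vec2 Jm_simp power2_eq_square intro!: image_eqI[of _ _ "(a, b, e)"])
qed (auto simp: Sph_def Jm_simp vinner_vec2 power2_eq_square)

lemma Jm_normalize:
  "(vscale 2 (1 / Enorm 2 (Jm p)) (fst (Jm p)), snd (Jm p) / Enorm 2 (Jm p)) = Jm (sgn p)"
  unfolding Enorm_Jm by (cases p) (simp add: Jm_simp vscale_vec2 sgn_div_norm divide_inverse mult.commute)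

lemma Sph_sets: "Sph 2 \<in> sets (Emeasure 2)"
  unfolding Sph_eq sets_Emeasure_iff using S2_borel by (auto simp: inj_vimage_image_eq[OF inj_Jm])

lemma sets_SM: "A \<in> sets SM \<longleftrightarrow> A \<subseteq> Jm ` S2 \<and> Jm -` A \<in> sets borel"
proof -
  have "A \<in> sets SM \<longleftrightarrow> A \<in> sets (restrict_space (Emeasure 2) (Sph 2))" by (simp add: Smeasure_def)
  also have "\<dots> \<longleftrightarrow> A \<subseteq> Sph 2 \<and> A \<in> sets (Emeasure 2)"
    using Sph_sets sets.sets_into_space[OF Sph_sets] by (subst sets_restrict_space_iff) (auto simp: Int_absorb2)
  finally show ?thesis by (auto simp: Sph_eq sets_Emeasure_iff)
qed

lemma space_SM [simp]: "space SM = Jm ` S2"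
  using Sph_sets sets.sets_into_space[OF Sph_sets] by (simp add: Smeasure_def space_scale_measure space_restrict_space Sph_eq Int_absorb2)

text \<open>The factor \<open>3\<close> is \<open>n + 1\<close> for \<open>n = 2\<close>. The rest
  identifies the normalisation map of the polar coordinates with \<open>sgn\<close> under
  \<open>Jm\<close>, so invariance of the cone measure carries over.\<close>

lemma emeasure_SM:
  assumes A: "A \<in> sets SM"
  shows "emeasure SM A = 3 * emeasure cone_measure (Jm -` A)"
proof -
  let ?B = "{p. 0 < Enorm 2 p \<and> Enorm 2 p \<le> 1} \<inter> range Jm"
  let ?f = "\<lambda>p. (vscale 2 (1 / Enorm 2 p) (fst p), snd p / Enorm 2 p)"
  have Jp: "Jm -` {p. 0 < Enorm 2 p \<and> Enorm 2 p \<le> 1} = cball 0 1 - {0}" by (auto simp: Enorm_Jm)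
  have sp: "space (restrict_space (Emeasure 2) {p. 0 < Enorm 2 p \<and> Enorm 2 p \<le> 1}) = ?B"
    by (auto simp: space_restrict_space space_Emeasure range_Jm)
  have B: "?B \<in> sets (Emeasure 2)" 
  proof -
    have "Jm -` range Jm = UNIV" by blast
    then have "Jm -` ?B = cball 0 1 - {0}" unfolding vimage_Int Jp by simp
    then show ?thesis unfolding sets_Emeasure_iff by simp
  qed
  have "(\<lambda>p. Jm (sgn (Jinv p))) \<in> measurable (Emeasure 2) (Emeasure 2)"
  proof -
    have "(sgn :: r3 \<Rightarrow> r3) \<in> borel_measurable borel"
    proof -
      have "(\<lambda>x::r3. inverse (norm x) *\<^sub>R x) \<in> borel_measurable borel" by measurable
      then show ?thesis by (simp add: sgn_div_norm)
    qed
    from measurable_compose[OF Jinv_measurable measurable_compose[OF this Jm_measurable]] show ?thesis .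
  qed
  then have f: "?f \<in> measurable (Emeasure 2) (Emeasure 2)"
  proof (rule measurable_cong[THEN iffD1, rotated])
    fix x assume "x \<in> space (Emeasure 2)"
    then obtain q where "x = Jm q" using range_Jm unfolding space_Emeasure by blast
    then show "Jm (sgn (Jinv x)) = ?f x" by (simp only: Jm_normalize Jinv_Jm)
  qed
  have fs: "?f p \<in> Sph 2" if p': "p \<in> ?B" for p
  proof -
    have p: "0 < Enorm 2 p" "p \<in> range Jm" using p' by simp_all
    then obtain q where q: "p = Jm q" by blast
    have "q \<noteq> 0" using p(1) unfolding q Enorm_Jm by simp
    then show ?thesis unfolding q Jm_normalize Sph_eq by (simp add: S2_eq_sphere norm_sgn)
  qed
  have m: "?f \<in> measurable (restrict_space (Emeasure 2) {p. 0 < Enorm 2 p \<and> Enorm 2 p \<le> 1}) (restrict_space (Emeasure 2) (Sph 2))"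
    by (rule measurable_restrict_space2) (use fs in \<open>unfold sp, blast\<close>, rule measurable_restrict_space1[OF f])
  have A': "A \<in> sets (restrict_space (Emeasure 2) (Sph 2))" using A by (simp add: Smeasure_def)
  have JA: "Jm -` A \<in> sets borel" "Jm -` A \<subseteq> S2" using A by (auto simp: sets_SM)
  let ?P = "?f -` A \<inter> ?B"
  have "emeasure SM A = 3 * emeasure (restrict_space (Emeasure 2) {p. 0 < Enorm 2 p \<and> Enorm 2 p \<le> 1}) ?P"
    unfolding Smeasure_def emeasure_scale_measure emeasure_distr[OF m A'] sp by simp
  also have "emeasure (restrict_space (Emeasure 2) {p. 0 < Enorm 2 p \<and> Enorm 2 p \<le> 1}) ?P = emeasure (Emeasure 2) ?P"
  proof (rule emeasure_restrict_space)
    have "{p. 0 < Enorm 2 p \<and> Enorm 2 p \<le> 1} \<inter> space (Emeasure 2) = ?B" by (auto simp: space_Emeasure range_Jm)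
    then show "{p. 0 < Enorm 2 p \<and> Enorm 2 p \<le> 1} \<inter> space (Emeasure 2) \<in> sets (Emeasure 2)" using B by simp
  qed auto
  also have "\<dots> = emeasure lborel (Jm -` ?P)"
  proof (rule emeasure_Emeasure)
    have "A \<in> sets (Emeasure 2)" using A by (auto simp: sets_SM sets_Emeasure_iff)
    from sets.Int[OF measurable_sets[OF f this] B]
    have "?f -` A \<inter> space (Emeasure 2) \<inter> ?B \<in> sets (Emeasure 2)" .
    moreover have "?f -` A \<inter> space (Emeasure 2) \<inter> ?B = ?P" unfolding space_Emeasure range_Jm by blast
    ultimately show "?P \<in> sets (Emeasure 2)" by simp
  qed
  also have "Jm -` ?P = {p \<in> cball 0 1 - {0}. sgn p \<in> Jm -` A}"
  proof -
    have "Jm -` ?P = {p \<in> Jm -` {p. 0 < Enorm 2 p \<and> Enorm 2 p \<le> 1}. ?f (Jm p) \<in> A}" by blast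
    then show ?thesis unfolding Jm_normalize Jp vimage_eq .
  qed
  also have "emeasure lborel \<dots> = emeasure cone_measure (Jm -` A)"
    by (rule emeasure_cone_measure[OF JA, symmetric])
  finally show ?thesis .
qed

lemma finite_measure_SM: "finite_measure SM"
proof (rule finite_measureI)
  have "emeasure SM (space SM) = 3 * emeasure cone_measure (Jm -` space SM)"
    by (rule emeasure_SM[OF sets.top])
  also have "\<dots> \<noteq> \<infinity>" using finite_measure.emeasure_finite[OF finite_measure_cone] by (simp add: ennreal_mult_eq_top_iff)
  finally show "emeasure SM (space SM) \<noteq> \<infinity>" .
qed

definition sflow :: "real \<Rightarrow> rvec \<times> real \<Rightarrow> rvec \<times> real" where "sflow t z = Jm (euler_flow t (Jinv z))"

lemma Jinv_measurable_SM: "Jinv \<in> measurable SM cone_measure"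
proof (rule measurableI)
  show "Jinv x \<in> space cone_measure" if "x \<in> space SM" for x using that by auto
  fix A assume "A \<in> sets cone_measure"
  then have A: "A \<in> sets borel" "A \<subseteq> S2" by (auto simp: sets_restrict_S2)
  have "Jinv -` A \<inter> space SM = Jm ` A" using A(2) by auto
  then show "Jinv -` A \<inter> space SM \<in> sets SM" using A by (auto simp: sets_SM inj_vimage_image_eq[OF inj_Jm])
qed

lemma preserves_sflow: "preserves SM (sflow t)"
  unfolding preserves_def
proof
  have ef: "euler_flow t \<in> measurable cone_measure cone_measure" by (rule euler_flow_measurable)
  show m: "sflow t \<in> measurable SM SM"
  proof (rule measurableI)
    show "sflow t x \<in> space SM" if "x \<in> space SM" for x using that by (auto simp: sflow_def euler_flow_in_S2)
    fix A assume A: "A \<in> sets SM"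
    then have "Jm -` A \<in> sets cone_measure" by (auto simp: sets_SM sets_restrict_S2)
    from measurable_sets[OF Jinv_measurable_SM measurable_sets[OF ef this]]
    have "Jinv -` (euler_flow t -` (Jm -` A) \<inter> S2) \<inter> space SM \<in> sets SM" by simp
    moreover have "Jinv -` (euler_flow t -` (Jm -` A) \<inter> S2) \<inter> space SM = sflow t -` A \<inter> space SM"
      by (rule Set.set_eqI) (auto simp: sflow_def simp del: split_paired_All)
    ultimately show "sflow t -` A \<inter> space SM \<in> sets SM" by simp
  qed
  show "distr SM SM (sflow t) = SM"
  proof (rule measure_eqI)
    fix A assume "A \<in> sets (distr SM SM (sflow t))"
    then have A: "A \<in> sets SM" by simp
    have JA: "Jm -` A \<in> sets cone_measure" using A by (auto simp: sets_SM sets_restrict_S2)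
    have P: "sflow t -` A \<inter> space SM \<in> sets SM" using measurable_sets[OF m A] .
    have "emeasure (distr SM SM (sflow t)) A = emeasure SM (sflow t -` A \<inter> space SM)" by (rule emeasure_distr[OF m A])
    also have "\<dots> = 3 * emeasure cone_measure (Jm -` (sflow t -` A \<inter> space SM))" by (rule emeasure_SM[OF P])
    also have "Jm -` (sflow t -` A \<inter> space SM) = euler_flow t -` (Jm -` A) \<inter> space cone_measure"
      by (rule Set.set_eqI) (simp add: sflow_def image_iff)
    also have "emeasure cone_measure \<dots> = emeasure cone_measure (Jm -` A)" by (rule preserves_emeasure[OF preserves_euler_flow JA])
    also have "3 * \<dots> = emeasure SM A" by (rule emeasure_SM[OF A, symmetric])
    finally show "emeasure (distr SM SM (sflow t)) A = emeasure SM A" .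
  qed simp
qed

section \<open>The flow as a skew product\<close>

text \<open>The group component of the solution over \<open>p\<close> that starts at the identity.
  By left invariance the solution through \<open>g\<close> over \<open>p\<close> is
  \<open>mul g (cocycle t p)\<close>.\<close>

definition cocycle :: "real \<Rightarrow> r3 \<Rightarrow> r3" where
  "cocycle t p = (fibre1 l1 p t, fibre2 l2 p t, drift p t)"

lemma zero_deriv_const:
  fixes f :: "real \<Rightarrow> real"
  assumes "\<And>t. (f has_real_derivative 0) (at t)"
  shows "f t = f 0"
proof (rule zero_deriv_eq_at_0)
  show "t \<in> {-\<bar>t\<bar>-1<..<\<bar>t\<bar>+1}" "0 \<in> {-\<bar>t\<bar>-1<..<\<bar>t\<bar>+1}" by auto
qed (rule assms)

lemma same_deriv_eq:
  fixes f g :: "real \<Rightarrow> real"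
  assumes "\<And>t. (f has_real_derivative d t) (at t)" "\<And>t. (g has_real_derivative d t) (at t)"
  shows "f t = f 0 + (g t - g 0)"
  using zero_deriv_const[of "\<lambda>t. f t - g t" t] DERIV_diff[OF assms] by simp

text \<open>The system is triangular: the sphere part is autonomous and unique, then
  \<open>u\<close> is an integral of \<eta>, and then \<open>w\<close> is an integral of known
  functions.\<close>

lemma LF_solution_flow:
  assumes sol: "LF_solution 2 Lop Fop w u \<xi> \<eta>" and p: "p \<in> S2" and 0: "(\<xi> 0, \<eta> 0) = Jm p"
  shows "(\<xi> t, \<eta> t) = Jm (euler_flow t p)" "(w t, u t) = Jm (mul (Jinv (w 0, u 0)) (cocycle t p))"
proof -
  have R: "w t \<in> Rn 2" "\<xi> t \<in> Rn 2" for t using sol by (auto simp: LF_solution_def)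
  define x y where "x = (\<lambda>t. \<xi> t 0)" and "y = (\<lambda>t. \<xi> t 1)"
  define a b where "a = (\<lambda>t. w t 0)" and "b = (\<lambda>t. w t 1)"
  have xi: "\<xi> t = vec2 (x t) (y t)" for t using Rn2_vec2[OF R(2)] by (simp add: x_def y_def)
  have w: "w t = vec2 (a t) (b t)" for t using Rn2_vec2[OF R(1)] by (simp add: a_def b_def)
  have d: "(\<forall>i<2. ((\<lambda>s. \<xi> s i) has_real_derivative \<eta> t * Fop (\<xi> t) i) (at t))"
    "(\<eta> has_real_derivative - vinner 2 (Fop (\<xi> t)) (\<xi> t)) (at t)"
    "(\<forall>i<2. ((\<lambda>s. w s i) has_real_derivative exp_op 2 Lop (u t) (\<xi> t) i) (at t))"
    "(u has_real_derivative \<eta> t) (at t)" for t using sol by (auto simp: LF_solution_def)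
  have dx: "(x has_real_derivative - 2 * \<eta> t * y t) (at t)" "(y has_real_derivative \<eta> t * x t) (at t)" for t
    using d(1)[of t, rule_format, of 0] d(1)[of t, rule_format, of 1]
    unfolding xi Fop_vec2 by (simp_all add: mult.commute mult.left_commute)
  have de: "(\<eta> has_real_derivative x t * y t) (at t)" for t
    using d(2)[of t] unfolding xi Fop_vec2 vinner_vec2 by (simp add: mult.commute)
  have dw: "(a has_real_derivative exp (u t * l1) * x t) (at t)" "(b has_real_derivative exp (u t * l2) * y t) (at t)" for t
    using d(3)[of t, rule_format, of 0] d(3)[of t, rule_format, of 1] unfolding w xi exp_op_vec2 by simp_all
  have es: "euler_sol UNIV x y \<eta>" using dx de by (simp add: euler_sol_def)
  have p0: "p = (x 0, y 0, \<eta> 0)" using 0 unfolding xi by (cases p) (simp add: Jm_simp)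
  have fl: "euler_flow t p = (x t, y t, \<eta> t)" for t
    using euler_flow_unique[OF es, of 0 t] p unfolding p0 by simp
  then show "(\<xi> t, \<eta> t) = Jm (euler_flow t p)" by (simp add: Jm_simp xi)
  have comp: "euler_x p = x" "euler_y p = y" "euler_e p = \<eta>" using fl by (auto simp: euler_flow_def fun_eq_iff)
  have U: "u t = u 0 + drift p t" for t
    using same_deriv_eq[of u \<eta> "drift p" t] d(4) drift[OF p] unfolding comp by simp
  have A: "a t = a 0 + exp (u 0 * l1) * fibre1 l1 p t"
  proof -
    have "((\<lambda>t. exp (u 0 * l1) * fibre1 l1 p t) has_real_derivative exp (u t * l1) * x t) (at t)" for t
      by (rule derivative_eq_intros fibre1(2)[OF p] refl)+ (simp add: comp U[of t] ring_distribs exp_add mult_ac)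
    from same_deriv_eq[OF dw(1) this, of t] fibre1(1)[OF p] show ?thesis by simp
  qed
  have B: "b t = b 0 + exp (u 0 * l2) * fibre2 l2 p t"
  proof -
    have "((\<lambda>t. exp (u 0 * l2) * fibre2 l2 p t) has_real_derivative exp (u t * l2) * y t) (at t)" for t
      by (rule derivative_eq_intros fibre2(2)[OF p] refl)+ (simp add: comp U[of t] ring_distribs exp_add mult_ac)
    from same_deriv_eq[OF dw(2) this, of t] fibre2(1)[OF p] show ?thesis by simp
  qed
  show "(w t, u t) = Jm (mul (Jinv (w 0, u 0)) (cocycle t p))"
    unfolding w using A B U[of t] by (simp add: Jinv_def cocycle_def mul_simp Jm_simp)
qed

lemma LF_solution_exists:
  assumes p: "p \<in> S2"
  shows "LF_solution 2 Lop Fop (\<lambda>t. fst (Jm (mul g (cocycle t p)))) (\<lambda>t. snd (Jm (mul g (cocycle t p))))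
    (\<lambda>t. fst (Jm (euler_flow t p))) (\<lambda>t. snd (Jm (euler_flow t p)))"
proof -
  obtain a b u where g: "g = (a, b, u)" by (cases g)
  note d = euler_curve_deriv[OF p] drift(2)[OF p] fibre1(2)[OF p] fibre2(2)[OF p]
  show ?thesis
    unfolding LF_solution_def
  proof (intro allI conjI impI)
    fix t
    show "fst (Jm (mul g (cocycle t p))) \<in> Rn 2" "fst (Jm (euler_flow t p)) \<in> Rn 2"
      by (simp_all add: g cocycle_def mul_simp Jm_simp euler_flow_def)
    show "((\<lambda>t. snd (Jm (mul g (cocycle t p)))) has_real_derivative snd (Jm (euler_flow t p))) (at t)"
      by (auto simp: g cocycle_def mul_simp Jm_simp euler_flow_def intro!: derivative_eq_intros d)
    show "((\<lambda>t. snd (Jm (euler_flow t p))) has_real_derivative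
          - vinner 2 (Fop (fst (Jm (euler_flow t p)))) (fst (Jm (euler_flow t p)))) (at t)"
      by (auto simp: Jm_simp euler_flow_def Fop_vec2 vinner_vec2 intro!: derivative_eq_intros d)
    fix i :: nat assume i: "i < 2"
    show "((\<lambda>s. fst (Jm (euler_flow s p)) i) has_real_derivative
         snd (Jm (euler_flow t p)) * Fop (fst (Jm (euler_flow t p))) i) (at t)"
      using i d[of t] by (auto simp: less2 Jm_simp euler_flow_def Fop_vec2 mult.commute mult.left_commute)
    have "((\<lambda>s. a + exp (u * l1) * fibre1 l1 p s) has_real_derivative exp ((u + drift p t) * l1) * euler_x p t) (at t)"
      by (rule derivative_eq_intros d refl)+ (simp add: ring_distribs exp_add mult_ac)
    moreover have "((\<lambda>s. b + exp (u * l2) * fibre2 l2 p s) has_real_derivative exp ((u + drift p t) * l2) * euler_y p t) (at t)"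
      by (rule derivative_eq_intros d refl)+ (simp add: ring_distribs exp_add mult_ac)
    ultimately show "((\<lambda>s. fst (Jm (mul g (cocycle s p))) i) has_real_derivative
         exp_op 2 Lop (snd (Jm (mul g (cocycle t p)))) (fst (Jm (euler_flow t p))) i) (at t)"
      using i by (auto simp: less2 g cocycle_def mul_simp Jm_simp euler_flow_def exp_op_vec2)
  qed
qed

lemma cocycle_0: "p \<in> S2 \<Longrightarrow> cocycle 0 p = (0, 0, 0)"
  by (simp add: cocycle_def drift fibre1 fibre2)

abbreviation "flow \<equiv> SNflow 2 Lop Fop golden_lattice"

text \<open>The definite description is legitimate because two lifts of the same coset differ by a
  left translation from the lattice subgroup, which commutes with right multiplication by the
  cocycle.\<close>

lemma flow_eq:
  assumes p: "p \<in> S2"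
  shows "flow t (quo g, Jm p) = (quo (mul g (cocycle t p)), Jm (euler_flow t p))"
  unfolding SNflow_def
proof (rule the_equality)
  let ?w = "\<lambda>t. fst (Jm (mul g (cocycle t p)))" and ?u = "\<lambda>t. snd (Jm (mul g (cocycle t p)))"
    and ?x = "\<lambda>t. fst (Jm (euler_flow t p))" and ?e = "\<lambda>t. snd (Jm (euler_flow t p))"
  have "LF_solution 2 Lop Fop ?w ?u ?x ?e" by (rule LF_solution_exists[OF p])
  then show "\<exists>w u \<xi> \<eta>. LF_solution 2 Lop Fop w u \<xi> \<eta> \<and>
       (quo g, Jm p) = (coset_proj 2 Lop golden_lattice (w 0, u 0), \<xi> 0, \<eta> 0) \<and>
       (quo (mul g (cocycle t p)), Jm (euler_flow t p)) = (coset_proj 2 Lop golden_lattice (w t, u t), \<xi> t, \<eta> t)"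
    by (intro exI[of _ ?w] exI[of _ ?u] exI[of _ ?x] exI[of _ ?e]) (simp add: cocycle_0[OF p] p flip: quo_def)
next
  fix q assume "\<exists>w u \<xi> \<eta>. LF_solution 2 Lop Fop w u \<xi> \<eta> \<and>
       (quo g, Jm p) = (coset_proj 2 Lop golden_lattice (w 0, u 0), \<xi> 0, \<eta> 0) \<and>
       q = (coset_proj 2 Lop golden_lattice (w t, u t), \<xi> t, \<eta> t)"
  then obtain w u \<xi> \<eta> where sol: "LF_solution 2 Lop Fop w u \<xi> \<eta>"
    and g: "quo g = coset_proj 2 Lop golden_lattice (w 0, u 0)" and pe: "(\<xi> 0, \<eta> 0) = Jm p"
    and q: "q = (coset_proj 2 Lop golden_lattice (w t, u t), \<xi> t, \<eta> t)" by auto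
  have "w 0 \<in> Rn 2" using sol by (auto simp: LF_solution_def)
  then have J: "Jm (Jinv (w 0, u 0)) = (w 0, u 0)" by (intro Jm_Jinv) simp
  then have "quo g = quo (Jinv (w 0, u 0))" using g by (simp add: quo_def)
  then have "quo (mul g (cocycle t p)) = quo (mul (Jinv (w 0, u 0)) (cocycle t p))" by (metis quo_mul)
  then show "q = (quo (mul g (cocycle t p)), Jm (euler_flow t p))"
    using LF_solution_flow[OF sol p pe, of t] unfolding q by (simp add: quo_def)
qed

lemma LF_solution_shift:
  assumes "LF_solution n L F w u \<xi> \<eta>"
  shows "LF_solution n L F (\<lambda>t. w (t + s)) (\<lambda>t. u (t + s)) (\<lambda>t. \<xi> (t + s)) (\<lambda>t. \<eta> (t + s))"
  using assms DERIV_shift[where f = "\<lambda>t. \<xi> t _" and z = s] DERIV_shift[where f = "\<lambda>t. w t _" and z = s]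
    DERIV_shift[where f = u and z = s] DERIV_shift[where f = \<eta> and z = s]
  unfolding LF_solution_def by blast

text \<open>The solution that starts at the identity, shifted by time \<open>s\<close>, is a
  solution over \<open>euler_flow s p\<close> that starts at \<open>cocycle s p\<close>; uniqueness
  gives the product.\<close>

lemma cocycle_add:
  assumes p: "p \<in> S2"
  shows "cocycle (s + t) p = mul (cocycle s p) (cocycle t (euler_flow s p))"
proof -
  let ?w = "\<lambda>t. fst (Jm (mul (0, 0, 0) (cocycle t p)))" and ?u = "\<lambda>t. snd (Jm (mul (0, 0, 0) (cocycle t p)))"
    and ?x = "\<lambda>t. fst (Jm (euler_flow t p))" and ?e = "\<lambda>t. snd (Jm (euler_flow t p))"
  have "LF_solution 2 Lop Fop ?w ?u ?x ?e" by (rule LF_solution_exists[OF p])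
  from LF_solution_shift[OF this, of s]
  have "LF_solution 2 Lop Fop (\<lambda>t. ?w (t + s)) (\<lambda>t. ?u (t + s)) (\<lambda>t. ?x (t + s)) (\<lambda>t. ?e (t + s))" .
  from LF_solution_flow(2)[OF this euler_flow_in_S2[OF p, of s], of t]
  show ?thesis by (simp add: add.commute)
qed

lemma flow_add:
  assumes "p \<in> S2"
  shows "flow t (flow s (quo g, Jm p)) = flow (s + t) (quo g, Jm p)"
  using assms by (simp add: flow_eq euler_flow_in_S2 cocycle_add mul_assoc euler_flow_add)

lemma flow_power:
  assumes "p \<in> S2"
  shows "(flow 1 ^^ i) (quo g, Jm p) = flow (real i) (quo g, Jm p)"
proof (induction i)
  case 0 then show ?case using assms by (simp add: flow_eq cocycle_0)
next
  case (Suc i) then show ?case using flow_add[OF assms, of 1 "real i" g] by (simp add: add.commute)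
qed

section \<open>Invariance of the Lebesgue measure\<close>

abbreviation "SNM \<equiv> SNmeasure 2 Lop golden_lattice"

lemma space_SNM: "space SNM = range quo \<times> Jm ` S2"
  by (simp add: SNmeasure_def space_pair_measure)

lemma pair_sigma_NM_SM: "pair_sigma_finite NM SM"
  using finite_measure_NM finite_measure_SM by (intro pair_sigma_finite.intro finite_measure.axioms(1))

lemma cocycle_measurable: "cocycle t \<in> measurable cone_measure borel"
proof -
  have "continuous_on S2 (cocycle t)"
    unfolding cocycle_def[abs_def] by (intro continuous_on_Pair continuous_on_fibre continuous_on_drift)
  then have "cocycle t \<in> measurable (restrict_space borel S2) borel" by (rule borel_measurable_continuous_on_restrict)
  then show ?thesis by (simp add: measurable_cong_sets[OF sets_cone_measure refl])
qed

text \<open>A skew product over the measure preserving sphere flow, with right translations in the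
  fibres. Joint measurability of the fibre maps is obtained through the Borel section
  \<open>sec\<close>.\<close>

lemma flow_preserves: "preserves SNM (flow t)"
proof -
  define T where "T = (\<lambda>z C. C #>\<^bsub>LG\<^esub> Jm (cocycle t (Jinv z)))"
  have fe: "flow t x = (T (snd x) (fst x), sflow t (snd x))" if x: "x \<in> space SNM" for x
  proof -
    obtain g p where "x = (quo g, Jm p)" "p \<in> S2" using x unfolding space_SNM by blast
    then show ?thesis by (simp add: flow_eq T_def sflow_def quo_mul)
  qed
  have T: "(\<lambda>(x, y). T y x) \<in> measurable (NM \<Otimes>\<^sub>M SM) NM"
  proof -
    have c: "(\<lambda>x. cocycle t (Jinv (snd x))) \<in> measurable (NM \<Otimes>\<^sub>M SM) borel"
      by (rule measurable_compose[OF measurable_snd measurable_compose[OF Jinv_measurable_SM cocycle_measurable]])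
    have s: "(\<lambda>x. sec (fst x)) \<in> measurable (NM \<Otimes>\<^sub>M SM) borel"
      by (rule measurable_compose[OF measurable_fst]) (use sec_measurable measurable_cong_sets[OF sets_NM refl] in blast)
    have m: "(\<lambda>x. mul (fst x) (snd x)) \<in> borel_measurable borel"
      by (intro borel_measurable_continuous_onI continuous_mul continuous_intros)
    have "(\<lambda>x. quo (mul (sec (fst x)) (cocycle t (Jinv (snd x))))) \<in> measurable (NM \<Otimes>\<^sub>M SM) NB"
      using measurable_compose[OF borel_measurable_Pair[OF s c] measurable_compose[OF m quo_measurable]] by simp
    then have "(\<lambda>x. quo (mul (sec (fst x)) (cocycle t (Jinv (snd x))))) \<in> measurable (NM \<Otimes>\<^sub>M SM) NM"
      using measurable_cong_sets[OF refl sets_NM] by blast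
    then show ?thesis
    proof (rule measurable_cong[THEN iffD1, rotated])
      fix x assume "x \<in> space (NM \<Otimes>\<^sub>M SM)"
      then have "fst x \<in> range quo" by (auto simp: space_pair_measure)
      then show "quo (mul (sec (fst x)) (cocycle t (Jinv (snd x)))) = (case x of (x, y) \<Rightarrow> T y x)"
        using sec(2)[of "fst x"] quo_mul[of "sec (fst x)"] by (simp add: T_def split_beta')
    qed
  qed
  have sp: "sflow t \<in> measurable SM SM" "distr SM SM (sflow t) = SM" using preserves_sflow by (auto simp: preserves_def)
  have eq: "distr (NM \<Otimes>\<^sub>M SM) (NM \<Otimes>\<^sub>M SM) (\<lambda>(x, y). (T y x, sflow t y)) = NM \<Otimes>\<^sub>M SM"
    by (rule pair_sigma_finite.distr_skew_snd[OF pair_sigma_NM_SM T sp(1) _ sp(2)])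
       (unfold T_def, rule NM_mul_right(2))
  have "(\<lambda>(x, y). (T y x, sflow t y)) \<in> measurable SNM SNM"
    unfolding SNmeasure_def split_beta'
    using T sp(1) by (intro measurable_Pair measurable_compose[OF measurable_snd]) (simp_all add: split_beta')
  then have "flow t \<in> measurable SNM SNM"
    by (rule measurable_cong[THEN iffD1, rotated]) (simp add: fe split_beta')
  moreover have "distr SNM SNM (flow t) = distr SNM SNM (\<lambda>(x, y). (T y x, sflow t y))"
    by (rule distr_cong) (simp_all add: fe split_beta')
  ultimately show ?thesis unfolding preserves_def using eq by (simp add: SNmeasure_def)
qed

section \<open>The trapped region and its tori\<close>

text \<open>The cap around the equilibrium \<open>(0, 1, 0)\<close>, up to the separatrix
  \<open>x\<^sup>2 + 2 * e\<^sup>2 = 1\<close> and without the equilibrium itself, where the motion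
  has no least period.\<close>

definition trapped :: "r3 set" where
  "trapped = {(x, y, e). (x, y, e) \<in> S2 \<and> y > 0 \<and> 0 < x\<^sup>2 + 2 * e\<^sup>2 \<and> x\<^sup>2 + 2 * e\<^sup>2 < 1}"

lemma trapped_S2: "p \<in> trapped \<Longrightarrow> p \<in> S2" by (auto simp: trapped_def)

lemma euler_continuous:
  assumes "p \<in> S2"
  shows "continuous_on A (euler_x p)" "continuous_on A (euler_y p)" "continuous_on A (euler_e p)" "continuous_on A (drift p)"
    "continuous_on A (fibre1 l p)" "continuous_on A (fibre2 l p)"
proof -
  note c = DERIV_continuous_on[OF has_field_derivative_at_within]
  show "continuous_on A (euler_x p)" by (rule c[OF euler_curve_deriv(1)[OF assms]])
  show "continuous_on A (euler_y p)" by (rule c[OF euler_curve_deriv(2)[OF assms]])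
  show "continuous_on A (euler_e p)" by (rule c[OF euler_curve_deriv(3)[OF assms]])
  show "continuous_on A (drift p)" by (rule c[OF drift(2)[OF assms]])
  show "continuous_on A (fibre1 l p)" by (rule c[OF fibre1(2)[OF assms]])
  show "continuous_on A (fibre2 l p)" by (rule c[OF fibre2(2)[OF assms]])
qed

text \<open>The integral is conserved, and \<open>y\<close> cannot vanish: on the sphere this would
  give \<open>x\<^sup>2 + e\<^sup>2 = 1\<close>, against
  \<open>x\<^sup>2 + 2 * e\<^sup>2 < 1\<close>. By connectedness \<open>y\<close> stays
  positive.\<close>

lemma euler_flow_trapped:
  assumes p: "p \<in> trapped"
  shows "euler_flow t p \<in> trapped"
proof -
  obtain x y e where pe: "p = (x, y, e)" by (cases p)
  note pS = trapped_S2[OF p]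
  have i: "euler_x p 0 = x" "euler_y p 0 = y" "euler_e p 0 = e" using euler_curve(2)[OF pS] pe by auto
  have P: "y > 0" "0 < x\<^sup>2 + 2 * e\<^sup>2" "x\<^sup>2 + 2 * e\<^sup>2 < 1" using p by (auto simp: trapped_def pe)
  have c: "(euler_x p t)\<^sup>2 + 2 * (euler_e p t)\<^sup>2 = x\<^sup>2 + 2 * e\<^sup>2" for t
    using euler_sol_conserved(3)[OF euler_curve(1)[OF pS], of t] by (simp add: i)
  have s: "(euler_x p t)\<^sup>2 + (euler_y p t)\<^sup>2 + (euler_e p t)\<^sup>2 = 1" for t
    using euler_flow_in_S2[OF pS, of t] by (simp add: euler_flow_def)
  have ne: "euler_y p t \<noteq> 0" for t
  proof
    assume "euler_y p t = 0"
    then have "(euler_x p t)\<^sup>2 + (euler_e p t)\<^sup>2 = 1" using s[of t] by simp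
    moreover have "0 \<le> (euler_e p t)\<^sup>2" by simp
    ultimately show False using c[of t] P by linarith
  qed
  have "euler_y p t > 0"
  proof (rule ccontr)
    assume "\<not> euler_y p t > 0"
    then have n: "euler_y p t < 0" using ne[of t] by simp
    have "connected (euler_y p ` UNIV)" by (intro connected_continuous_image euler_continuous pS) simp
    then have "{euler_y p t..euler_y p 0} \<subseteq> euler_y p ` UNIV" by (rule connected_contains_Icc) auto
    moreover have "0 \<in> {euler_y p t..euler_y p 0}" using n P(1) i by simp
    ultimately have "0 \<in> euler_y p ` UNIV" by blast
    then show False using ne by auto
  qed
  then show ?thesis using c[of t] s[of t] P by (simp add: trapped_def euler_flow_def)
qed

text \<open>The pair \<open>(x, sqrt 2 * e)\<close> satisfies the equation of a plane rotation with
  angular speed \<open>sqrt 2 * y\<close>. In terms of the angle \<Theta> the motion is exactly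
  circular, so no elliptic functions appear.\<close>

lemma trapped_rotation:
  assumes p: "(x, y, e) \<in> S2"
  defines "\<Theta> \<equiv> primitive (\<lambda>t. sqrt 2 * euler_y (x, y, e) t)"
  shows "(\<Theta> has_real_derivative sqrt 2 * euler_y (x, y, e) t) (at t)" "\<Theta> 0 = 0"
    "euler_x (x, y, e) t = x * cos (\<Theta> t) - sqrt 2 * e * sin (\<Theta> t)"
    "sqrt 2 * euler_e (x, y, e) t = x * sin (\<Theta> t) + sqrt 2 * e * cos (\<Theta> t)"
proof -
  let ?p = "(x, y, e)"
  have i: "euler_x ?p 0 = x" "euler_y ?p 0 = y" "euler_e ?p 0 = e" using euler_curve(2)[OF p] by auto
  note d = euler_curve_deriv[OF p]
  have "isCont (\<lambda>t. sqrt 2 * euler_y ?p t) t" for t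
    using d(2)[of t] DERIV_isCont by (intro continuous_intros) blast
  from primitive[OF this] show \<Theta>: "(\<Theta> has_real_derivative sqrt 2 * euler_y ?p t) (at t)" "\<Theta> 0 = 0" for t
    unfolding \<Theta>_def by auto
  have s2: "sqrt 2 * sqrt 2 = (2::real)" "\<And>a. sqrt 2 * (sqrt 2 * a) = 2 * (a::real)" by (simp_all flip: mult.assoc)
  \<comment> \<open>Rotating the pair back by the angle \<Theta> gives a constant; \<open>P\<close>
    and \<open>Q\<close> are its two components.\<close>
  have P: "euler_x ?p t * cos (\<Theta> t) + sqrt 2 * euler_e ?p t * sin (\<Theta> t) = x" for t
  proof -
    have "((\<lambda>t. euler_x ?p t * cos (\<Theta> t) + sqrt 2 * euler_e ?p t * sin (\<Theta> t)) has_real_derivative 0) (at t)" for t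
      by (rule derivative_eq_intros d \<Theta>(1) refl)+ (simp add: algebra_simps s2)
    from zero_deriv_const[of "\<lambda>t. euler_x ?p t * cos (\<Theta> t) + sqrt 2 * euler_e ?p t * sin (\<Theta> t)", OF this, of t]
    show ?thesis by (simp add: i \<Theta>(2))
  qed
  have Q: "sqrt 2 * euler_e ?p t * cos (\<Theta> t) - euler_x ?p t * sin (\<Theta> t) = sqrt 2 * e" for t
  proof -
    have "((\<lambda>t. sqrt 2 * euler_e ?p t * cos (\<Theta> t) - euler_x ?p t * sin (\<Theta> t)) has_real_derivative 0) (at t)" for t
      by (rule derivative_eq_intros d \<Theta>(1) refl)+ (simp add: algebra_simps s2)
    from zero_deriv_const[of "\<lambda>t. sqrt 2 * euler_e ?p t * cos (\<Theta> t) - euler_x ?p t * sin (\<Theta> t)", OF this, of t]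
    show ?thesis by (simp add: i \<Theta>(2))
  qed
  have sc: "X * (cos (\<Theta> t) * cos (\<Theta> t)) + X * (sin (\<Theta> t) * sin (\<Theta> t)) = X" for X
    by (simp flip: distrib_left)
  have "x * cos (\<Theta> t) - sqrt 2 * e * sin (\<Theta> t) = (euler_x ?p t * cos (\<Theta> t) + sqrt 2 * euler_e ?p t * sin (\<Theta> t)) * cos (\<Theta> t)
      - (sqrt 2 * euler_e ?p t * cos (\<Theta> t) - euler_x ?p t * sin (\<Theta> t)) * sin (\<Theta> t)" by (simp only: P Q)
  also have "\<dots> = euler_x ?p t * (cos (\<Theta> t) * cos (\<Theta> t)) + euler_x ?p t * (sin (\<Theta> t) * sin (\<Theta> t))" by (simp add: algebra_simps)
  finally show "euler_x ?p t = x * cos (\<Theta> t) - sqrt 2 * e * sin (\<Theta> t)" unfolding sc ..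
  have "x * sin (\<Theta> t) + sqrt 2 * e * cos (\<Theta> t) = (euler_x ?p t * cos (\<Theta> t) + sqrt 2 * euler_e ?p t * sin (\<Theta> t)) * sin (\<Theta> t)
      + (sqrt 2 * euler_e ?p t * cos (\<Theta> t) - euler_x ?p t * sin (\<Theta> t)) * cos (\<Theta> t)" by (simp only: P Q)
  also have "\<dots> = sqrt 2 * euler_e ?p t * (cos (\<Theta> t) * cos (\<Theta> t)) + sqrt 2 * euler_e ?p t * (sin (\<Theta> t) * sin (\<Theta> t))" by (simp add: algebra_simps)
  finally show "sqrt 2 * euler_e ?p t = x * sin (\<Theta> t) + sqrt 2 * e * cos (\<Theta> t)" unfolding sc ..
qed

text \<open>The orbit returns exactly when \<Theta> is a multiple of \<open>2 * pi\<close>. Since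
  \<open>y\<^sup>2\<close> is at least \<open>1 - (x\<^sup>2 + 2 * e\<^sup>2)\<close>, the angle
  grows at a speed bounded below and reaches \<open>2 * pi\<close>; strict monotonicity makes this
  the first return.\<close>

lemma trapped_period:
  assumes p: "p \<in> trapped"
  obtains T where "T > 0" "euler_flow T p = p" "\<And>r. 0 < r \<Longrightarrow> r < T \<Longrightarrow> euler_flow r p \<noteq> p"
proof -
  obtain x y e where pe: "p = (x, y, e)" by (cases p)
  note pS = trapped_S2[OF p]
  define \<Theta> where "\<Theta> = primitive (\<lambda>t. sqrt 2 * euler_y (x, y, e) t)"
  note R = trapped_rotation[OF pS[unfolded pe], folded \<Theta>_def pe]
  have P: "y > 0" "0 < x\<^sup>2 + 2 * e\<^sup>2" "x\<^sup>2 + 2 * e\<^sup>2 < 1" using p by (auto simp: trapped_def pe)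
  have tr: "euler_y p t > 0" "(euler_x p t)\<^sup>2 + (euler_y p t)\<^sup>2 + (euler_e p t)\<^sup>2 = 1" for t
    using euler_flow_trapped[OF p, of t] by (auto simp: trapped_def euler_flow_def)
  have c: "(euler_x p t)\<^sup>2 + 2 * (euler_e p t)\<^sup>2 = x\<^sup>2 + 2 * e\<^sup>2" for t
    using euler_sol_conserved(3)[OF euler_curve(1)[OF pS], of t] euler_curve(2)[OF pS] pe by simp
  define \<delta> where "\<delta> = sqrt 2 * sqrt (1 - (x\<^sup>2 + 2 * e\<^sup>2))"
  have \<delta>: "\<delta> > 0" using P by (simp add: \<delta>_def)
  have yl: "\<delta> \<le> sqrt 2 * euler_y p t" for t
  proof -
    have "1 - (x\<^sup>2 + 2 * e\<^sup>2) \<le> (euler_y p t)\<^sup>2"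
      using c[of t] tr(2)[of t] zero_le_power2[of "euler_e p t"] by linarith
    then have "sqrt (1 - (x\<^sup>2 + 2 * e\<^sup>2)) \<le> euler_y p t"
      using tr(1)[of t] by (intro real_le_lsqrt) auto
    then show ?thesis unfolding \<delta>_def by (intro mult_left_mono) auto
  qed
  have mono: "\<Theta> s < \<Theta> t" if "s < t" for s t
    by (rule DERIV_pos_imp_increasing[OF that]) (use R(1) tr(1) in \<open>force intro: mult_pos_pos\<close>)
  have grow: "\<delta> * t \<le> \<Theta> t" if "t \<ge> 0" for t
  proof -
    have "\<Theta> 0 - \<delta> * 0 \<le> \<Theta> t - \<delta> * t"
    proof (rule DERIV_nonneg_imp_nondecreasing[OF that])
      fix s
      have "((\<lambda>t. \<Theta> t - \<delta> * t) has_real_derivative sqrt 2 * euler_y p s - \<delta>) (at s)"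
        by (auto intro!: derivative_eq_intros R(1))
      then show "\<exists>y. ((\<lambda>t. \<Theta> t - \<delta> * t) has_real_derivative y) (at s) \<and> 0 \<le> y" using yl[of s] by (intro exI conjI) auto
    qed
    then show ?thesis by (simp add: R(2))
  qed
  have cont: "continuous_on A \<Theta>" for A
    by (rule DERIV_continuous_on[OF has_field_derivative_at_within[OF R(1)]])
  have "\<exists>T. 0 \<le> T \<and> T \<le> 2 * pi / \<delta> \<and> \<Theta> T = 2 * pi"
  proof (rule IVT')
    show "2 * pi \<le> \<Theta> (2 * pi / \<delta>)" using grow[of "2 * pi / \<delta>"] \<delta> by simp
    show "0 \<le> 2 * pi / \<delta>" "\<Theta> 0 \<le> 2 * pi" using \<delta> R(2) by simp_all
  qed (rule cont)
  then obtain T where T: "0 \<le> T" "\<Theta> T = 2 * pi" by blast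
  have "T \<noteq> 0" using T(2) R(2) by auto
  then have T0: "T > 0" using T(1) by simp
  have ret: "euler_flow r p = p \<longleftrightarrow> cos (\<Theta> r) = 1" for r
  proof
    assume "euler_flow r p = p"
    then have "euler_x p r = x" "euler_e p r = e" by (auto simp: euler_flow_def pe)
    then have 1: "x = x * cos (\<Theta> r) - sqrt 2 * e * sin (\<Theta> r)" "sqrt 2 * e = x * sin (\<Theta> r) + sqrt 2 * e * cos (\<Theta> r)"
      using R(3)[of r] R(4)[of r] by simp_all
    \<comment> \<open>The inner product of the vector \<open>(x, sqrt 2 * e)\<close> with its
      rotated image equals its squared length times the cosine, and the vector is nonzero in the
      trapped region.\<close>
    have "x * x + (sqrt 2 * e) * (sqrt 2 * e) = x * (x * cos (\<Theta> r) - sqrt 2 * e * sin (\<Theta> r)) + (sqrt 2 * e) * (x * sin (\<Theta> r) + sqrt 2 * e * cos (\<Theta> r))"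
      using 1 by simp
    also have "\<dots> = (x * x + (sqrt 2 * e) * (sqrt 2 * e)) * cos (\<Theta> r)" by (simp add: algebra_simps)
    also have "x * x + (sqrt 2 * e) * (sqrt 2 * e) = x\<^sup>2 + 2 * e\<^sup>2" by (simp add: power2_eq_square)
    finally show "cos (\<Theta> r) = 1" using P(2) by simp
  next
    assume c1: "cos (\<Theta> r) = 1"
    then have s0: "sin (\<Theta> r) = 0" using sin_cos_squared_add[of "\<Theta> r"] by simp
    have xe: "euler_x p r = x" "euler_e p r = e" using R(3)[of r] R(4)[of r] c1 s0 by auto
    have "(euler_y p r)\<^sup>2 = y\<^sup>2" using tr(2)[of r] pS unfolding pe xe[unfolded pe] by simp
    then have "euler_y p r = y" using tr(1)[of r] P(1) by (simp add: power2_eq_iff_nonneg)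
    then show "euler_flow r p = p" using xe by (simp add: euler_flow_def) (simp add: pe)
  qed
  show ?thesis
  proof (rule that[OF T0])
    show "euler_flow T p = p" using T(2) by (simp add: ret)
    fix r assume r: "0 < r" "r < T"
    have "0 < \<Theta> r" "\<Theta> r < 2 * pi" using mono[OF r(1)] mono[OF r(2)] R(2) T(2) by auto
    have "cos (\<Theta> r) \<noteq> 1"
    proof
      assume "cos (\<Theta> r) = 1"
      then obtain n :: int where n: "\<Theta> r = of_int n * (2 * pi)" by (auto simp: cos_one_2pi_int mult.assoc)
      have "of_int n * (2 * pi) < 1 * (2 * pi)" "0 * (2 * pi) < of_int n * (2 * pi)" using \<open>0 < \<Theta> r\<close> \<open>\<Theta> r < 2 * pi\<close> n by simp_all
      then have "real_of_int n < 1" "0 < real_of_int n" by (simp_all only: mult_less_cancel_right_pos pi_gt_zero zero_less_mult_iff zero_less_numeral simp_thms)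
      then show False by simp
    qed
    then show "euler_flow r p \<noteq> p" by (simp add: ret)
  qed
qed

text \<open>For \<open>z = x / y\<close> one finds \<open>z' = - e * (2 + z\<^sup>2)\<close>. Hence
  \<open>e\<close> is the derivative of a function of \<open>z\<close> alone, which takes the same
  value at both ends of a closed orbit.\<close>

lemma trapped_drift:
  assumes p: "p \<in> trapped" and "euler_flow T p = p"
  shows "drift p T = 0"
proof -
  note pS = trapped_S2[OF p]
  define G where "G = (\<lambda>t. - arctan (euler_x p t / euler_y p t / sqrt 2) / sqrt 2)"
  have y: "euler_y p t > 0" for t
    using euler_flow_trapped[OF p, of t] by (auto simp: trapped_def euler_flow_def)
  have "(G has_real_derivative euler_e p t) (at t)" for t
  proof -
    let ?x = "euler_x p t" and ?y = "euler_y p t" and ?e = "euler_e p t"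
    have n: "?y \<noteq> 0" "sqrt 2 \<noteq> (0::real)" using y[of t] by auto
    have d: "((\<lambda>t. euler_x p t / euler_y p t / sqrt 2) has_real_derivative - ?e * (2 + (?x / ?y)\<^sup>2) / sqrt 2) (at t)"
      by (rule derivative_eq_intros euler_curve_deriv[OF pS] refl n)+ (use n in \<open>simp add: field_simps power2_eq_square power_mult_distrib\<close>)
    have "(G has_real_derivative - (inverse (1 + (?x / ?y / sqrt 2)\<^sup>2) * (- ?e * (2 + (?x / ?y)\<^sup>2) / sqrt 2)) / sqrt 2) (at t)"
      unfolding G_def by (rule derivative_eq_intros DERIV_chain2[OF DERIV_arctan d] refl n)+ (simp add: n)
    moreover have "- (inverse (1 + (?x / ?y / sqrt 2)\<^sup>2) * (- ?e * (2 + (?x / ?y)\<^sup>2) / sqrt 2)) / sqrt 2 = ?e"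
    proof -
      define z where "z = (?x / ?y)\<^sup>2"
      have z: "1 + z / 2 > 0" by (simp add: z_def add_pos_nonneg)
      have a: "(?x / ?y / sqrt 2)\<^sup>2 = z / 2" by (simp add: z_def power_divide power_mult_distrib)
      have b: "- (inverse (1 + z / 2) * (- ?e * (2 + z) / sqrt 2)) / sqrt 2 = inverse (1 + z / 2) * (1 + z / 2) * ?e"
        by (simp add: field_simps)
      show ?thesis unfolding a z_def[symmetric] b using z by simp
    qed
    ultimately show ?thesis by (simp only:)
  qed
  from same_deriv_eq[OF drift(2)[OF pS] this, of T]
  have "drift p T = G T - G 0" by (simp add: drift(1)[OF pS])
  also have "\<dots> = 0"
  proof -
    have "euler_flow T p = euler_flow 0 p" using assms(2) euler_flow_0[OF pS] by simp
    then show ?thesis by (simp add: G_def euler_flow_def)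
  qed
  finally show ?thesis .
qed

section \<open>Topology of the phase space and of the torus\<close>

text \<open>The quotient map is open, and cosets are equal exactly when \<open>mul b (ivs a)\<close>
  lies in the closed set \<open>Gam3\<close>; a closed equivalence relation under an open quotient
  map has a Hausdorff quotient.\<close>

lemma Hausdorff_NT: "Hausdorff_space NT"
  unfolding Hausdorff_space_def
proof (intro allI impI)
  fix C C' assume "C \<in> topspace NT \<and> C' \<in> topspace NT \<and> C \<noteq> C'"
  then obtain g g' where g: "C = quo g" "C' = quo g'" "quo g \<noteq> quo g'" unfolding topspace_NT by blast
  have "Gam3 = (\<lambda>p. coord_m (fst p) (fst (snd p))) -` \<int> \<inter> (\<lambda>p. coord_n (fst p) (fst (snd p))) -` \<int> \<inter> (\<lambda>p. snd (snd p)) -` \<int>"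
    by (auto simp: Gam3_iff)
  also have "closed \<dots>"
    by (intro closed_Int closed_vimage closed_Ints continuous_on_coord continuous_intros)
  finally have cl: "closed Gam3" .
  have rel: "quo a = quo b \<longleftrightarrow> mul b (ivs a) \<in> Gam3" for a b
    unfolding quo_eq_iff by (metis mul_ivs_cancel_right)
  let ?f = "\<lambda>q. mul (snd q) (ivs (fst q))"
  have "open (?f -` (- Gam3))"
    by (intro open_vimage open_Compl cl continuous_mul continuous_ivs continuous_intros)
  moreover have "(g, g') \<in> ?f -` (- Gam3)" using g(3) rel by simp
  ultimately obtain A B where AB: "open A" "open B" "(g, g') \<in> A \<times> B" "A \<times> B \<subseteq> ?f -` (- Gam3)"
    by (rule open_prod_elim)
  have "disjnt (quo ` A) (quo ` B)" using AB(4) rel by (fastforce simp: disjnt_def)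
  then show "\<exists>U V. openin NT U \<and> openin NT V \<and> C \<in> U \<and> C' \<in> V \<and> disjnt U V"
    using AB g quo_open by (intro exI[of _ "quo ` A"] exI[of _ "quo ` B"]) auto
qed

abbreviation "SNT \<equiv> SNtop 2 Lop golden_lattice"

lemma Hausdorff_SNT: "Hausdorff_space SNT"
proof -
  have "Hausdorff_space (Etop 2)"
    unfolding Etop_def by (simp add: Hausdorff_space_prod_topology Hausdorff_space_product_topology)
  then show ?thesis unfolding SNtop_def
    by (simp add: Hausdorff_space_prod_topology Hausdorff_NT Hausdorff_space_subtopology)
qed

lemma topspace_SNT: "topspace SNT = range quo \<times> Jm ` S2"
proof -
  have "Sph 2 \<subseteq> topspace (Etop 2)" unfolding Sph_eq topspace_Etop range_Jm[symmetric] by blast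
  then show ?thesis by (simp add: SNtop_def topspace_NT topspace_subtopology Int_absorb1 Sph_eq)
qed

lemma continuous_map_SNT:
  fixes f g :: "'a::topological_space \<Rightarrow> r3"
  assumes f: "continuous_on UNIV f" and g: "continuous_on UNIV g" and S: "\<And>x. g x \<in> S2"
  shows "continuous_map euclidean SNT (\<lambda>x. (quo (f x), Jm (g x)))"
proof -
  have "continuous_map euclidean NT quo"
    unfolding continuous_map_def by (auto simp: topspace_NT openin_Ntop_iff vimage_def[symmetric])
  then have 1: "continuous_map euclidean NT (\<lambda>x. quo (f x))"
    using continuous_map_compose[of euclidean euclidean f NT quo] f by (simp add: comp_def)
  have "continuous_map euclidean (Etop 2) (\<lambda>x. Jm (g x))"
    using continuous_map_compose[OF _ continuous_map_Jm, of euclidean g] g by (simp add: comp_def)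
  then have 2: "continuous_map euclidean (subtopology (Etop 2) (Sph 2)) (\<lambda>x. Jm (g x))"
    using S by (simp add: continuous_map_in_subtopology Sph_eq image_subset_iff)
  show ?thesis unfolding SNtop_def by (rule continuous_map_pairedI[OF 1 2])
qed

lemma euler_flow_multiple_period:
  assumes p: "p \<in> S2" and T: "euler_flow T p = p"
  shows "euler_flow (of_int k * T + t) p = euler_flow t p"
proof -
  have n: "euler_flow (real n * T) p = p" for n
  proof (induction n)
    case (Suc n)
    have "euler_flow (real (Suc n) * T) p = euler_flow T (euler_flow (real n * T) p)"
      using euler_flow_add[OF p, of "real n * T" T] by (simp add: algebra_simps)
    then show ?case using Suc T by simp
  qed (simp add: p)
  have "euler_flow (of_int k * T) p = p"
  proof (cases "k \<ge> 0")
    case True then show ?thesis using n[of "nat k"] by simp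
  next
    case False
    then have "euler_flow (real (nat (- k)) * T + of_int k * T) p = euler_flow 0 p" by simp
    then show ?thesis using euler_flow_add[OF p, of "real (nat (- k)) * T" "of_int k * T"] n p by simp
  qed
  then show ?thesis using euler_flow_add[OF p, of "of_int k * T" t] by simp
qed

definition angles :: "r3 \<Rightarrow> nat \<Rightarrow> complex" where
  "angles = (\<lambda>(s0, s1, t). \<lambda>j\<in>{..<3}. cis (2 * pi * (if j = 0 then s0 else if j = 1 then s1 else t)))"

lemma less3: "{..<3::nat} = {0, 1, 2}" by auto

lemma topspace_torus: "topspace (torus k) = {..<k} \<rightarrow>\<^sub>E sphere 0 1"
  by (simp add: torus_def)

lemma cis_2pi_eq_iff: "cis (2 * pi * a) = cis (2 * pi * b) \<longleftrightarrow> a - b \<in> \<int>"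
proof -
  have "cis (2 * pi * a) = cis (2 * pi * b) \<longleftrightarrow> cis (2 * pi * (a - b)) = 1"
    by (simp add: right_diff_distrib flip: cis_divide)
  also have "\<dots> \<longleftrightarrow> cos (2 * pi * (a - b)) = 1"
  proof
    assume c: "cos (2 * pi * (a - b)) = 1"
    then have "sin (2 * pi * (a - b)) = 0" using sin_cos_squared_add[of "2 * pi * (a - b)"] by simp
    then show "cis (2 * pi * (a - b)) = 1" using c by (simp add: complex_eq_iff)
  qed (simp add: complex_eq_iff)
  also have "\<dots> \<longleftrightarrow> (\<exists>n::int. a - b = of_int n)" 
  proof -
    have "2 * pi * (a - b) = of_int n * 2 * pi \<longleftrightarrow> 2 * pi * (a - b) = 2 * pi * of_int n" for n :: int
      by (simp only: mult_ac)
    then show ?thesis unfolding cos_one_2pi_int by (simp only: mult_cancel_left) simp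
  qed
  also have "\<dots> \<longleftrightarrow> a - b \<in> \<int>" by (auto simp: Ints_def)
  finally show ?thesis .
qed

lemma angles_eq_iff: "angles (a, b, c) = angles (a', b', c') \<longleftrightarrow> a - a' \<in> \<int> \<and> b - b' \<in> \<int> \<and> c - c' \<in> \<int>"
proof -
  have "angles (a, b, c) = angles (a', b', c') \<longleftrightarrow> (\<forall>j\<in>{..<3::nat}. angles (a, b, c) j = angles (a', b', c') j)"
  proof
    assume *: "\<forall>j\<in>{..<3::nat}. angles (a, b, c) j = angles (a', b', c') j"
    show "angles (a, b, c) = angles (a', b', c')"
    proof
      fix j show "angles (a, b, c) j = angles (a', b', c') j"
        using * by (cases "j < 3") (simp_all add: angles_def)
    qed
  qed simp
  also have "\<dots> \<longleftrightarrow> a - a' \<in> \<int> \<and> b - b' \<in> \<int> \<and> c - c' \<in> \<int>"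
    unfolding less3 by (simp add: angles_def cis_2pi_eq_iff)
  finally show ?thesis .
qed

lemma angles_torus: "angles s \<in> topspace (torus 3)"
  by (cases s) (simp add: topspace_torus angles_def)

lemma angles_surj:
  assumes "z \<in> topspace (torus 3)"
  obtains s where "s \<in> cbox (0, 0, 0) (1, 1, 1)" "angles s = z"
proof -
  have n: "norm (z j) = 1" if "j < 3" for j
  proof -
    have "z j \<in> sphere 0 1" using assms that unfolding topspace_torus PiE_iff by blast
    then show ?thesis by simp
  qed
  define s where "s = (\<lambda>j. Arg2pi (z j) / (2 * pi))"
  have s: "0 \<le> s j" "s j \<le> 1" for j using Arg2pi[of "z j"] by (simp_all add: s_def)
  have c: "cis (2 * pi * s j) = z j" if "j < 3" for j
    using complex_norm_eq_1_exp[of "z j"] n[OF that] by (simp add: s_def cis_conv_exp mult.commute)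
  show ?thesis
  proof (rule that[of "(s 0, s 1, s 2)"])
    show "(s 0, s 1, s 2) \<in> cbox (0, 0, 0) (1, 1, 1)" using s by simp
    show "angles (s 0, s 1, s 2) = z"
    proof
      fix j show "angles (s 0, s 1, s 2) j = z j"
      proof (cases "j < 3")
        case True
        then have "j = 0 \<or> j = 1 \<or> j = 2" by auto
        then show ?thesis using c[of 0] c[of 1] c[of 2] by (auto simp: angles_def)
      next
        case False
        have "z j = undefined"
          by (rule PiE_arb[OF assms[unfolded topspace_torus]]) (use False in simp)
        then show ?thesis using False by (simp add: angles_def)
      qed
    qed
  qed
qed

lemma continuous_angles: "continuous_map euclidean (torus 3) angles"
  unfolding torus_def continuous_map_componentwise
proof (intro conjI ballI)
  show "angles ` topspace euclidean \<subseteq> extensional {..<3}" by (auto simp: angles_def)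
  fix j :: nat assume "j \<in> {..<3}"
  then have "(\<lambda>s. angles s j) = (\<lambda>s. cis (2 * pi * (if j = 0 then fst s else if j = 1 then fst (snd s) else snd (snd s))))"
    by (auto simp: angles_def fun_eq_iff)
  moreover have "continuous_on UNIV (\<lambda>s :: r3. cis (2 * pi * (if j = 0 then fst s else if j = 1 then fst (snd s) else snd (snd s))))"
    by (cases "j = 0"; cases "j = 1") (auto intro!: continuous_intros)
  ultimately show "continuous_map euclidean (top_of_set (sphere 0 1)) (\<lambda>s. angles s j)"
    by (auto simp: continuous_map_in_subtopology)
qed

lemma Hausdorff_torus: "Hausdorff_space (torus k)"
  by (simp add: torus_def Hausdorff_space_product_topology Hausdorff_space_subtopology)

lemma compact_torus: "compact_space (torus k)"
proof -
  have "compact_space (top_of_set (sphere (0::complex) 1))" by (simp add: compact_space_subtopology)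
  then show ?thesis by (simp add: torus_def compact_space_product_topology)
qed

text \<open>A continuous surjection from a compact space to a Hausdorff space. It reduces continuity
  of a map on the torus to continuity on the cube.\<close>

lemma quotient_angles: "quotient_map (top_of_set (cbox (0, 0, 0) (1, 1, 1 :: real))) (torus 3) angles"
proof (rule T1_Spaces.continuous_imp_quotient_map)
  show "continuous_map (top_of_set (cbox (0, 0, 0) (1, 1, 1))) (torus 3) angles"
    using continuous_angles by (rule continuous_map_from_subtopology)
  show "compact_space (top_of_set (cbox (0, 0, 0) (1, 1, 1 :: real)))"
    by (simp add: compact_space_subtopology compact_cbox)
  show "angles ` topspace (top_of_set (cbox (0, 0, 0) (1, 1, 1))) = topspace (torus 3)"
  proof (intro equalityI subsetI)
    fix z assume "z \<in> topspace (torus 3)"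
    then obtain s where "s \<in> cbox (0, 0, 0) (1, 1, 1)" "angles s = z" by (rule angles_surj)
    then show "z \<in> angles ` topspace (top_of_set (cbox (0, 0, 0) (1, 1, 1)))" by (simp del: split_paired_All) (metis image_eqI)
  qed (use angles_torus in blast)
qed (rule Hausdorff_torus)

text \<open>Two angles are the lattice coordinates of a left translation by the abelian ideal, and
  the third is time divided by the period. Since the drift over a period vanishes, the cocycle there
  lies in the ideal, so a correction linear in time closes up the third direction; in the corrected
  coordinates the flow is linear.\<close>

lemma trapped_torus:
  assumes p: "p \<in> trapped"
  shows "\<exists>A. (quo g, Jm p) \<in> A \<and> A \<subseteq> range quo \<times> Jm ` trapped \<and> quasi_periodic_torus SNT flow A"
proof -
  note pS = trapped_S2[OF p]
  obtain T where T: "T > 0" "euler_flow T p = p" and min: "\<And>r. 0 < r \<Longrightarrow> r < T \<Longrightarrow> euler_flow r p \<noteq> p"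
    by (rule trapped_period[OF p]) blast
  have period: "euler_flow r p = p \<longleftrightarrow> r / T \<in> \<int>" for r
  proof
    assume r: "euler_flow r p = p"
    define k where "k = \<lfloor>r / T\<rfloor>"
    define d where "d = r - of_int k * T"
    have "of_int k \<le> r / T" "r / T < of_int k + 1" unfolding k_def by linarith+
    then have "of_int k * T \<le> r" "r < (of_int k + 1) * T" using T(1) by (simp_all only: pos_le_divide_eq pos_divide_less_eq)
    then have d: "0 \<le> d" "d < T" by (simp_all add: d_def algebra_simps)
    have "euler_flow d p = p" using euler_flow_multiple_period[OF pS T(2), of k d] r by (simp add: d_def)
    then have "d = 0" using min[of d] d by force
    then show "r / T \<in> \<int>" using T(1) by (simp add: d_def)
  next
    assume "r / T \<in> \<int>"
    then obtain k where "r / T = of_int k" by (auto simp: Ints_def)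
    then have "r = of_int k * T" using T(1) by (simp add: field_simps)
    then show "euler_flow r p = p" using euler_flow_multiple_period[OF pS T(2), of k 0] pS by simp
  qed
  have ret: "euler_flow r p = euler_flow r' p \<longleftrightarrow> (r - r') / T \<in> \<int>" for r r'
  proof -
    have "euler_flow r p = euler_flow r' p \<longleftrightarrow> euler_flow (r - r') p = p"
    proof
      assume "euler_flow r p = euler_flow r' p"
      then have "euler_flow (- r') (euler_flow r p) = euler_flow (- r') (euler_flow r' p)" by simp
      then show "euler_flow (r - r') p = p" using euler_flow_add[OF pS, of r "- r'"] euler_flow_add[OF pS, of r' "- r'"] pS by simp
    next
      assume "euler_flow (r - r') p = p"
      then show "euler_flow r p = euler_flow r' p" using euler_flow_add[OF pS, of "r - r'" r'] by simp
    qed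
    then show ?thesis using period by simp
  qed
  obtain V1 V2 where V: "cocycle T p = (V1, V2, 0)"
    using trapped_drift[OF p T(2)] by (simp add: cocycle_def)
  obtain a0 b0 u0 where g: "g = (a0, b0, u0)" by (cases g)
  \<comment> \<open>Moving the period translation from the right of \<open>g\<close> to its left
    multiplies it by the exponential of \<open>u0 * L\<close>.\<close>
  define v1 v2 where "v1 = exp (u0 * l1) * V1" and "v2 = exp (u0 * l2) * V2"
  define X where "X = (\<lambda>\<tau>. mul (- \<tau> * v1, - \<tau> * v2, 0) (mul g (cocycle (\<tau> * T) p)))"
  define H where "H = (\<lambda>(s0, s1, \<tau>). (quo (mul (s0 + s1 * t1, s0 + s1 * t2, 0) (X \<tau>)), Jm (euler_flow (\<tau> * T) p)))"
  have X1: "X (\<tau> + 1) = X \<tau>" for \<tau>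
  proof -
    have "cocycle ((\<tau> + 1) * T) p = mul (V1, V2, 0) (cocycle (\<tau> * T) p)"
      using cocycle_add[OF pS, of T "\<tau> * T"] T(2) V by (simp add: algebra_simps)
    then show ?thesis
      by (cases "cocycle (\<tau> * T) p") (simp add: X_def g mul_simp v1_def v2_def algebra_simps)
  qed
  have Xk: "X (\<tau> + of_int k) = X \<tau>" for \<tau> k
  proof (induction k rule: int_induct[where k = 0])
    case (step1 i) then show ?case using X1[of "\<tau> + of_int i"] by (simp add: add.assoc)
  next
    case (step2 i) then show ?case using X1[of "\<tau> + of_int (i - 1)"] by simp
  qed simp
  have X_eq: "X \<tau> = X \<tau>'" if i: "\<tau> - \<tau>' \<in> \<int>" for \<tau> \<tau>'
  proof -
    obtain k where "\<tau> - \<tau>' = of_int k" using i by (rule Ints_cases)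
    then show ?thesis using Xk[of \<tau>' k] by (simp add: algebra_simps)
  qed
  \<comment> \<open>The two points differ by the left translation \<open>(a' - a, b' - b, 0)\<close>
    of height \<open>0\<close>, so equality of cosets becomes integrality of its lattice
    coordinates.\<close>
  have quo_line: "quo (mul (a, b, 0) x) = quo (mul (a', b', 0) x) \<longleftrightarrow> coord_m (a' - a) (b' - b) \<in> \<int> \<and> coord_n (a' - a) (b' - b) \<in> \<int>" for a b a' b' x
  proof -
    have iv: "ivs (a, b, 0) = (- a, - b, 0)" by (simp add: ivs_def)
    have "quo (mul (a, b, 0) x) = quo (mul (a', b', 0) x) \<longleftrightarrow> mul (mul (a', b', 0) x) (ivs (mul (a, b, 0) x)) \<in> Gam3"
      unfolding quo_eq_iff by (metis mul_ivs_cancel_right)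
    also have "mul (mul (a', b', 0) x) (ivs (mul (a, b, 0) x)) = (a' - a, b' - b, 0)"
    proof -
      have "mul (a' - a, b' - b, 0) (mul (a, b, 0) x) = mul (a', b', 0) x" by (simp add: mul_simp flip: mul_assoc)
      then show ?thesis by (metis mul_ivs_cancel_right(1))
    qed
    finally show ?thesis by (simp add: Gam3_iff)
  qed
  have H_eq: "H s = H s' \<longleftrightarrow> angles s = angles s'" for s s'
  proof -
    obtain a b c a' b' c' where s: "s = (a, b, c)" "s' = (a', b', c')" by (cases s; cases s')
    have cT: "(c * T - c' * T) / T = c - c'" using T(1) by (simp add: field_simps)
    have d: "a' + b' * t - (a + b * t) = (a' - a) + (b' - b) * t" for t :: real by (simp add: algebra_simps)
    have neg: "(a' - a \<in> \<int>) = (a - a' \<in> \<int>)" "(b' - b \<in> \<int>) = (b - b' \<in> \<int>)"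
      by (metis Ints_minus minus_diff_eq)+
    have "H s = H s' \<longleftrightarrow> c - c' \<in> \<int> \<and> quo (mul (a + b * t1, a + b * t2, 0) (X c)) = quo (mul (a' + b' * t1, a' + b' * t2, 0) (X c'))"
      unfolding H_def s by (auto simp: ret cT)
    also have "\<dots> \<longleftrightarrow> c - c' \<in> \<int> \<and> quo (mul (a + b * t1, a + b * t2, 0) (X c)) = quo (mul (a' + b' * t1, a' + b' * t2, 0) (X c))"
      by (rule conj_cong[OF refl]) (simp only: X_eq)
    also have "\<dots> \<longleftrightarrow> c - c' \<in> \<int> \<and> a - a' \<in> \<int> \<and> b - b' \<in> \<int>"
      unfolding quo_line d coord_lattice neg ..
    also have "\<dots> \<longleftrightarrow> angles s = angles s'" unfolding s angles_eq_iff by blast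
    finally show ?thesis .
  qed
  \<comment> \<open>The translation accumulated per unit of time, in the lattice basis: these are
    the frequencies in the two lattice directions.\<close>
  define c0 c1 where "c0 = coord_m (v1 / T) (v2 / T)" and "c1 = coord_n (v1 / T) (v2 / T)"
  have c01: "v1 / T = c0 + c1 * t1" "v2 / T = c0 + c1 * t2"
    unfolding c0_def c1_def by (rule coord_inverse)+
  have H_flow: "flow r (H (a, b, c)) = H (a + r * c0, b + r * c1, c + r / T)" for r a b c
  proof -
    have cT: "(c + r / T) * T = c * T + r" using T(1) by (simp add: field_simps)
    have cc: "cocycle (c * T + r) p = mul (cocycle (c * T) p) (cocycle r (euler_flow (c * T) p))" by (rule cocycle_add[OF pS])
    have "flow r (H (a, b, c)) = (quo (mul (mul (a + b * t1, a + b * t2, 0) (X c)) (cocycle r (euler_flow (c * T) p))), Jm (euler_flow r (euler_flow (c * T) p)))"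
      unfolding H_def split_conv by (rule flow_eq[OF euler_flow_in_S2[OF pS]])
    also have "euler_flow r (euler_flow (c * T) p) = euler_flow ((c + r / T) * T) p" unfolding cT by (rule euler_flow_add[OF pS, symmetric])
    also have "mul (mul (a + b * t1, a + b * t2, 0) (X c)) (cocycle r (euler_flow (c * T) p))
      = mul (a + b * t1 - c * v1, a + b * t2 - c * v2, 0) (mul g (cocycle ((c + r / T) * T) p))"
      unfolding cT cc X_def by (simp add: mul_simp flip: mul_assoc)
    also have "(a + b * t1 - c * v1, a + b * t2 - c * v2, 0 :: real)
      = mul ((a + r * c0) + (b + r * c1) * t1, (a + r * c0) + (b + r * c1) * t2, 0) (- (c + r / T) * v1, - (c + r / T) * v2, 0)"
    proof -
      have "r / T * v1 = r * (c0 + c1 * t1)" "r / T * v2 = r * (c0 + c1 * t2)" unfolding c01[symmetric] by simp_all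
      then show ?thesis by (simp add: mul_simp algebra_simps)
    qed
    finally show ?thesis unfolding H_def X_def split_conv mul_assoc .
  qed
  have contX: "continuous_on UNIV X"
  proof -
    have "continuous_on UNIV (\<lambda>t. cocycle t p)"
      unfolding cocycle_def by (intro continuous_on_Pair euler_continuous pS)
    then have "continuous_on UNIV (\<lambda>\<tau>. cocycle (\<tau> * T) p)"
      by (rule continuous_on_compose2) (auto intro!: continuous_intros)
    then show ?thesis unfolding X_def by (intro continuous_mul continuous_intros)
  qed
  have contE: "continuous_on UNIV (\<lambda>t. euler_flow t p)"
    unfolding euler_flow_def by (intro continuous_on_Pair euler_continuous pS)
  have contH: "continuous_map euclidean SNT H"
  proof -
    have "continuous_map euclidean SNT (\<lambda>s. (quo (mul (fst s + fst (snd s) * t1, fst s + fst (snd s) * t2, 0) (X (snd (snd s)))), Jm (euler_flow (snd (snd s) * T) p)))"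
    proof (rule continuous_map_SNT)
      have "continuous_on UNIV (\<lambda>s :: r3. X (snd (snd s)))"
        by (rule continuous_on_compose2[OF contX]) (auto intro!: continuous_intros)
      then show "continuous_on UNIV (\<lambda>s. mul (fst s + fst (snd s) * t1, fst s + fst (snd s) * t2, 0) (X (snd (snd s))))"
        by (intro continuous_mul continuous_intros)
      show "continuous_on UNIV (\<lambda>s :: r3. euler_flow (snd (snd s) * T) p)"
        by (rule continuous_on_compose2[OF contE]) (auto intro!: continuous_intros)
    qed (rule euler_flow_in_S2[OF pS])
    then show ?thesis by (simp add: H_def split_beta')
  qed
  \<comment> \<open>The chosen preimage under \<open>angles\<close> does not matter, since
    \<open>H\<close> and \<open>angles\<close> have the same fibres.\<close>
  define h where "h = (\<lambda>z. H (SOME s. angles s = z))"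
  have hH: "h (angles s) = H s" for s
  proof -
    have "angles (SOME s'. angles s' = angles s) = angles s" by (rule someI) (rule refl)
    then show ?thesis unfolding h_def H_eq by simp
  qed
  define A where "A = range H"
  have A_sub: "A \<subseteq> range quo \<times> Jm ` trapped"
    using euler_flow_trapped[OF p] by (auto simp: A_def H_def)
  have A_top: "A \<subseteq> topspace SNT" using A_sub trapped_S2 unfolding topspace_SNT by blast
  have h_img: "h ` topspace (torus 3) = A"
  proof
    show "h ` topspace (torus 3) \<subseteq> A" by (auto simp: A_def h_def)
    show "A \<subseteq> h ` topspace (torus 3)"
    proof
      fix y assume "y \<in> A"
      then obtain s where "y = H s" unfolding A_def by blast
      then have "y = h (angles s)" by (simp add: hH)
      then show "y \<in> h ` topspace (torus 3)" using angles_torus by blast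
    qed
  qed
  have "continuous_map (top_of_set (cbox (0, 0, 0) (1, 1, 1))) SNT (h \<circ> angles)"
    using continuous_map_from_subtopology[OF contH] by (simp add: comp_def hH)
  then have "continuous_map (torus 3) SNT h" by (rule continuous_compose_quotient_map[OF quotient_angles])
  then have conth: "continuous_map (torus 3) (subtopology SNT A) h"
    unfolding continuous_map_in_subtopology using h_img by blast
  have homeo: "homeomorphic_map (torus 3) (subtopology SNT A) h"
  proof (rule continuous_imp_homeomorphic_map[OF conth compact_torus])
    show "Hausdorff_space (subtopology SNT A)" by (rule Hausdorff_space_subtopology[OF Hausdorff_SNT])
    show "h ` topspace (torus 3) = topspace (subtopology SNT A)"
      using h_img A_top by (simp add: topspace_subtopology Int_absorb1)
    show "inj_on h (topspace (torus 3))"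
    proof (rule inj_onI)
      fix z z' assume z: "z \<in> topspace (torus 3)" "z' \<in> topspace (torus 3)" "h z = h z'"
      obtain s where s: "angles s = z" using angles_surj[OF z(1)] by blast
      obtain s' where s': "angles s' = z'" using angles_surj[OF z(2)] by blast
      show "z = z'" using z(3) unfolding s[symmetric] s'[symmetric] hH H_eq .
    qed
  qed
  define \<omega> where "\<omega> = (\<lambda>j::nat. if j = 0 then 2 * pi * c0 else if j = 1 then 2 * pi * c1 else 2 * pi / T)"
  have lin: "linear_torus_flow 3 \<omega> t (angles (a, b, c)) = angles (a + t * c0, b + t * c1, c + t / T)" for t a b c
    by (auto simp: linear_torus_flow_def angles_def \<omega>_def fun_eq_iff cis_mult algebra_simps)
  have "quasi_periodic_torus SNT flow A"
    unfolding quasi_periodic_torus_def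
  proof (intro conjI exI[of _ "3::nat"] exI[of _ \<omega>] exI[of _ h] allI ballI A_top homeo)
    fix t \<theta> assume "\<theta> \<in> topspace (torus 3)"
    then obtain a b c where "\<theta> = angles (a, b, c)" using angles_surj by (metis prod_cases3)
    then show "flow t (h \<theta>) = h (linear_torus_flow 3 \<omega> t \<theta>)" by (simp add: lin hH H_flow)
  qed simp
  moreover have "(quo g, Jm p) \<in> A"
  proof -
    have "H (0, 0, 0) = (quo g, Jm p)" using pS by (simp add: H_def X_def cocycle_0)
    then show ?thesis unfolding A_def by (metis rangeI)
  qed
  ultimately show ?thesis using A_sub by blast
qed

lemma semi_integrable_flow: "semi_integrable SNT flow"
  unfolding semi_integrable_def
proof (rule exI[of _ "range quo \<times> Jm ` trapped"], intro conjI ballI)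
  let ?U = "range quo \<times> Jm ` trapped"
  have "openin (subtopology (Etop 2) (Sph 2)) (Jm ` trapped)"
  proof -
    define W where "W = {p :: r3. 0 < fst (snd p)} \<inter> {p. 0 < (fst p)\<^sup>2 + 2 * (snd (snd p))\<^sup>2} \<inter> {p. (fst p)\<^sup>2 + 2 * (snd (snd p))\<^sup>2 < 1}"
    have "open W" unfolding W_def by (intro open_Int open_Collect_less continuous_intros)
    then have "openin (Etop 2) (Jm ` W)" by (simp add: openin_Etop_iff inj_vimage_image_eq[OF inj_Jm] image_mono)
    moreover have tW: "trapped = W \<inter> S2" by (auto simp: trapped_def W_def)
    have "Jm ` trapped = Jm ` W \<inter> Sph 2" unfolding Sph_eq tW by (rule image_Int[OF inj_Jm])
    ultimately show ?thesis by (auto simp: openin_subtopology)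
  qed
  moreover have "openin NT (range quo)" using openin_topspace[of NT] by (simp add: topspace_NT)
  ultimately show "openin SNT ?U" by (simp add: SNtop_def openin_prod_Times_iff)
  have "(1/2, sqrt (3/4), 0) \<in> trapped" by (simp add: trapped_def power2_eq_square)
  then show "?U \<noteq> {}" by blast
  fix x assume "x \<in> ?U"
  then obtain g p where "x = (quo g, Jm p)" "p \<in> trapped" by blast
  then show "\<exists>T. x \<in> T \<and> T \<subseteq> ?U \<and> quasi_periodic_torus SNT flow T" using trapped_torus by simp
qed

section \<open>Entropy\<close>

text \<open>The subadditive lemma, by division with remainder by an \<open>m\<close> whose quotient
  is nearly the infimum. Convergence matters here because \<open>metric_entropy\<close> is defined
  with \<open>lim\<close>, which carries no information about a sequence not known to
  converge.\<close>

lemma fekete: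
  fixes a :: "nat \<Rightarrow> real"
  assumes sub: "\<And>m n. a (m + n) \<le> a m + a n" and nonneg: "\<And>n. 0 \<le> a n"
  shows "convergent (\<lambda>n. a n / real n)"
proof -
  define L where "L = (INF m\<in>{1..}. a m / real m)"
  have bdd: "bdd_below ((\<lambda>m. a m / real m) ` {1..})" using nonneg by (intro bdd_belowI[of _ 0]) auto
  have L: "L \<le> a n / real n" if "n \<ge> 1" for n unfolding L_def using that bdd by (intro cINF_lower) auto
  have mult: "a (q * m + r) \<le> real q * a m + a r" for q m r
  proof (induction q)
    case (Suc q)
    have "a (Suc q * m + r) \<le> a m + a (q * m + r)" using sub[of m "q * m + r"] by (simp add: add.assoc)
    then show ?case using Suc by (simp add: algebra_simps)
  qed simp
  have "(\<lambda>n. a n / real n) \<longlonglongrightarrow> L"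
  proof (rule LIMSEQ_I)
    fix e :: real assume e: "0 < e"
    have "L < L + e / 2" using e by simp
    then obtain m where m: "m \<ge> 1" "a m / real m < L + e / 2"
      using bdd unfolding L_def by (subst (asm) cINF_less_iff) auto
    define C where "C = Max (a ` {..<m})"
    have C: "a r \<le> C" if "r < m" for r unfolding C_def using that by (intro Max_ge) auto
    have C0: "0 \<le> C" using C[of 0] nonneg[of 0] m(1) by simp
    show "\<exists>no. \<forall>n\<ge>no. norm (a n / real n - L) < e"
    proof (intro exI allI impI)
      fix n assume n: "n \<ge> max 1 (nat \<lceil>2 * C / e\<rceil> + 1)"
      define q r where "q = n div m" and "r = n mod m"
      have qr: "n = q * m + r" "r < m" using m(1) by (auto simp: q_def r_def)
      have n0: "real n > 0" using n by simp
      have "a n \<le> real q * a m + C" using mult[of q m r] C[OF qr(2)] qr(1) by simp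
      also have "real q * a m = real (q * m) * (a m / real m)" using m(1) by simp
      also have "\<dots> \<le> real n * (a m / real m)" using qr(1) nonneg[of m] by (intro mult_right_mono) auto
      finally have "a n \<le> real n * (a m / real m) + C" by simp
      then have "a n / real n \<le> a m / real m + C / real n" using n0 by (simp add: field_simps)
      moreover have "C / real n < e / 2"
      proof -
        have "2 * C / e < real n" using n by linarith
        then show ?thesis using e n0 by (simp add: field_simps)
      qed
      ultimately have "a n / real n < L + e" using m(2) by linarith
      moreover have "L \<le> a n / real n" using n by (intro L) simp
      ultimately show "norm (a n / real n - L) < e" by simp
    qed
  qed
  then show ?thesis by (rule convergentI)
qed

context prob_space
begin

lemma info_space: "information_space M (exp 1)"
  by standard simp

lemma partition_entropy_sum:
  assumes "simple_function M X"
  shows "partition_entropy M X = (\<Sum>a\<in>X ` space M. - (prob (X -` {a} \<inter> space M) * ln (prob (X -` {a} \<inter> space M))))"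
  unfolding partition_entropy_def
  using information_space.entropy_simple_distributed[OF info_space simple_distributedI[OF assms measure_nonneg refl]]
  by (simp add: log_def sum_negf)

lemma entropy_term_nonneg: "0 \<le> - (prob A * ln (prob A))"
  by (cases "prob A = 0") (auto simp: mult_le_0_iff zero_less_measure_iff)

lemma partition_entropy_nonneg: "simple_function M X \<Longrightarrow> 0 \<le> partition_entropy M X"
  unfolding partition_entropy_sum by (intro sum_nonneg entropy_term_nonneg)

lemma partition_entropy_Pair:
  assumes X: "simple_function M X" and Y: "simple_function M Y"
  shows "partition_entropy M (\<lambda>x. (X x, Y x)) \<le> partition_entropy M X + partition_entropy M Y"
  using information_space.entropy_chain_rule[OF info_space X Y]
    information_space.conditional_entropy_less_eq_entropy[OF info_space Y X]
  by (simp add: partition_entropy_def)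

lemma partition_entropy_comp:
  assumes X: "simple_function M X"
  shows "partition_entropy M (f \<circ> X) \<le> partition_entropy M X"
  using information_space.entropy_data_processing[OF info_space X, of f] by (simp add: partition_entropy_def)

text \<open>The atoms of the composed partition are preimages of atoms and have the same
  probability. Labels not attained after composition contribute nonnegative terms on the right, and
  the inequality suffices for subadditivity.\<close>

lemma partition_entropy_preserves:
  assumes T: "preserves M T" and X: "simple_function M X"
  shows "simple_function M (\<lambda>x. X (T x))" "partition_entropy M (\<lambda>x. X (T x)) \<le> partition_entropy M X"
proof -
  have Tm: "T \<in> measurable M M" using T by (simp add: preserves_def)
  have sub: "(\<lambda>x. X (T x)) ` space M \<subseteq> X ` space M" using measurable_space[OF Tm] by auto
  have fin: "finite (X ` space M)" using X by (rule simple_functionD)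
  have pre: "(\<lambda>x. X (T x)) -` {a} \<inter> space M = T -` (X -` {a} \<inter> space M) \<inter> space M" for a
    using measurable_space[OF Tm] by auto
  have Xs: "X -` {a} \<inter> space M \<in> sets M" for a using X by (rule simple_functionD)
  show s: "simple_function M (\<lambda>x. X (T x))"
    unfolding simple_function_def
  proof (intro conjI ballI)
    show "finite ((\<lambda>x. X (T x)) ` space M)" using sub fin by (rule finite_subset)
    show "(\<lambda>x. X (T x)) -` {a} \<inter> space M \<in> sets M" for a unfolding pre by (rule measurable_sets[OF Tm Xs])
  qed
  have pr: "prob ((\<lambda>x. X (T x)) -` {a} \<inter> space M) = prob (X -` {a} \<inter> space M)" for a
    unfolding pre using preserves_emeasure[OF T Xs] by (simp add: measure_def)
  show "partition_entropy M (\<lambda>x. X (T x)) \<le> partition_entropy M X"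
    unfolding partition_entropy_sum[OF s] partition_entropy_sum[OF X] pr
    by (rule sum_mono2[OF fin sub]) (rule entropy_term_nonneg)
qed

lemma preserves_funpow: "preserves M T \<Longrightarrow> preserves M (T ^^ n)"
proof (induction n)
  case 0
  show ?case using distr_id2[of M M] by (simp add: preserves_def id_def)
next
  case (Suc n)
  show ?case unfolding funpow.simps by (rule preserves_comp[OF Suc.prems Suc.IH[OF Suc.prems]])
qed

lemma simple_function_itinerary:
  assumes T: "preserves M T" and P: "simple_function M P"
  shows "simple_function M (itinerary T P m)"
proof (induction m)
  case 0 then show ?case by (simp add: itinerary_def[abs_def])
next
  case (Suc m)
  have "simple_function M (\<lambda>x. (itinerary T P m x, P ((T ^^ m) x)))"
    by (intro simple_function_Pair Suc partition_entropy_preserves(1)[OF preserves_funpow[OF T] P])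
  from simple_function_compose[OF this, of "\<lambda>(a, b). a @ [b]"]
  show ?case by (simp add: itinerary_def[abs_def] comp_def)
qed

lemma itinerary_add: "itinerary T P (m + n) x = itinerary T P m x @ itinerary T P n ((T ^^ m) x)"
proof -
  have "[0..<m + n] = [0..<m] @ map (\<lambda>i. i + m) [0..<n]"
    using upt_add_eq_append[of 0 m n] map_add_upt[of m n] by (simp add: add.commute)
  then show ?thesis by (simp add: itinerary_def funpow_add)
qed

text \<open>An itinerary of length \<open>m + n\<close> is the concatenation of one of length
  \<open>m\<close> and one of length \<open>n\<close> started \<open>m\<close> steps later; entropy
  is subadditive for pairs and does not grow under composition with a preserving map.\<close>

lemma itinerary_entropy_convergent:
  assumes T: "preserves M T" and P: "simple_function M P"
  shows "convergent (\<lambda>m. partition_entropy M (itinerary T P m) / real m)"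
proof (rule fekete)
  fix m n
  note s = simple_function_itinerary[OF T P]
  note p = partition_entropy_preserves[OF preserves_funpow[OF T, of m] s[of n]]
  have "itinerary T P (m + n) = (\<lambda>(a, b). a @ b) \<circ> (\<lambda>x. (itinerary T P m x, itinerary T P n ((T ^^ m) x)))"
    by (auto simp: itinerary_add fun_eq_iff)
  then have "partition_entropy M (itinerary T P (m + n)) \<le> partition_entropy M (\<lambda>x. (itinerary T P m x, itinerary T P n ((T ^^ m) x)))"
    using partition_entropy_comp[OF simple_function_Pair[OF s p(1)]] by simp
  also have "\<dots> \<le> partition_entropy M (itinerary T P m) + partition_entropy M (\<lambda>x. itinerary T P n ((T ^^ m) x))"
    by (rule partition_entropy_Pair[OF s p(1)])
  also have "\<dots> \<le> partition_entropy M (itinerary T P m) + partition_entropy M (itinerary T P n)"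
    using p(2) by simp
  finally show "partition_entropy M (itinerary T P (m + n)) \<le> partition_entropy M (itinerary T P m) + partition_entropy M (itinerary T P n)" .
qed (intro partition_entropy_nonneg simple_function_itinerary T P)

text \<open>An atom of probability \<open>p \<le> r\<close> contributes
  \<open>p * (- ln p) \<ge> p * (- ln r)\<close>; summing over the labels in \<open>G\<close> gives
  the bound, and the other terms are nonnegative.\<close>

lemma partition_entropy_lower:
  assumes X: "simple_function M X" and r: "r > 0"
    and small: "\<And>a. a \<in> G \<Longrightarrow> prob (X -` {a} \<inter> space M) \<le> r"
  shows "prob (X -` G \<inter> space M) * (- ln r) \<le> partition_entropy M X"
proof -
  have fin: "finite (X ` space M)" using X by (rule simple_functionD)
  have Xs: "X -` {a} \<inter> space M \<in> sets M" for a using X by (rule simple_functionD)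
  let ?p = "\<lambda>a. prob (X -` {a} \<inter> space M)"
  have "X -` G \<inter> space M = (\<Union>a\<in>X ` space M \<inter> G. X -` {a} \<inter> space M)" by blast
  moreover have "prob (\<Union>a\<in>X ` space M \<inter> G. X -` {a} \<inter> space M) = (\<Sum>a\<in>X ` space M \<inter> G. ?p a)"
    by (rule finite_measure_finite_Union) (use fin Xs in \<open>auto simp: disjoint_family_on_def\<close>)
  ultimately have "prob (X -` G \<inter> space M) = (\<Sum>a\<in>X ` space M \<inter> G. ?p a)" by simp
  then have "prob (X -` G \<inter> space M) * (- ln r) = (\<Sum>a\<in>X ` space M \<inter> G. ?p a * (- ln r))"
    by (simp only: sum_distrib_right)
  also have "\<dots> \<le> (\<Sum>a\<in>X ` space M \<inter> G. - (?p a * ln (?p a)))"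
  proof (rule sum_mono)
    fix a assume a: "a \<in> X ` space M \<inter> G"
    show "?p a * (- ln r) \<le> - (?p a * ln (?p a))"
    proof (cases "?p a = 0")
      case False
      then have pos: "?p a > 0" by (simp add: zero_less_measure_iff)
      then have "ln (?p a) \<le> ln r" using small[of a] a by simp
      then show ?thesis using pos by simp
    qed simp
  qed
  also have "\<dots> \<le> (\<Sum>a\<in>X ` space M. - (?p a * ln (?p a)))"
    using fin entropy_term_nonneg by (intro sum_mono2) auto
  finally show ?thesis by (simp add: partition_entropy_sum[OF X])
qed

text \<open>Exponentially small atoms filling a fixed set \<open>A\<close> give entropy at least
  \<open>prob A * (c * m - ln K)\<close> for itineraries of length \<open>m\<close>, hence the rate
  \<open>prob A * c\<close>. Control of the atoms outside \<open>A\<close> does not enter.\<close>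

lemma metric_entropy_pos:
  fixes P :: "'a \<Rightarrow> nat"
  assumes T: "preserves M T" and P: "simple_function M P"
    and K: "K > 0" and c: "c > 0" and pos: "prob A > 0"
    and G: "\<And>m. m \<ge> 1 \<Longrightarrow> itinerary T P m -` G m \<inter> space M = A"
    and small: "\<And>m a. m \<ge> 1 \<Longrightarrow> a \<in> G m \<Longrightarrow> prob (itinerary T P m -` {a} \<inter> space M) \<le> K * exp (- c * real m)"
  shows "0 < metric_entropy M T"
proof -
  let ?h = "\<lambda>m. partition_entropy M (itinerary T P m) / real m"
  note s = simple_function_itinerary[OF T P]
  have lower: "prob A * (c - ln K / real m) \<le> ?h m" if "m \<ge> 1" for m
  proof -
    have "prob A * (- ln (K * exp (- c * real m))) \<le> partition_entropy M (itinerary T P m)"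
      using partition_entropy_lower[OF s[of m], of "K * exp (- c * real m)" "G m"] K small[OF that] G[OF that] by simp
    also have "- ln (K * exp (- c * real m)) = real m * (c - ln K / real m)"
      using K that by (simp add: ln_mult field_simps)
    finally show ?thesis using that by (simp add: field_simps)
  qed
  have "(\<lambda>m. ln K / real m) \<longlonglongrightarrow> 0" by (rule lim_const_over_n)
  then have "(\<lambda>m. prob A * (c - ln K / real m)) \<longlonglongrightarrow> prob A * (c - 0)" by (intro tendsto_intros)
  moreover have "?h \<longlonglongrightarrow> lim ?h" using itinerary_entropy_convergent[OF T P] by (simp add: convergent_LIMSEQ_iff)
  ultimately have "prob A * (c - 0) \<le> lim ?h"
    by (rule LIMSEQ_le) (use lower in blast)
  moreover have "0 < prob A * c" using pos c by simp
  ultimately have "0 < ereal (lim ?h)" by simp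
  also have "\<dots> \<le> metric_entropy M T" unfolding metric_entropy_def using P by (intro SUP_upper2[of P]) auto
  finally show ?thesis .
qed

end

section \<open>The drifting region and the coding of its orbits\<close>

text \<open>A cap around \<open>(0, 0, 1)\<close> inside the separatrix
  \<open>x\<^sup>2 + 2 * y\<^sup>2 = 1\<close>. The level \<open>3 / 4\<close> leaves
  \<open>e\<^sup>2 \<ge> 1 / 4\<close> on the sphere, so \<open>u\<close> grows at speed at least
  \<open>1 / 2\<close>.\<close>

definition drifting :: "r3 set" where
  "drifting = {(x, y, e). (x, y, e) \<in> S2 \<and> e > 0 \<and> x\<^sup>2 + 2 * y\<^sup>2 \<le> 3 / 4}"

lemma drifting_S2: "p \<in> drifting \<Longrightarrow> p \<in> S2" by (auto simp: drifting_def)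

lemma euler_flow_drifting:
  assumes p: "p \<in> drifting"
  shows "euler_flow t p \<in> drifting" "1 / 2 \<le> euler_e p t"
proof -
  obtain x y e where pe: "p = (x, y, e)" by (cases p)
  note pS = drifting_S2[OF p]
  have i: "euler_x p 0 = x" "euler_y p 0 = y" "euler_e p 0 = e" using euler_curve(2)[OF pS] pe by auto
  have P: "e > 0" "x\<^sup>2 + 2 * y\<^sup>2 \<le> 3 / 4" using p by (auto simp: drifting_def pe)
  have c: "(euler_x p t)\<^sup>2 + 2 * (euler_y p t)\<^sup>2 = x\<^sup>2 + 2 * y\<^sup>2" for t
    using euler_sol_conserved(2)[OF euler_curve(1)[OF pS], of t] by (simp add: i)
  have s: "(euler_x p t)\<^sup>2 + (euler_y p t)\<^sup>2 + (euler_e p t)\<^sup>2 = 1" for t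
    using euler_flow_in_S2[OF pS, of t] by (simp add: euler_flow_def)
  have sq: "1 / 4 \<le> (euler_e p t)\<^sup>2" for t
    using c[of t] s[of t] P(2) zero_le_power2[of "euler_y p t"] by linarith
  then have ne: "euler_e p t \<noteq> 0" for t by (metis power_zero_numeral not_le zero_less_divide_1_iff zero_less_numeral)
  have pos: "euler_e p t > 0"
  proof (rule ccontr)
    assume "\<not> euler_e p t > 0"
    then have n: "euler_e p t < 0" using ne[of t] by simp
    have "connected (euler_e p ` UNIV)" by (intro connected_continuous_image euler_continuous pS) simp
    then have "{euler_e p t..euler_e p 0} \<subseteq> euler_e p ` UNIV" by (rule connected_contains_Icc) auto
    moreover have "0 \<in> {euler_e p t..euler_e p 0}" using n P(1) i by simp
    ultimately have "0 \<in> euler_e p ` UNIV" by blast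
    then show False using ne by auto
  qed
  then show "euler_flow t p \<in> drifting" using c[of t] s[of t] P by (simp add: drifting_def euler_flow_def)
  have "(1 / 2)\<^sup>2 \<le> (euler_e p t)\<^sup>2" using sq[of t] by (simp add: power2_eq_square)
  then show "1 / 2 \<le> euler_e p t" using pos by (rule power2_le_imp_le[OF _ less_imp_le])
qed

lemma drift_growth:
  assumes p: "p \<in> drifting" and t: "t \<ge> 0"
  shows "t / 2 \<le> drift p t"
proof -
  note pS = drifting_S2[OF p]
  have "drift p 0 - 0 / 2 \<le> drift p t - t / 2"
  proof (rule DERIV_nonneg_imp_nondecreasing[OF t])
    fix s
    have "((\<lambda>t. drift p t - t / 2) has_real_derivative euler_e p s - 1 / 2) (at s)"
      by (auto intro!: derivative_eq_intros drift(2)[OF pS])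
    then show "\<exists>y. ((\<lambda>t. drift p t - t / 2) has_real_derivative y) (at s) \<and> 0 \<le> y"
      using euler_flow_drifting(2)[OF p, of s] by (intro exI conjI) auto
  qed
  then show ?thesis by (simp add: drift(1)[OF pS])
qed

lemma drift_step:
  assumes p: "p \<in> S2"
  shows "\<bar>drift p (t + 1) - drift p t\<bar> \<le> 1"
proof -
  have "drift p (t + 1) = drift p t + drift (euler_flow t p) 1"
    using cocycle_add[OF p, of t 1] by (simp add: cocycle_def mul_simp)
  then show ?thesis using drift_le[OF euler_flow_in_S2[OF p], of t 1] by simp
qed

text \<open>Four bins for the lattice coordinate in \<open>[0, 1)\<close>, and the separate value
  \<open>4\<close> off the drifting region. The bin width is matched to the expansion, which is at
  most 3 per unit of time: points within \<open>1 / 4\<close> are within \<open>3 / 4\<close> one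
  step later, and a true difference of at most \<open>3 / 4\<close> cannot be mistaken modulo 1 for
  another one below \<open>1 / 4\<close>.\<close>

definition label :: "sn_point \<Rightarrow> nat" where
  "label x = (if Jinv (snd x) \<in> drifting then nat \<lfloor>4 * coord_n (fst (sec (fst x))) (fst (snd (sec (fst x))))\<rfloor> else 4)"

lemma exp_l1_bounds: "1 < exp (- l1)" "exp (- l1) \<le> 3"
proof -
  have "1 < sqrt 5" by (rule real_less_rsqrt) simp
  moreover have "sqrt 5 \<le> 3" by (rule real_le_lsqrt) simp_all
  moreover have "2 * t1 = 1 - sqrt 5" by (simp add: t1_def)
  ultimately have "1 < 2 - t1" "2 - t1 \<le> 3" by - linarith+
  then show "1 < exp (- l1)" "exp (- l1) \<le> 3" by (simp_all add: exp_neg_l)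
qed

text \<open>Bringing the height into \<open>[0, 1)\<close> forces the power
  \<open>- \<lfloor>u\<rfloor>\<close> of the monodromy, and the lattice translation that remains
  changes the coordinate by an integer.\<close>

lemma coord_n_sec:
  "\<exists>n::int. coord_n (fst (sec (quo (a, b, u)))) (fst (snd (sec (quo (a, b, u)))))
    = of_int n + coord_n (exp (- of_int \<lfloor>u\<rfloor> * l1) * a) (exp (- of_int \<lfloor>u\<rfloor> * l2) * b)"
proof -
  have "quo (sec (quo (a, b, u))) = quo (a, b, u)" by (rule sec(2)) simp
  then obtain g where g: "g \<in> Gam3" "sec (quo (a, b, u)) = mul g (a, b, u)" by (metis quo_eq_iff)
  obtain m n k :: int where ge: "g = (of_int m + of_int n * t1, of_int m + of_int n * t2, of_int k)" using g(1) by (auto simp: Gam3_def)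
  have se: "sec (quo (a, b, u)) = (of_int m + of_int n * t1 + exp (of_int k * l1) * a, of_int m + of_int n * t2 + exp (of_int k * l2) * b, of_int k + u)"
    by (simp add: g(2) ge mul_simp)
  have "sec (quo (a, b, u)) \<in> D0" by (rule sec(1)) simp
  then have "0 \<le> of_int k + u" "of_int k + u < 1" unfolding se D0_def by auto
  then have "\<lfloor>u\<rfloor> = - k" by linarith
  then have k: "of_int k = - real_of_int \<lfloor>u\<rfloor>" by simp
  show ?thesis
    unfolding se fst_conv snd_conv coord_add(1)[of "of_int m + of_int n * t1" _ "of_int m + of_int n * t2"] coord_lattice k by blast
qed

lemma sec_coord_bounds:
  assumes "C \<in> range quo"
  shows "0 \<le> coord_n (fst (sec C)) (fst (snd (sec C)))" "coord_n (fst (sec C)) (fst (snd (sec C))) < 1"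
  using sec(1)[OF assms] by (auto simp: D0_def)

text \<open>Equal labels bound the difference of the reduced coordinates by \<open>1 / 4\<close>,
  and this difference is an integer plus the expanded displacement. The a priori bound
  \<open>3 / 4\<close> forces the integer to be zero.\<close>

lemma label_separation:
  assumes z: "z \<in> drifting" and eq: "label (quo (a, b, u), Jm z) = label (quo (a + s, b, u), Jm z)"
    and s: "\<bar>s\<bar> * exp (- of_int \<lfloor>u\<rfloor> * l1) / sqrt 5 \<le> 3 / 4"
  shows "\<bar>s\<bar> * exp (- of_int \<lfloor>u\<rfloor> * l1) / sqrt 5 \<le> 1 / 4"
proof -
  define E where "E = exp (- of_int \<lfloor>u\<rfloor> * l1)"
  define X where "X = coord_n (fst (sec (quo (a, b, u)))) (fst (snd (sec (quo (a, b, u)))))"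
  define Y where "Y = coord_n (fst (sec (quo (a + s, b, u)))) (fst (snd (sec (quo (a + s, b, u)))))"
  obtain n where n: "X = of_int n + coord_n (E * a) (exp (- of_int \<lfloor>u\<rfloor> * l2) * b)"
    using coord_n_sec[of a b u] unfolding X_def E_def by blast
  obtain m where m: "Y = of_int m + coord_n (E * (a + s)) (exp (- of_int \<lfloor>u\<rfloor> * l2) * b)"
    using coord_n_sec[of "a + s" b u] unfolding Y_def E_def by blast
  define d where "d = E * s / sqrt 5"
  have XY: "X - Y = of_int (n - m) + d"
    unfolding n m coord_n_def d_def by (simp add: algebra_simps diff_divide_distrib add_divide_distrib)
  have bX: "0 \<le> X" "X < 1" "0 \<le> Y" "Y < 1" using sec_coord_bounds unfolding X_def Y_def by blast+
  have "nat \<lfloor>4 * X\<rfloor> = nat \<lfloor>4 * Y\<rfloor>" using eq z by (simp add: label_def X_def Y_def)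
  moreover have "0 \<le> \<lfloor>4 * X\<rfloor>" "0 \<le> \<lfloor>4 * Y\<rfloor>" using bX by simp_all
  ultimately have "\<lfloor>4 * X\<rfloor> = \<lfloor>4 * Y\<rfloor>" using eq_nat_nat_iff by blast
  then have "\<bar>4 * X - 4 * Y\<bar> < 1" by linarith
  then have c: "\<bar>X - Y\<bar> < 1 / 4" by linarith
  have dE: "\<bar>s\<bar> * exp (- of_int \<lfloor>u\<rfloor> * l1) / sqrt 5 = \<bar>d\<bar>"
    unfolding d_def E_def[symmetric] by (simp add: abs_mult abs_divide E_def mult.commute)
  then have "\<bar>d\<bar> \<le> 3 / 4" using s by simp
  then have "\<bar>real_of_int (n - m)\<bar> < 1" using c XY by linarith
  then have "n - m = 0" by linarith
  then have "\<bar>d\<bar> < 1 / 4" using c XY by simp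
  then show ?thesis using dE by simp
qed

lemma itinerary_nth: "i < m \<Longrightarrow> itinerary T P m x ! i = P ((T ^^ i) x)"
  by (simp add: itinerary_def)

text \<open>The solution for \<open>s\<close> of
  \<open>s * exp (- (m / 2 - 3 / 2) * l1) / sqrt 5 = 1 / 4\<close>: at time \<open>m - 1\<close> the
  integer part of the height is at least \<open>m / 2 - 3 / 2\<close>.\<close>

definition contraction :: "nat \<Rightarrow> real" where
  "contraction m = sqrt 5 / 4 * exp (- 3 / 2 * l1) * exp (l1 / 2 * real m)"

text \<open>The two orbits use the same cocycle, so their displacement stays equal to
  \<open>s\<close> in the group; only the reduction to the fundamental domain expands it. Equal
  labels keep the expanded displacement below \<open>1 / 4\<close> at every step, and at the last
  step the expansion is exponentially large in \<open>m\<close>.\<close>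

lemma itinerary_separation:
  assumes z: "z \<in> drifting" and u: "0 \<le> u" "u < 1" and m: "m \<ge> 1" and s: "\<bar>s\<bar> \<le> 1 / 2"
    and eq: "itinerary (flow 1) label m (quo (a, b, u), Jm z) = itinerary (flow 1) label m (quo (a + s, b, u), Jm z)"
  shows "\<bar>s\<bar> \<le> contraction m"
proof -
  note zS = drifting_S2[OF z]
  have l1: "l1 < 0" using exp_l1_bounds(1) by simp
  define k where "k = (\<lambda>i::nat. \<lfloor>u + drift z (real i)\<rfloor>)"
  have st: "(flow 1 ^^ i) (quo (a', b, u), Jm z) = (quo (a' + exp (u * l1) * fibre1 l1 z (real i), b + exp (u * l2) * fibre2 l2 z (real i), u + drift z (real i)), Jm (euler_flow (real i) z))" for i a'
    by (simp add: flow_power[OF zS] flow_eq[OF zS] cocycle_def mul_simp)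
  have main: "\<bar>s\<bar> * exp (- of_int (k i) * l1) / sqrt 5 \<le> 1 / 4" if "i < m" for i
    using that
  proof (induction i)
    case 0
    \<comment> \<open>At time \<open>0\<close> the height lies in \<open>[0, 1)\<close>, so there is
      no expansion yet, and \<open>1 / 2\<close> is at most \<open>sqrt 5 / 4\<close>.\<close>
    have "k 0 = 0" using u by (simp add: k_def drift(1)[OF zS]) linarith
    moreover have "2 \<le> sqrt (5::real)" by (rule real_le_rsqrt) simp
    then have "\<bar>s\<bar> \<le> 1 / 4 * sqrt 5" using s by linarith
    then have "\<bar>s\<bar> / sqrt 5 \<le> 1 / 4" by (subst pos_divide_le_eq) simp_all
    ultimately show ?case by simp
  next
    case (Suc i)
    have "drift z (real (Suc i)) \<le> drift z (real i) + 1" using drift_step[OF zS, of "real i"] by (simp add: add.commute)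
    then have "k (Suc i) \<le> k i + 1" unfolding k_def by linarith
    then have "- of_int (k (Suc i)) * l1 \<le> - of_int (k i) * l1 + (- l1)"
      using mult_right_mono_neg[of "of_int (k (Suc i))" "of_int (k i) + 1" l1] l1 
        mult_right_mono[of "of_int (k (Suc i))" "of_int (k i) + 1" "- l1"] by (simp add: algebra_simps)
    then have "exp (- of_int (k (Suc i)) * l1) \<le> exp (- of_int (k i) * l1) * exp (- l1)"
      by (simp only: exp_add[symmetric] exp_le_cancel_iff)
    also have "\<dots> \<le> exp (- of_int (k i) * l1) * 3" using exp_l1_bounds by (intro mult_left_mono) auto
    finally have "\<bar>s\<bar> * exp (- of_int (k (Suc i)) * l1) / sqrt 5 \<le> \<bar>s\<bar> * (exp (- of_int (k i) * l1) * 3) / sqrt 5"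
      by (intro divide_right_mono mult_left_mono) auto
    also have "\<dots> = (\<bar>s\<bar> * exp (- of_int (k i) * l1) / sqrt 5) * 3" by simp
    also have "\<dots> \<le> 1 / 4 * 3" using Suc.IH Suc.prems by (intro mult_right_mono) auto
    finally have le: "\<bar>s\<bar> * exp (- of_int (k (Suc i)) * l1) / sqrt 5 \<le> 3 / 4" by simp
    have "label ((flow 1 ^^ Suc i) (quo (a, b, u), Jm z)) = label ((flow 1 ^^ Suc i) (quo (a + s, b, u), Jm z))"
      using arg_cong[OF eq, of "\<lambda>l. l ! Suc i"] Suc.prems by (simp only: itinerary_nth)
    then have leq: "label (quo (a + exp (u * l1) * fibre1 l1 z (real (Suc i)), b + exp (u * l2) * fibre2 l2 z (real (Suc i)), u + drift z (real (Suc i))), Jm (euler_flow (real (Suc i)) z))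
      = label (quo (a + exp (u * l1) * fibre1 l1 z (real (Suc i)) + s, b + exp (u * l2) * fibre2 l2 z (real (Suc i)), u + drift z (real (Suc i))), Jm (euler_flow (real (Suc i)) z))"
      unfolding st by (simp only: add_ac)
    show ?case
      using label_separation[OF euler_flow_drifting(1)[OF z] leq] le unfolding k_def by blast
  qed
  have k: "real m / 2 - 3 / 2 \<le> of_int (k (m - 1))"
  proof -
    have "real (m - 1) / 2 \<le> drift z (real (m - 1))" by (rule drift_growth[OF z]) simp
    moreover have "real (m - 1) = real m - 1" using m by simp
    moreover have "u + drift z (real (m - 1)) - 1 \<le> of_int (k (m - 1))" unfolding k_def by linarith
    ultimately show ?thesis using u(1) by (simp add: diff_divide_distrib)
  qed
  have "- (real m / 2 - 3 / 2) * l1 \<le> - of_int (k (m - 1)) * l1"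
  proof -
    have "(real m / 2 - 3 / 2) * (- l1) \<le> of_int (k (m - 1)) * (- l1)" by (rule mult_right_mono[OF k]) (use l1 in simp)
    then show ?thesis by (simp only: mult_minus_left mult_minus_right)
  qed
  then have "exp (- (real m / 2 - 3 / 2) * l1) \<le> exp (- of_int (k (m - 1)) * l1)" by simp
  then have "\<bar>s\<bar> * exp (- (real m / 2 - 3 / 2) * l1) / sqrt 5 \<le> \<bar>s\<bar> * exp (- of_int (k (m - 1)) * l1) / sqrt 5"
    by (intro divide_right_mono mult_left_mono) auto
  also have "\<dots> \<le> 1 / 4" using main[of "m - 1"] m by simp
  finally have "\<bar>s\<bar> * exp (- (real m / 2 - 3 / 2) * l1) \<le> sqrt 5 / 4" by (simp add: field_simps)
  then have "\<bar>s\<bar> \<le> sqrt 5 / 4 * exp ((real m / 2 - 3 / 2) * l1)"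
    by (simp add: exp_minus field_simps)
  also have "\<dots> = contraction m" unfolding contraction_def
    by (simp add: mult.assoc flip: exp_add) (simp add: algebra_simps)
  finally show ?thesis .
qed

section \<open>Measure of the itinerary atoms\<close>

text \<open>Twelve intervals of length \<open>1 / 2\<close> cover \<open>[- 3, 3]\<close>; within
  one of them the set lies in the ball of radius \<open>R\<close> around any of its points, which
  has length \<open>2 * R\<close>.\<close>

lemma separated_set_measure:
  fixes Z :: "real set"
  assumes Z: "Z \<in> sets borel" "Z \<subseteq> {-3..3}" and R: "R \<ge> 0"
    and sep: "\<And>x y. x \<in> Z \<Longrightarrow> y \<in> Z \<Longrightarrow> \<bar>x - y\<bar> \<le> 1 / 2 \<Longrightarrow> \<bar>x - y\<bar> \<le> R"
  shows "emeasure lborel Z \<le> ennreal (24 * R)"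
proof -
  define I where "I = (\<lambda>j::nat. {-3 + real j / 2..-3 + real j / 2 + 1/2})"
  have cover: "Z \<subseteq> (\<Union>j<12. Z \<inter> I j)"
  proof
    fix x assume x: "x \<in> Z"
    then have b: "-3 \<le> x" "x \<le> 3" using Z(2) by auto
    \<comment> \<open>The right endpoint \<open>3\<close> would receive the index \<open>12\<close>;
      it is assigned to the last closed interval instead.\<close>
    define j where "j = (if x = 3 then 11 else nat \<lfloor>2 * x + 6\<rfloor>)"
    have "j < 12 \<and> x \<in> I j"
    proof (cases "x = 3")
      case True then show ?thesis by (simp add: j_def I_def)
    next
      case False
      define q where "q = \<lfloor>2 * x + 6\<rfloor>"
      have q: "of_int q \<le> 2 * x + 6" "2 * x + 6 < of_int q + 1" unfolding q_def by linarith+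
      have "0 \<le> q" "q < 12" using b False q by - linarith+
      then have "j < 12" "real j = of_int q" using False by (simp_all add: j_def q_def[symmetric])
      then show ?thesis using q unfolding I_def by simp
    qed
    then show "x \<in> (\<Union>j<12. Z \<inter> I j)" using x by blast
  qed
  have piece: "emeasure lborel (Z \<inter> I j) \<le> ennreal (2 * R)" for j
  proof (cases "Z \<inter> I j = {}")
    case False
    then obtain x where x: "x \<in> Z" "x \<in> I j" by blast
    have "Z \<inter> I j \<subseteq> {x - R..x + R}"
    proof
      fix y assume y: "y \<in> Z \<inter> I j"
      then have "-3 + real j / 2 \<le> x" "x \<le> -3 + real j / 2 + 1 / 2" "-3 + real j / 2 \<le> y" "y \<le> -3 + real j / 2 + 1 / 2"
        using x(2) unfolding I_def by auto
      then have "\<bar>x - y\<bar> \<le> 1 / 2" by linarith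
      then have "\<bar>x - y\<bar> \<le> R" using sep x(1) y by blast
      then show "y \<in> {x - R..x + R}" by auto
    qed
    then have "emeasure lborel (Z \<inter> I j) \<le> emeasure lborel {x - R..x + R}" by (intro emeasure_mono) auto
    also have "\<dots> = ennreal (2 * R)" using R by simp
    finally show ?thesis .
  qed simp
  have "emeasure lborel Z \<le> emeasure lborel (\<Union>j<12. Z \<inter> I j)"
    using cover Z by (intro emeasure_mono) (auto simp: I_def)
  also have "\<dots> \<le> (\<Sum>j<12. emeasure lborel (Z \<inter> I j))"
    using Z by (intro emeasure_subadditive_finite) (auto simp: I_def)
  also have "\<dots> \<le> (\<Sum>j<(12::nat). ennreal (2 * R))" by (intro sum_mono piece)
  also have "\<dots> = ennreal (24 * R)" using R by (simp add: ennreal_mult'[symmetric] flip: ennreal_numeral)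
  finally show ?thesis .
qed

lemma open_pos_lborel:
  fixes V :: "'a::euclidean_space set"
  assumes "open V" "V \<noteq> {}"
  shows "emeasure lborel V > 0"
proof (rule ccontr)
  assume "\<not> emeasure lborel V > 0"
  then have "V \<in> null_sets lborel" using assms(1) by (auto intro: null_setsI)
  then have "negligible V" using null_sets_completionI[of V lborel] negligible_iff_null_sets[of V] by simp
  then show False using open_not_negligible[OF assms] by simp
qed

lemma NM_pos: "emeasure NM (space NM) > 0"
proof -
  define V where "V = {p :: r3. 0 < coord_m (fst p) (fst (snd p))} \<inter> {p. coord_m (fst p) (fst (snd p)) < 1}
    \<inter> {p. 0 < coord_n (fst p) (fst (snd p))} \<inter> {p. coord_n (fst p) (fst (snd p)) < 1} \<inter> {p. 0 < snd (snd p)} \<inter> {p. snd (snd p) < 1}"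
  have "open V" unfolding V_def by (intro open_Int open_Collect_less continuous_on_coord continuous_intros)
  moreover have "(1/2 + 1/2 * t1, 1/2 + 1/2 * t2, 1/2) \<in> V" unfolding V_def by (simp only: Int_iff mem_Collect_eq fst_conv snd_conv coord_lattice) simp
  ultimately have "emeasure lborel V > 0" by (intro open_pos_lborel) auto
  also have "emeasure lborel V \<le> emeasure lborel D0"
    using fdom_D0 by (intro emeasure_mono) (auto simp: V_def D0_def fdom_def)
  also have "emeasure lborel D0 = emeasure NM (space NM)"
    using emeasure_NM[OF sets.top[of NM, unfolded sets_NM] fdom_D0] by (simp add: vimage_def)
  finally show ?thesis .
qed

lemma drifting_borel: "drifting \<in> sets borel"
proof -
  have "drifting = S2 \<inter> {p. 0 < snd (snd p)} \<inter> {p. (fst p)\<^sup>2 + 2 * (fst (snd p))\<^sup>2 \<le> 3 / 4}"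
    by (auto simp: drifting_def)
  also have "\<dots> \<in> sets borel"
    by (intro sets.Int S2_borel borel_open[OF open_Collect_less] borel_closed[OF closed_Collect_le] continuous_intros)
  finally show ?thesis .
qed

lemma SM_drifting: "Jm ` drifting \<in> sets SM" "emeasure SM (Jm ` drifting) > 0"
proof -
  show 1: "Jm ` drifting \<in> sets SM"
    unfolding sets_SM inj_vimage_image_eq[OF inj_Jm] using drifting_borel drifting_S2 by blast
  \<comment> \<open>An open piece of the cone over the cap: multiplying the bound
    \<open>3 / 4\<close> by the squared norm makes the condition homogeneous, so that it survives
    normalisation by \<open>sgn\<close>.\<close>
  define V where "V = {p :: r3. norm p < 1} \<inter> {p. 0 < snd (snd p)} \<inter> {p. (fst p)\<^sup>2 + 2 * (fst (snd p))\<^sup>2 < 3 / 4 * (norm p)\<^sup>2}"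
  have "open V" unfolding V_def by (intro open_Int open_Collect_less continuous_intros)
  moreover have "(0, 0, 1/2) \<in> V" by (simp add: V_def norm_r3 power2_eq_square)
  ultimately have "0 < emeasure lborel V" by (intro open_pos_lborel) auto
  also have "V \<subseteq> {p \<in> cball 0 1 - {0}. sgn p \<in> drifting}"
  proof
    fix p assume p: "p \<in> V"
    obtain x y e where pe: "p = (x, y, e)" by (cases p)
    have n: "norm p < 1" "0 < e" "x\<^sup>2 + 2 * y\<^sup>2 < 3 / 4 * (norm p)\<^sup>2" using p unfolding V_def pe by auto
    have p0: "p \<noteq> 0" using n(2) pe by (auto simp: zero_prod_def)
    then have np: "norm p > 0" by simp
    have s: "sgn p = (x / norm p, y / norm p, e / norm p)" by (simp add: sgn_div_norm pe divide_inverse mult.commute)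
    have "sgn p \<in> S2" using p0 by (simp add: S2_eq_sphere norm_sgn)
    moreover have "(x / norm p)\<^sup>2 + 2 * (y / norm p)\<^sup>2 \<le> 3 / 4"
    proof -
      have "(x / norm p)\<^sup>2 + 2 * (y / norm p)\<^sup>2 = (x\<^sup>2 + 2 * y\<^sup>2) / (norm p)\<^sup>2" by (simp add: power_divide add_divide_distrib)
      also have "\<dots> \<le> 3 / 4" using n(3) np by (subst pos_divide_le_eq) auto
      finally show ?thesis .
    qed
    ultimately have "sgn p \<in> drifting" using n(2) np unfolding s drifting_def by simp
    then show "p \<in> {p \<in> cball 0 1 - {0}. sgn p \<in> drifting}" using n(1) p0 by simp
  qed
  then have "emeasure lborel V \<le> emeasure lborel {p \<in> cball 0 1 - {0}. sgn p \<in> drifting}"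
  proof (rule emeasure_mono)
    have "sgn -` drifting \<inter> (cball 0 1 - {0}) \<in> sets (restrict_space lborel (cball (0::r3) 1 - {0}))"
    proof -
      have "drifting \<in> sets (restrict_space borel S2)" using drifting_borel drifting_S2 by (simp add: sets_restrict_S2 subsetI del: split_paired_All)
      from measurable_sets[OF sgn_measurable this] show ?thesis by (simp add: space_restrict_space)
    qed
    then have "sgn -` drifting \<inter> (cball 0 1 - {0}) \<in> sets lborel" by (subst (asm) sets_restrict_space_iff) auto
    moreover have "sgn -` drifting \<inter> (cball 0 1 - {0}) = {p \<in> cball 0 1 - {0}. sgn p \<in> drifting}" by blast
    ultimately show "{p \<in> cball 0 1 - {0}. sgn p \<in> drifting} \<in> sets lborel" by simp
  qed
  also have "\<dots> = emeasure cone_measure drifting"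
    by (rule emeasure_cone_measure[OF drifting_borel, symmetric]) (use drifting_S2 in blast)
  finally have "0 < emeasure cone_measure drifting" .
  then show "emeasure SM (Jm ` drifting) > 0"
    unfolding emeasure_SM[OF 1] inj_vimage_image_eq[OF inj_Jm] by (simp add: ennreal_zero_less_mult_iff)
qed

lemma emeasure_SNM_Times: "A \<in> sets NB \<Longrightarrow> B \<in> sets SM \<Longrightarrow> emeasure SNM (A \<times> B) = emeasure NM A * emeasure SM B"
  unfolding SNmeasure_def using pair_sigma_NM_SM
  by (intro sigma_finite_measure.emeasure_pair_measure_Times) (auto simp: pair_sigma_finite_def)

lemma finite_measure_SNM: "finite_measure SNM"
proof (rule finite_measureI)
  have "emeasure SNM (space SNM) = emeasure NM (space NM) * emeasure SM (space SM)"
    unfolding space_SNM using emeasure_SNM_Times[OF sets.top[of NM, unfolded sets_NM] sets.top[of SM]] by simp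
  also have "\<dots> \<noteq> \<infinity>"
    using finite_measure.emeasure_finite[OF finite_measure_NM] finite_measure.emeasure_finite[OF finite_measure_SM]
    by (simp add: ennreal_mult_eq_top_iff)
  finally show "emeasure SNM (space SNM) \<noteq> \<infinity>" .
qed

lemma label_measurable: "label \<in> measurable SNM (count_space UNIV)"
proof -
  have s: "(\<lambda>x. sec (fst x)) \<in> measurable SNM borel"
    unfolding SNmeasure_def
    by (rule measurable_compose[OF measurable_fst]) (use sec_measurable measurable_cong_sets[OF sets_NM refl] in blast)
  have c: "(\<lambda>p::r3. coord_n (fst p) (fst (snd p))) \<in> borel_measurable borel"
    by (intro borel_measurable_continuous_onI continuous_on_coord continuous_intros)
  have f: "(\<lambda>x. nat \<lfloor>4 * coord_n (fst (sec (fst x))) (fst (snd (sec (fst x))))\<rfloor>) \<in> measurable SNM (count_space UNIV)"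
  proof -
    have "(\<lambda>x. 4 * coord_n (fst (sec (fst x))) (fst (snd (sec (fst x))))) \<in> borel_measurable SNM"
      using measurable_compose[OF s c] by simp
    from measurable_compose[OF measurable_compose[OF this measurable_real_floor], of nat "count_space UNIV"]
    show ?thesis by simp
  qed
  have "{x \<in> space SNM. Jinv (snd x) \<in> drifting} \<in> sets SNM"
  proof -
    have "{x \<in> space SNM. Jinv (snd x) \<in> drifting} = range quo \<times> Jm ` drifting"
      unfolding space_SNM using drifting_S2 by force
    also have "\<dots> \<in> sets SNM" unfolding SNmeasure_def
      using sets.top[of NM] SM_drifting(1) by (intro pair_measureI) simp_all
    finally show ?thesis .
  qed
  then show ?thesis unfolding label_def[abs_def] by (intro measurable_If f) simp_all
qed

lemma label_le4: "x \<in> space SNM \<Longrightarrow> label x \<le> 4"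
proof -
  assume "x \<in> space SNM"
  then have "fst x \<in> range quo" by (auto simp: space_SNM)
  from sec_coord_bounds[OF this] show ?thesis unfolding label_def by (auto simp: nat_le_iff floor_le_iff)
qed

lemma simple_function_label: "simple_function SNM label"
  unfolding simple_function_def
proof (intro conjI ballI)
  have "label ` space SNM \<subseteq> {..4}" using label_le4 by blast
  then show "finite (label ` space SNM)" by (rule finite_subset) simp
  show "label -` {x} \<inter> space SNM \<in> sets SNM" for x by (rule measurable_sets[OF label_measurable]) simp
qed

lemma contraction_nonneg: "0 \<le> contraction m" by (simp add: contraction_def)

text \<open>Fubini on \<open>D0\<close>: for fixed second coordinate and height, the first
  coordinates of the atom form a separated set of length at most \<open>24 * contraction m\<close>.
  The rectangle \<open>[- 3, 3] \<times> [0, 1]\<close> of the remaining coordinates has area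
  6.\<close>

lemma itinerary_fibre_measure:
  assumes z: "z \<in> drifting" and m: "m \<ge> 1"
    and A: "A = {C \<in> range quo. itinerary (flow 1) label m (C, Jm z) = w}" and As: "A \<in> sets NB"
  shows "emeasure NM A \<le> ennreal (144 * contraction m)"
proof -
  let ?E = "D0 \<inter> quo -` A"
  have E: "?E \<in> sets (lborel \<Otimes>\<^sub>M lborel)"
  proof -
    have "?E \<in> sets lborel" using As fdom_D0 by (auto simp: sets_NB_iff fdom_def)
    then show ?thesis by (simp only: lborel_prod)
  qed
  have "emeasure NM A = emeasure lborel ?E" by (rule emeasure_NM[OF As fdom_D0])
  also have "\<dots> = emeasure (lborel \<Otimes>\<^sub>M lborel) ?E" by (simp add: lborel_prod)
  also have "\<dots> = (\<integral>\<^sup>+y. emeasure lborel ((\<lambda>x. (x, y)) -` ?E) \<partial>lborel)"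
    by (rule pair_sigma_finite.emeasure_pair_measure_alt2[OF lborel_pair_sigma E])
  also have "\<dots> \<le> (\<integral>\<^sup>+y. ennreal (24 * contraction m) * indicator (cbox (-3 :: real, 0 :: real) (3, 1)) y \<partial>lborel)"
  proof (rule nn_integral_mono)
    fix y :: "real \<times> real"
    obtain b u where y: "y = (b, u)" by (cases y)
    show "emeasure lborel ((\<lambda>x. (x, y)) -` ?E) \<le> ennreal (24 * contraction m) * indicator (cbox (-3 :: real, 0 :: real) (3, 1)) y"
    proof (cases "(\<lambda>x. (x, y)) -` ?E = {}")
      case False
      then obtain a0 where a0: "(a0, b, u) \<in> D0" unfolding y by auto
      then have u: "0 \<le> u" "u < 1" by (auto simp: D0_def)
      have bx: "(b, u) \<in> cbox (-3 :: real, 0 :: real) (3, 1)" using D0_bounded a0 by auto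
      have "emeasure lborel ((\<lambda>x. (x, y)) -` ?E) \<le> ennreal (24 * contraction m)"
      proof (rule separated_set_measure)
        show "(\<lambda>x. (x, y)) -` ?E \<in> sets borel" using sets_Pair2[OF E, of y] by simp
        show "(\<lambda>x. (x, y)) -` ?E \<subseteq> {-3..3}" using D0_bounded unfolding y by auto
        fix x x' assume x: "x \<in> (\<lambda>x. (x, y)) -` ?E" "x' \<in> (\<lambda>x. (x, y)) -` ?E" "\<bar>x - x'\<bar> \<le> 1 / 2"
        then have "itinerary (flow 1) label m (quo (x, b, u), Jm z) = itinerary (flow 1) label m (quo (x + (x' - x), b, u), Jm z)"
          unfolding A y by simp
        from itinerary_separation[OF z u m _ this] x(3)
        show "\<bar>x - x'\<bar> \<le> contraction m" by (simp add: abs_minus_commute)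
      qed (rule contraction_nonneg)
      then show ?thesis using bx y by simp
    qed simp
  qed
  also have "\<dots> = ennreal (24 * contraction m) * emeasure lborel (cbox (-3 :: real, 0 :: real) (3, 1))"
    by (rule nn_integral_cmult_indicator) simp
  also have "emeasure lborel (cbox (-3 :: real, 0 :: real) (3, 1)) = ennreal 6"
    unfolding cbox_Pair_eq by (subst emeasure_lborel_Times) (auto simp: ennreal_mult'[symmetric])
  also have "ennreal (24 * contraction m) * ennreal 6 = ennreal (144 * contraction m)"
    using contraction_nonneg[of m] by (subst ennreal_mult'[symmetric]) simp_all
  finally show ?thesis .
qed

lemma entropy_positive: "0 < flow_entropy SNM flow"
proof -
  interpret N: finite_measure SNM by (rule finite_measure_SNM)
  define V where "V = measure SNM (space SNM)"
  define A where "A = range quo \<times> Jm ` drifting"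
  have As: "A \<in> sets SNM" unfolding A_def SNmeasure_def
    using sets.top[of NM] SM_drifting(1) by (intro pair_measureI) simp_all
  have Asub: "A \<subseteq> space SNM" using As by (rule sets.sets_into_space)
  have "emeasure SNM A = emeasure NM (space NM) * emeasure SM (Jm ` drifting)"
    unfolding A_def using emeasure_SNM_Times[OF sets.top[of NM, unfolded sets_NM] SM_drifting(1)] by simp
  then have "emeasure SNM A > 0" using NM_pos SM_drifting(2) by (simp add: ennreal_zero_less_mult_iff)
  then have mA: "measure SNM A > 0" by (simp add: N.emeasure_eq_measure)
  have V: "V > 0" using mA N.finite_measure_mono[OF Asub sets.top] unfolding V_def by linarith
  define M where "M = uniform_measure SNM (space SNM)"
  have spM: "space M = space SNM" and stM: "sets M = sets SNM" by (simp_all add: M_def)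
  have Ve: "emeasure SNM (space SNM) = ennreal V" by (simp add: V_def N.emeasure_eq_measure)
  interpret M: prob_space M unfolding M_def
    by (rule prob_space_uniform_measure) (use V Ve in auto)
  have eM: "emeasure M B = emeasure SNM B / ennreal V" if "B \<in> sets SNM" for B
    using that sets.sets_into_space[OF that] unfolding M_def
    by (subst emeasure_uniform_measure) (auto simp: Ve Int_absorb1)
  have mM: "measure M B = measure SNM B / V" if "B \<in> sets SNM" for B
    using eM[OF that] V by (simp add: M.emeasure_eq_measure N.emeasure_eq_measure divide_ennreal measure_nonneg)
  have T: "preserves M (flow 1)"
    unfolding preserves_def
  proof
    have fp: "flow 1 \<in> measurable SNM SNM" using flow_preserves by (simp add: preserves_def)
    show m: "flow 1 \<in> measurable M M" using fp measurable_cong_sets[OF stM stM] by blast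
    show "distr M M (flow 1) = M"
    proof (rule measure_eqI)
      fix B assume "B \<in> sets (distr M M (flow 1))"
      then have B: "B \<in> sets SNM" by (simp add: stM)
      have "emeasure (distr M M (flow 1)) B = emeasure M (flow 1 -` B \<inter> space SNM)"
        using emeasure_distr[OF m, of B] B by (simp add: stM spM)
      also have "\<dots> = emeasure M B"
        using eM[OF measurable_sets[OF fp B]] eM[OF B] preserves_emeasure[OF flow_preserves B, of 1] by simp
      finally show "emeasure (distr M M (flow 1)) B = emeasure M B" .
    qed simp
  qed
  have P: "simple_function M label" using simple_function_label unfolding simple_function_def spM stM .
  define S where "S = measure SM (space SM)"
  have Se: "emeasure SM (space SM) = ennreal S" unfolding S_def by (rule finite_measure.emeasure_eq_measure[OF finite_measure_SM])
  have "0 < emeasure SM (space SM)"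
    using SM_drifting emeasure_mono[OF sets.sets_into_space[OF SM_drifting(1)] sets.top] by (metis order_less_le_trans)
  then have S: "S > 0" unfolding Se by simp
  \<comment> \<open>The factor of \<open>contraction m\<close> that does not depend on
    \<open>m\<close>, times the fibre bound \<open>144\<close>, the total mass \<open>S\<close> of
    the sphere and the normalisation \<open>1 / V\<close>; the factor that depends on
    \<open>m\<close> is left to \<open>c\<close>.\<close>
  define K where "K = 144 * (sqrt 5 / 4 * exp (- 3 / 2 * l1)) * S / V"
  have K: "K > 0" using S V by (simp add: K_def)
  define c where "c = - l1 / 2"
  have c: "c > 0" using exp_l1_bounds(1) by (simp add: c_def)
  \<comment> \<open>Itineraries of points that start in the drifting part: the label
    \<open>4\<close> is reserved for its complement, so the first letter decides membership in
    \<open>A\<close>.\<close>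
  define G where "G = (\<lambda>m::nat. {w :: nat list. w ! 0 \<noteq> 4 \<and> length w = m})"
  have lab4: "label x \<noteq> 4 \<longleftrightarrow> x \<in> A" if "x \<in> space SNM" for x
  proof -
    have x: "fst x \<in> range quo" "snd x \<in> Jm ` S2" using that by (auto simp: space_SNM)
    have "nat \<lfloor>4 * coord_n (fst (sec (fst x))) (fst (snd (sec (fst x))))\<rfloor> < 4"
      using sec_coord_bounds[OF x(1)] by (simp add: nat_less_iff floor_less_iff)
    moreover have "x \<in> A \<longleftrightarrow> Jinv (snd x) \<in> drifting" using x unfolding A_def by (cases x) auto
    ultimately show ?thesis by (simp add: label_def)
  qed
  have "0 < metric_entropy M (flow 1)"
  proof (rule M.metric_entropy_pos[OF T P K c])
    show "0 < measure M A" using mM[OF As] mA V by simp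
    fix m :: nat assume m: "1 \<le> m"
    have it0: "itinerary (flow 1) label m x ! 0 = label x" for x using itinerary_nth[of 0 m "flow 1" label x] m by simp
    have len: "length (itinerary (flow 1) label m x) = m" for x by (simp add: itinerary_def)
    have "itinerary (flow 1) label m x \<in> G m \<longleftrightarrow> x \<in> A" if "x \<in> space SNM" for x
      unfolding G_def using lab4[OF that] by (simp add: it0 len)
    then show "itinerary (flow 1) label m -` G m \<inter> space M = A" using Asub unfolding spM by blast
    fix w assume w: "w \<in> G m"
    let ?B = "itinerary (flow 1) label m -` {w} \<inter> space SNM"
    have B: "?B \<in> sets SNM"
      using simple_functionD(2)[OF M.simple_function_itinerary[OF T P, of m], of "{w}"] by (simp add: spM stM)
    \<comment> \<open>The atom is sliced over the points of the sphere. Slices over drifting points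
      obey the fibre bound, and the others are empty because their first label would be
      \<open>4\<close>.\<close>
    have "emeasure SNM ?B = (\<integral>\<^sup>+z. emeasure NM ((\<lambda>C. (C, z)) -` ?B) \<partial>SM)"
      using pair_sigma_finite.emeasure_pair_measure_alt2[OF pair_sigma_NM_SM] B unfolding SNmeasure_def by blast
    also have "\<dots> \<le> (\<integral>\<^sup>+z. ennreal (144 * contraction m) \<partial>SM)"
    proof (rule nn_integral_mono)
      fix z assume "z \<in> space SM"
      then obtain p where p: "p \<in> S2" "z = Jm p" by auto
      have s: "(\<lambda>C. (C, z)) -` ?B \<in> sets NB" using sets_Pair2[of ?B NM SM z] B unfolding SNmeasure_def by simp
      show "emeasure NM ((\<lambda>C. (C, z)) -` ?B) \<le> ennreal (144 * contraction m)"
      proof (cases "p \<in> drifting")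
        case True
        have "(\<lambda>C. (C, z)) -` ?B = {C \<in> range quo. itinerary (flow 1) label m (C, Jm p) = w}"
          unfolding space_SNM p(2) using p(1) by (auto simp del: split_paired_All split_paired_Ex)
        then show ?thesis using itinerary_fibre_measure[OF True m] s by blast
      next
        case False
        have "(\<lambda>C. (C, z)) -` ?B = {}"
        proof (rule equals0I)
          fix C assume "C \<in> (\<lambda>C. (C, z)) -` ?B"
          then have C: "(C, z) \<in> space SNM" "itinerary (flow 1) label m (C, z) = w" by auto
          then have "label (C, z) \<noteq> 4" using w it0[of "(C, z)"] by (simp add: G_def)
          then have "z \<in> Jm ` drifting" using lab4[OF C(1)] by (simp add: A_def)
          then show False using False p by auto
        qed
        then show ?thesis by simp
      qed
    qed
    also have "\<dots> = ennreal (144 * contraction m * S)"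
      unfolding nn_integral_const Se using contraction_nonneg[of m] by (subst ennreal_mult'[symmetric]) simp_all
    finally have "measure SNM ?B \<le> 144 * contraction m * S"
      using contraction_nonneg[of m] S by (simp add: N.emeasure_eq_measure)
    then have "measure M ?B \<le> 144 * contraction m * S / V" using mM[OF B] V by (simp add: divide_right_mono)
    also have "\<dots> = K * exp (- c * real m)" by (simp add: K_def contraction_def c_def)
    finally show "measure M (itinerary (flow 1) label m -` {w} \<inter> space M) \<le> K * exp (- c * real m)" by (simp add: spM)
  qed
  then show ?thesis by (simp add: flow_entropy_def M_def)
qed

theorem theorem9p1:
  shows "\<exists>(n::nat) (L :: rvec \<Rightarrow> rvec) (\<Lambda> :: rvec set) (F :: rvec \<Rightarrow> rvec).
    linear_op n L \<and> full_rank_lattice n \<Lambda> \<and> exp_op n L 1 ` \<Lambda> = \<Lambda> \<and> linear_op n F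
    \<and> preserves_measure (SNflow n L F \<Lambda>) (SNmeasure n L \<Lambda>)
    \<and> semi_integrable (SNtop n L \<Lambda>) (SNflow n L F \<Lambda>)
    \<and> 0 < flow_entropy (SNmeasure n L \<Lambda>) (SNflow n L F \<Lambda>)"
proof -
  have "preserves_measure flow SNM"
    using flow_preserves by (simp add: preserves_measure_def preserves_def)
  then show ?thesis
    using linear_op_Lop full_rank_golden_lattice exp_op_golden_lattice linear_op_Fop semi_integrable_flow entropy_positive
    by blast
qed

end
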